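(* Let $v$ and $k$ be positive integers with $v+k$ even. Let $b_1,\dots,b_v\in\{1,2,3,6\}$ and $c_1,\dots,c_k\in\{1,2,3,4,6\}$, and put ${\bf h}=c_1+\cdots+c_k$ and $M=\mathrm{lcm}\big[4\,\mathrm{lcm}(b_1,\dots,b_v),\,2\,\mathrm{lcm}(c_1,\dots,c_k)\big]$. Define $$\psi_{s,t}(\tau)=\prod_{i=1}^v\theta(b_i\tau)\prod_{j=1}^k\Psi(c_j\tau),$$ where $\theta(\tau)=\sum_{n\in\mathbb Z}q^{n^2}$, $\Psi(\tau)=\sum_{n\ge0}q^{n(n+1)/2}$, $q=e^{2\pi i\tau}$. Then $q^{{\bf h}/8}\psi_{s,t}(\tau)$ is a modular form in $M_{(v+k)/2}(\Gamma_0(M),\chi'')$ if, and only if, ${\bf h}\equiv 0\pmod 8$, where $$\chi''=\begin{cases}\left(\frac{(-1)^{(v+k)/2}\,4\prod_{i=1}^v b_i\prod_{j=1}^k c_j}{\cdot}\right), & v,k\text{ even},\\[2mm] \left(\frac{(-1)^{(v+k)/2}\,8\prod_{i=1}^v b_i\prod_{j=1}^k c_j}{\cdot}\right), & v,k\text{ odd}.\end{cases}$$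
   Context: $\psi_{s,t}$ is the generating function of the number of representations of $n$ by $\sum_{i=1}^v b_iy_i^2+\sum_{j=1}^k c_j z_j(z_j+1)/2$ with $y_i\in\mathbb Z$, $z_j\in\mathbb Z_{\ge0}$. $M_w(\Gamma_0(M),\chi'')$ is the space of holomorphic modular forms of weight $w$ on $\Gamma_0(M)$ with character $\chi''$; $\left(\frac{m}{\cdot}\right)$ is the Kronecker symbol. *)

theory Defs
  imports "HOL-Complex_Analysis.Complex_Analysis" "HOL-Number_Theory.Number_Theory"
begin

definition upper_half_plane :: "complex set" where
  "upper_half_plane = {\<tau>. Im \<tau> > 0}"

text \<open>\<open>q_pow \<tau> r\<close> is $q^r = e^{2\pi i r\tau}$, also for fractional exponents.\<close>

definition q_pow :: "complex \<Rightarrow> real \<Rightarrow> complex" where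
  "q_pow \<tau> r = exp (2 * of_real pi * \<i> * of_real r * \<tau>)"

definition theta :: "complex \<Rightarrow> complex" where
  "theta \<tau> = (\<Sum>\<^sub>\<infinity>n::int. q_pow \<tau> ((of_int n)\<^sup>2))"

definition Psi :: "complex \<Rightarrow> complex" where
  "Psi \<tau> = (\<Sum>n. q_pow \<tau> (real n * (real n + 1) / 2))"

definition psi_prod :: "nat \<Rightarrow> (nat \<Rightarrow> nat) \<Rightarrow> nat \<Rightarrow> (nat \<Rightarrow> nat) \<Rightarrow> complex \<Rightarrow> complex" where
  "psi_prod v b k c \<tau> =
     (\<Prod>i=1..v. theta (of_nat (b i) * \<tau>)) * (\<Prod>j=1..k. Psi (of_nat (c j) * \<tau>))"

definition kronecker_prime :: "int \<Rightarrow> int \<Rightarrow> int" where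
  "kronecker_prime a p =
     (if p = 2 then (if even a then 0 else if a mod 8 \<in> {1, 7} then 1 else -1)
      else Legendre a p)"

text \<open>The factor at the unit $-1$ is $(a/{-1}) = -1$ for $a < 0$ and $1$ otherwise;
  elements of \<open>prime_factorization n\<close> are positive.\<close>

definition kronecker :: "int \<Rightarrow> int \<Rightarrow> int" where
  "kronecker a n =
     (if n = 0 then (if \<bar>a\<bar> = 1 then 1 else 0)
      else (if n < 0 \<and> a < 0 then -1 else 1) *
           (\<Prod>p\<in>#prime_factorization n. kronecker_prime a p))"

definition SL2Z :: "(int ^ 2 ^ 2) set" where
  "SL2Z = {A. det A = 1}"

definition Gamma0 :: "nat \<Rightarrow> (int ^ 2 ^ 2) set" where
  "Gamma0 N = {A \<in> SL2Z. int N dvd A $ 2 $ 1}"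

definition automorphy_factor :: "int ^ 2 ^ 2 \<Rightarrow> complex \<Rightarrow> complex" where
  "automorphy_factor A \<tau> = of_int (A $ 2 $ 1) * \<tau> + of_int (A $ 2 $ 2)"

definition moebius :: "int ^ 2 ^ 2 \<Rightarrow> complex \<Rightarrow> complex" where
  "moebius A \<tau> = (of_int (A $ 1 $ 1) * \<tau> + of_int (A $ 1 $ 2)) / automorphy_factor A \<tau>"

definition slash :: "int \<Rightarrow> (complex \<Rightarrow> complex) \<Rightarrow> int ^ 2 ^ 2 \<Rightarrow> complex \<Rightarrow> complex" where
  "slash w f A \<tau> = automorphy_factor A \<tau> powi (- w) * f (moebius A \<tau>)"

text \<open>Some period \<open>N\<close> of \<open>f\<close> makes \<open>f\<close> a function of $q^{1/N}$ on the punctured unit disc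
  that extends holomorphically to $q^{1/N} = 0$.\<close>

definition holomorphic_at_ii_inf :: "(complex \<Rightarrow> complex) \<Rightarrow> bool" where
  "holomorphic_at_ii_inf f \<longleftrightarrow>
     (\<exists>N::nat. N > 0 \<and> (\<exists>g. g holomorphic_on ball 0 1 \<and>
        (\<forall>\<tau>\<in>upper_half_plane. f \<tau> = g (q_pow \<tau> (1 / real N)))))"

text \<open>Only the values of \<open>f\<close> on the upper half-plane matter, and only the values of
  \<open>\<epsilon>\<close> at integers coprime to \<open>N\<close>. Letting \<open>A\<close> range over all of \<open>SL2Z\<close> in the last
  condition covers every cusp.\<close>

definition modular_forms ::
    "int \<Rightarrow> nat \<Rightarrow> (int \<Rightarrow> complex) \<Rightarrow> (complex \<Rightarrow> complex) set" where
  "modular_forms w N \<epsilon> =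
     {f. f holomorphic_on upper_half_plane \<and>
         (\<forall>A\<in>Gamma0 N. \<forall>\<tau>\<in>upper_half_plane.
            f (moebius A \<tau>) = \<epsilon> (A $ 2 $ 2) * automorphy_factor A \<tau> powi w * f \<tau>) \<and>
         (\<forall>A\<in>SL2Z. holomorphic_at_ii_inf (slash w f A))}"

end

theory Submission
  imports Defs "HOL-Probability.Characteristic_Functions"
begin

text \<open>
  Up to a power of \<open>2\<close>, the function is a product of the \<open>v + k\<close> series
  \<open>\<Sum>n. q^(b n\<^sup>2)\<close> and \<open>\<Sum>n odd. q^(c n\<^sup>2 / 8)\<close>. For \<open>A = (a, \<beta>; c, d)\<close> in \<open>\<Gamma>\<^sub>0(M)\<close> with \<open>d > 0\<close>, write
  \<open>A\<tau> = \<beta>/d + \<sigma>\<close> with \<open>\<sigma> = \<tau> / (d (c\<tau> + d))\<close>, so that \<open>-1/\<sigma> = -d\<^sup>2/\<tau> - c d\<close>. Poisson summation in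
  \<open>\<sigma>\<close>, completing the square modulo \<open>d\<close>, and Poisson summation back to \<open>\<tau>\<close> multiply each factor by a
  quadratic Gauss sum modulo \<open>d\<close> and by one square root that is common to all factors.
  Gauss sums satisfy \<open>G(u\<beta>, d) = (u/d) G(\<beta>, d)\<close> and \<open>G(\<beta>, d)\<^sup>2 = (-1/d) d\<close>, which yields the
  character without quadratic reciprocity. The odd series contribute in addition
  the root of unity \<open>exp(2\<pi>i h \<beta> d / 8)\<close>, which is \<open>1\<close> when \<open>8\<close> divides \<open>h\<close>. Writing \<open>A\<tau> = a/c + \<sigma>\<close> instead
  gives the expansions at the cusps. Conversely, \<open>\<tau> \<mapsto> \<tau> + 1\<close> multiplies the function by
  \<open>exp(2\<pi>i h / 8)\<close>, and the function is positive at \<open>\<tau> = i\<close>.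
\<close>

section \<open>Additive characters and sums over the integers\<close>

text \<open>No half-integral weight multiplier is ever evaluated. All factors carry the same square
  roots and the same Gauss sum, and \<open>v + k\<close> is even, so only squares of these occur:
  neither a branch of the root nor the argument of a Gauss sum has to be determined.

  The exponent 1/8 is what makes the triangular numbers quadratic: n(n+1)/2 + 1/8 = (2n+1)^2 / 8.
  Both kinds of factor then are theta series with periodic coefficients, and a single inversion
  formula serves them.

  The level enters when squares are completed modulo \<open>d\<close>. From 4b | c, respectively 2e
  | c, the determinant relation makes c/(4b), respectively c/(2e), an explicit inverse of -4B,
  respectively -2B, modulo \<open>d\<close>, where \<open>B\<close> is the scaled upper right entry.
  Since the level is even, \<open>d\<close> is odd, so the symbol at the prime 2 never occurs.
  Negative \<open>d\<close> is reached through \<open>-A\<close>; the sign of the automorphy factor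
  is then matched by the sign of the discriminant in the Kronecker symbol.

  Poisson summation is needed only for Gaussians at real shifts. It rests on a pointwise uniqueness
  statement for Fourier coefficients of Lipschitz functions.\<close>

definition ee :: "real \<Rightarrow> complex" where
  "ee x = cis (2 * pi * x)"

lemma ee_add: "ee (x + y) = ee x * ee y"
  by (simp add: ee_def cis_mult ring_distribs)

lemma ee_0 [simp]: "ee 0 = 1"
  by (simp add: ee_def)

lemma ee_of_int [simp]: "ee (of_int n) = 1"
  by (simp add: ee_def)

lemma ee_1 [simp]: "ee 1 = 1"
  using ee_of_int[of 1] by simp

lemma norm_ee [simp]: "norm (ee x) = 1"
  by (simp add: ee_def)

lemma ee_sum: "finite A \<Longrightarrow> ee (\<Sum>j\<in>A. f j) = (\<Prod>j\<in>A. ee (f j))"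
  by (induction rule: finite_induct) (simp_all add: ee_add)

lemma ee_power: "ee x ^ n = ee (of_nat n * x)"
  by (simp add: ee_def Complex.DeMoivre mult_ac)

lemma ee_conv_exp: "ee x = exp (2 * of_real pi * \<i> * of_real x)"
  by (simp add: ee_def cis_conv_exp mult_ac)

lemma continuous_on_ee [continuous_intros]:
  "continuous_on S f \<Longrightarrow> continuous_on S (\<lambda>x. ee (f x))"
  unfolding ee_conv_exp by (intro continuous_intros)

lemma ee_eq_1_iff: "ee x = 1 \<longleftrightarrow> x \<in> \<int>"
proof
  assume "ee x = 1"
  hence "cos (2 * pi * x) = 1"
    by (auto simp: ee_def complex_eq_iff)
  then obtain n :: int where "2 * pi * x = of_int n * 2 * pi"
    by (auto simp: cos_one_2pi_int)
  hence "x = of_int n" by simp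
  thus "x \<in> \<int>" by simp
qed (auto elim!: Ints_cases)

section \<open>Majorants over the integers and termwise operations on series\<close>

lemma summable_on_geometric_int:
  fixes r :: real
  assumes "0 \<le> r" "r < 1"
  shows "(\<lambda>n::int. r ^ nat \<bar>n\<bar>) summable_on UNIV"
proof -
  have nat: "(\<lambda>n::nat. r ^ n) summable_on UNIV"
    using assms by (intro norm_summable_imp_summable_on) (auto simp: norm_power intro: summable_geometric)
  have 1: "(\<lambda>n::int. r ^ nat \<bar>n\<bar>) summable_on range int"
    by (subst summable_on_reindex) (use nat in \<open>auto simp: o_def\<close>)
  have 2: "(\<lambda>n::int. r ^ nat \<bar>n\<bar>) summable_on range (\<lambda>n. - int n)"
    by (subst summable_on_reindex) (use nat in \<open>auto simp: o_def inj_on_def\<close>)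
  have "n \<in> range int \<union> range (\<lambda>n. - int n)" for n
    by (cases n rule: int_cases2) auto
  hence "(UNIV :: int set) = range int \<union> range (\<lambda>n. - int n)"
    by blast
  with summable_on_union[OF 1 2] show ?thesis by simp
qed

lemma summable_on_exp_abs_int:
  fixes c :: real
  assumes "c > 0"
  shows "(\<lambda>n::int. exp (- c * \<bar>of_int n\<bar>)) summable_on UNIV"
proof -
  have "(\<lambda>n::int. exp (- c) ^ nat \<bar>n\<bar>) = (\<lambda>n::int. exp (- c * \<bar>of_int n\<bar>))"
    by (auto simp: fun_eq_iff exp_of_nat_mult [symmetric] mult_ac)
  with summable_on_geometric_int[of "exp (-c)"] assms show ?thesis
    by auto
qed

lemma abs_of_int_le_square: "\<bar>of_int n\<bar> \<le> (of_int n :: real)\<^sup>2"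
proof (cases "n = 0")
  case False
  hence "1 \<le> \<bar>of_int n :: real\<bar>" by linarith
  from mult_left_mono[OF this, of "\<bar>of_int n :: real\<bar>"] show ?thesis
    by (simp add: power2_eq_square)
qed simp

text \<open>The M-test gives uniform convergence along the net of finite index sets, and uniform
  limits commute with integration over a compact interval.\<close>

lemma integral_infsum:
  fixes f :: "'i \<Rightarrow> real \<Rightarrow> complex"
  assumes bound: "\<And>k x. x \<in> {a..b} \<Longrightarrow> norm (f k x) \<le> M k"
    and M: "M summable_on UNIV"
    and cont: "\<And>k. continuous_on {a..b} (f k)"
  shows "((\<lambda>k. integral {a..b} (f k)) has_sum integral {a..b} (\<lambda>x. \<Sum>\<^sub>\<infinity>k. f k x)) UNIV"
proof -
  have "uniform_limit {a..b} (\<lambda>X x. \<Sum>k\<in>X. f k x) (\<lambda>x. \<Sum>\<^sub>\<infinity>k. f k x) (finite_subsets_at_top UNIV)"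
    by (rule Weierstrass_m_test_general[OF _ M]) (use bound in auto)
  then obtain I J where IJ: "\<And>X. ((\<lambda>x. \<Sum>k\<in>X. f k x) has_integral I X) {a..b}"
    "((\<lambda>x. \<Sum>\<^sub>\<infinity>k. f k x) has_integral J) {a..b}" "(I \<longlongrightarrow> J) (finite_subsets_at_top UNIV)"
    by (rule uniform_limit_integral) (auto intro!: continuous_intros cont)
  have I: "I X = (\<Sum>k\<in>X. integral {a..b} (f k))" if "finite X" for X
    using IJ(1)[of X] that cont
    by (subst integral_sum [symmetric]) (auto intro: integrable_continuous_interval simp: integral_unique)
  have "((\<lambda>X. \<Sum>k\<in>X. integral {a..b} (f k)) \<longlongrightarrow> J) (finite_subsets_at_top UNIV)"
    using IJ(3) by (rule Lim_transform_eventually) (auto simp: I eventually_finite_subsets_at_top_weakI)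
  with IJ(2) show ?thesis
    by (simp add: has_sum_def integral_unique)
qed

text \<open>Holomorphy is local: a majorant on a closed ball makes the finite partial sums converge
  uniformly there, and uniform limits of holomorphic functions are holomorphic.\<close>

lemma holomorphic_on_infsum:
  fixes f :: "'i \<Rightarrow> complex \<Rightarrow> complex"
  assumes "open S"
    and hol: "\<And>k. f k holomorphic_on S"
    and bound: "\<And>K. compact K \<Longrightarrow> K \<subseteq> S \<Longrightarrow>
      \<exists>M. M summable_on UNIV \<and> (\<forall>k. \<forall>z\<in>K. norm (f k z) \<le> M k)"
  shows "(\<lambda>z. \<Sum>\<^sub>\<infinity>k. f k z) holomorphic_on S"
proof -
  have "\<exists>r>0. (\<lambda>z. \<Sum>\<^sub>\<infinity>k. f k z) holomorphic_on ball z r" if "z \<in> S" for z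
  proof -
    from that \<open>open S\<close> obtain r where r: "r > 0" "cball z r \<subseteq> S"
      using open_contains_cball by blast
    from bound[OF compact_cball r(2)] obtain M where M: "M summable_on UNIV"
      "\<And>k w. w \<in> cball z r \<Longrightarrow> norm (f k w) \<le> M k"
      by blast
    have lim: "uniform_limit (cball z r) (\<lambda>X w. \<Sum>k\<in>X. f k w) (\<lambda>w. \<Sum>\<^sub>\<infinity>k. f k w)
        (finite_subsets_at_top UNIV)"
      by (rule Weierstrass_m_test_general[OF _ M(1)]) (use M(2) in auto)
    have X: "continuous_on (cball z r) (\<lambda>w. \<Sum>k\<in>X. f k w) \<and> (\<lambda>w. \<Sum>k\<in>X. f k w) holomorphic_on ball z r" for X
    proof
      have "f k holomorphic_on cball z r" for k
        using hol r(2) by (rule holomorphic_on_subset)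
      thus "continuous_on (cball z r) (\<lambda>w. \<Sum>k\<in>X. f k w)"
        by (intro continuous_on_sum holomorphic_on_imp_continuous_on)
      have "f k holomorphic_on ball z r" for k
        using hol r(2) ball_subset_cball by (meson holomorphic_on_subset order_trans)
      thus "(\<lambda>w. \<Sum>k\<in>X. f k w) holomorphic_on ball z r"
        by (intro holomorphic_on_sum)
    qed
    have "(\<lambda>w. \<Sum>\<^sub>\<infinity>k. f k w) holomorphic_on ball z r"
      by (rule holomorphic_uniform_limit[OF always_eventually[OF allI[OF X]] lim]) auto
    with r show ?thesis by blast
  qed
  hence "(\<lambda>z. \<Sum>\<^sub>\<infinity>k. f k z) field_differentiable (at z)" if "z \<in> S" for z
    using that by (meson centre_in_ball holomorphic_on_imp_differentiable_at open_ball)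
  thus ?thesis
    by (auto simp: holomorphic_on_def intro: field_differentiable_at_within)
qed

section \<open>Uniqueness of Fourier coefficients\<close>

lemma integral_ee:
  fixes m :: int
  shows "integral {0..1} (\<lambda>x. ee (of_int m * x)) = (if m = 0 then 1 else 0)"
proof (cases "m = 0")
  case False
  have "((\<lambda>x. ee (of_int m * x)) has_integral
      (ee (of_int m * 1) / (2 * pi * \<i> * m) - ee (of_int m * 0) / (2 * pi * \<i> * m))) {0..1}"
    by (rule fundamental_theorem_of_calculus)
       (auto simp: ee_conv_exp False intro!: derivative_eq_intros has_vector_derivative_real_field)
  thus ?thesis
    using False by (simp add: integral_unique)
qed auto

lemma sin_pi_ge:
  fixes x :: real
  assumes "0 \<le> x" "x \<le> 1"
  shows "sin (pi * x) \<ge> min x (1 - x)"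
proof -
  have half: "sin (pi * y) \<ge> y" if "0 \<le> y" "y \<le> 1 / 2" for y :: real
  proof -
    have py: "0 \<le> pi * y" "pi * y \<le> pi * (1/2)"
      using that by (auto intro!: mult_left_mono)
    \<comment> \<open>The argument is thus at most 8/5, so the cubic error removes at most 32/75 of
      \<open>pi * y\<close>; the remaining 43/75, times pi at least 2, still exceeds 1.\<close>
    have "pi \<le> 16/5"
      using pi_approx(2) by simp
    hence "pi * y \<le> 8/5"
      using py(2) by linarith
    hence sq: "(pi * y)\<^sup>2 \<le> (8/5)\<^sup>2"
      using py by (intro power_mono) auto
    have "\<bar>sin (pi * y) - (\<Sum>m<3. sin_coeff m * (pi * y) ^ m)\<bar> \<le> inverse (fact 3) * \<bar>pi * y\<bar> ^ 3"
      by (rule Maclaurin_sin_bound)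
    hence "\<bar>sin (pi * y) - pi * y\<bar> \<le> (pi * y) ^ 3 / 6"
      using py by (simp add: sin_coeff_def numeral_eq_Suc)
    also have "(pi * y) ^ 3 / 6 = (pi * y) * (pi * y)\<^sup>2 / 6"
      by (simp add: power3_eq_cube power2_eq_square)
    also have "\<dots> \<le> (pi * y) * (8/5)\<^sup>2 / 6"
      by (intro divide_right_mono mult_left_mono sq py) auto
    finally have "sin (pi * y) \<ge> pi * y - pi * y * (8/5)\<^sup>2 / 6"
      by linarith
    moreover have "pi * y - pi * y * (8/5)\<^sup>2 / 6 \<ge> y"
    proof -
      have "2 * y \<le> pi * y" using that pi_approx by (intro mult_right_mono) auto
      thus ?thesis using py that by (simp add: power2_eq_square)
    qed
    ultimately show ?thesis by linarith
  qed
  show ?thesis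
  proof (cases "x \<le> 1 / 2")
    case False
    have "sin (pi * x) = sin (pi * (1 - x))"
      by (simp add: right_diff_distrib sin_diff)
    with half[of "1 - x"] False assms show ?thesis by auto
  qed (use half[of x] assms in auto)
qed

text \<open>The zeros of \<open>ee x - 1\<close> at the end points are simple, its modulus being
  \<open>2 * sin (pi * x)\<close>. Hence a Lipschitz function that vanishes at both ends stays
  bounded after division by it.\<close>

lemma norm_ee_minus_1_ge:
  fixes x :: real
  assumes "0 \<le> x" "x \<le> 1"
  shows "norm (ee x - 1) \<ge> min x (1 - x)"
proof -
  have "ee x - 1 = ee (x/2) * (ee (x/2) - cnj (ee (x/2)))"
    by (simp add: right_diff_distrib complex_norm_square [symmetric] flip: ee_add)
  also have "ee (x/2) - cnj (ee (x/2)) = complex_of_real (2 * sin (pi * x)) * \<i>"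
    by (simp add: ee_def complex_eq_iff)
  finally have "norm (ee x - 1) = 2 * \<bar>sin (pi * x)\<bar>"
    by (simp add: norm_mult)
  with sin_pi_ge[OF assms] show ?thesis by (simp add: assms)
qed

text \<open>The constant equals its Cesaro means, which tend to \<open>0\<close> by dominated convergence.\<close>

lemma constant_moments_zero:
  fixes h w :: "real \<Rightarrow> complex"
  assumes h: "h integrable_on {0..1}" and bound: "\<And>x. x \<in> {0..1} \<Longrightarrow> norm (h x) \<le> C"
    and int: "\<And>n. (\<lambda>x. h x * w x ^ n) integrable_on {0..1}"
    and w: "\<And>x. norm (w x) = 1" "\<And>x. x \<in> {0<..<1} \<Longrightarrow> w x \<noteq> 1"
    and const: "\<And>n. integral {0..1} (\<lambda>x. h x * w x ^ n) = c"
  shows "c = 0"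
proof -
  \<comment> \<open>The means are set to 0 at the end points: where \<open>w x = 1\<close> they
    would be constantly \<open>h x\<close> instead of tending to 0.\<close>
  define K where "K = (\<lambda>N x. (if x \<in> {0<..<1} then (\<Sum>n\<le>N. h x * w x ^ n) / of_nat (Suc N) else 0))"
  have hi: "((\<lambda>x. (\<Sum>n\<le>N. h x * w x ^ n) / of_nat (Suc N)) has_integral c) {0..1}" for N
  proof -
    have "((\<lambda>x. (\<Sum>n\<le>N. h x * w x ^ n)) has_integral (\<Sum>n\<le>N. c)) {0..1}"
      by (intro has_integral_sum) (use int const in \<open>auto simp: has_integral_iff\<close>)
    from has_integral_divide[OF this, of "of_nat (Suc N)"]
    show ?thesis by (simp del: of_nat_Suc)
  qed
  have K: "(K N has_integral c) {0..1}" for N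
    by (rule has_integral_spike_finite[OF _ _ hi[of N], of "{0, 1}"]) (auto simp: K_def)
  have lim: "(\<lambda>N. K N x) \<longlonglongrightarrow> 0" for x
  proof (cases "x \<in> {0<..<1}")
    case True
    have bd: "norm (K N x) \<le> norm (h x) * (2 / norm (w x - 1)) / real (Suc N)" for N
    proof -
      have "K N x = h x * ((\<Sum>n\<le>N. w x ^ n) / of_nat (Suc N))"
        using True by (simp add: K_def sum_distrib_left)
      \<comment> \<open>The geometric sum is bounded by \<open>2 / norm (w x - 1)\<close> for every
        \<open>N\<close>, so dividing by \<open>Suc N\<close> sends the mean to 0.\<close>
      also have "(\<Sum>n\<le>N. w x ^ n) = (w x ^ Suc N - 1) / (w x - 1)"
        using w(2)[OF True] geometric_sum[of "w x" "Suc N"] by (simp add: lessThan_Suc_atMost)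
      finally have "norm (K N x) = norm (h x) * (norm (w x ^ Suc N - 1) / norm (w x - 1) / real (Suc N))"
        by (simp add: norm_mult norm_divide del: of_nat_Suc power_Suc)
      also have "norm (w x ^ Suc N - 1) \<le> 2"
        by (rule order_trans[OF norm_triangle_ineq4]) (simp add: norm_power norm_mult w)
      finally show ?thesis
        by (simp add: divide_right_mono mult_left_mono)
    qed
    have lim0: "(\<lambda>N. norm (h x) * (2 / norm (w x - 1)) / real (Suc N)) \<longlonglongrightarrow> 0"
      by (intro real_tendsto_divide_at_top[OF tendsto_const]
            filterlim_compose[OF filterlim_real_sequentially filterlim_Suc])
    show ?thesis
      by (rule Lim_null_comparison[OF _ lim0]) (intro always_eventually allI bd)
  qed (auto simp: K_def)
  have bdd: "norm (K N x) \<le> C" if "x \<in> {0..1}" for N x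
  proof (cases "x \<in> {0<..<1}")
    case True
    have "norm (\<Sum>n\<le>N. h x * w x ^ n) \<le> (\<Sum>n\<le>N. C)"
      by (rule order_trans[OF norm_sum sum_mono]) (use bound that w in \<open>auto simp: norm_mult norm_power\<close>)
    thus ?thesis
      using True by (simp add: K_def norm_divide field_simps del: of_nat_Suc)
  next
    case False
    hence "K N x = 0" by (simp only: K_def if_False)
    thus ?thesis using order_trans[OF norm_ge_zero bound[OF that]] by simp
  qed
  have "(\<lambda>N. integral {0..1} (K N)) \<longlonglongrightarrow> integral {0..1} (\<lambda>x::real. 0::complex)"
    by (rule dominated_convergence[where h = "\<lambda>_. C"]) (use K bdd lim in \<open>auto simp: has_integral_iff\<close>)
  moreover have "integral {0..1} (K N) = c" for N
    using K by (simp add: integral_unique)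
  ultimately show "c = 0"
    by (simp add: LIMSEQ_const_iff)
qed

text \<open>With \<open>h = (D - D 0) / (ee - 1)\<close>, consecutive Fourier coefficients of \<open>h\<close> agree except
  across index \<open>0\<close>, where they jump by \<open>D 0\<close>.\<close>

lemma fourier_coeffs_zero_imp_zero:
  fixes D :: "real \<Rightarrow> complex"
  assumes cont: "continuous_on UNIV D" and per: "D 1 = D 0"
    and lip: "C-lipschitz_on {0..1} D"
    and coeff: "\<And>m::int. integral {0..1} (\<lambda>x. D x * ee (of_int m * x)) = 0"
  shows "D 0 = 0"
proof -
  \<comment> \<open>At integers the denominator is 0 and so \<open>h\<close> is 0 there by
    convention. Continuity may fail at these points, hence integrability is derived from
    measurability and boundedness.\<close>
  define h where "h = (\<lambda>x. (D x - D 0) / (ee x - 1))"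
  have meas: "h \<in> borel_measurable borel"
    unfolding h_def by (intro borel_measurable_divide borel_measurable_continuous_onI continuous_intros cont)
  have bound: "norm (h x) \<le> C" if "x \<in> {0..1}" for x
  proof (cases "x = 0 \<or> x = 1")
    case True
    thus ?thesis using lipschitz_on_nonneg[OF lip] by (auto simp: h_def)
  next
    case False
    with that have x: "0 < x" "x < 1" by auto
    have "norm (D x - D 0) \<le> C * x"
      using lipschitz_onD[OF lip, of x 0] x by (simp add: dist_norm)
    moreover have "norm (D x - D 0) \<le> C * (1 - x)"
      using lipschitz_onD[OF lip, of x 1] x by (simp add: dist_norm per)
    ultimately have "norm (D x - D 0) \<le> C * min x (1 - x)"
      by (simp add: min_def)
    also have "\<dots> \<le> C * norm (ee x - 1)"
      by (intro mult_left_mono norm_ee_minus_1_ge lipschitz_on_nonneg[OF lip]) (use x in auto)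
    finally have "norm (D x - D 0) \<le> C * norm (ee x - 1)" .
    moreover have "norm (ee x - 1) > 0"
      using norm_ee_minus_1_ge[of x] x by auto
    ultimately show ?thesis
      by (simp add: h_def norm_divide field_simps)
  qed
  have int: "(\<lambda>x. h x * g x) integrable_on {0..1}"
    if "continuous_on UNIV g" "\<And>x. norm (g x) = 1" for g
  proof (rule measurable_bounded_by_integrable_imp_integrable[where g = "\<lambda>_. C"])
    have "(\<lambda>x. h x * g x) \<in> borel_measurable borel"
      by (intro borel_measurable_times meas borel_measurable_continuous_onI that)
    thus "(\<lambda>x. h x * g x) \<in> borel_measurable (lebesgue_on {0..1})"
      by (intro measurable_restrict_space1 measurable_completion) simp
  qed (use bound that in \<open>auto simp: norm_mult\<close>)
  define H where "H = (\<lambda>m::int. integral {0..1} (\<lambda>x. h x * ee (of_int m * x)))"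
  have inth: "(\<lambda>x. h x * ee (of_int m * x)) integrable_on {0..1}" for m :: int
    by (intro int continuous_intros) auto
  have step: "H (m + 1) - H m = - (if m = 0 then D 0 else 0)" for m
  proof -
    have eq: "h x * ee (of_int (m + 1) * x) - h x * ee (of_int m * x)
              = D x * ee (of_int m * x) - D 0 * ee (of_int m * x)" if "x \<in> {0..1}" for x
    proof (cases "x = 0 \<or> x = 1")
      case False
      have "ee x \<noteq> 1"
        using norm_ee_minus_1_ge[of x] that False by auto
      hence "h x * (ee x - 1) = D x - D 0"
        by (simp add: h_def)
      moreover have "ee (of_int (m + 1) * x) = ee x * ee (of_int m * x)"
        unfolding ee_add [symmetric] by (simp add: algebra_simps)
      ultimately show ?thesis
        by (metis (no_types, lifting) left_diff_distrib mult.assoc mult_1 right_diff_distrib)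
    qed (auto simp: h_def per)
    have "H (m + 1) - H m = integral {0..1} (\<lambda>x. h x * ee (of_int (m + 1) * x) - h x * ee (of_int m * x))"
      unfolding H_def by (intro Henstock_Kurzweil_Integration.integral_diff [symmetric] inth)
    also have "\<dots> = integral {0..1} (\<lambda>x. D x * ee (of_int m * x) - D 0 * ee (of_int m * x))"
      by (intro integral_cong eq)
    also have "\<dots> = integral {0..1} (\<lambda>x. D x * ee (of_int m * x)) - integral {0..1} (\<lambda>x. D 0 * ee (of_int m * x))"
      by (intro Henstock_Kurzweil_Integration.integral_diff integrable_continuous_interval continuous_intros
            continuous_on_subset[OF cont]) auto
    also have "\<dots> = - (if m = 0 then D 0 else 0)"
      using integral_ee[of m] by (simp add: coeff)
    finally show ?thesis .
  qed
  \<comment> \<open>The only jump is between the indices 0 and 1, so \<open>H\<close> is constant on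
    the positive indices and on the nonpositive ones; both constants are shown to be 0.\<close>
  have pos: "H (1 + int n) = H 1" for n
    by (induction n) (use step[of "1 + int n" for n] in \<open>simp_all add: algebra_simps\<close>)
  have neg: "H (- int n) = H 0" for n
  proof (induction n)
    case (Suc n)
    thus ?case using step[of "- int (Suc n)"] by simp
  qed auto
  \<comment> \<open>The extra factor \<open>ee x\<close> starts the moments at index 1, on the right
    side of the jump.\<close>
  have "H 1 = 0"
  proof (rule constant_moments_zero[where h = "\<lambda>x. h x * ee x" and w = ee and C = C])
    show "integral {0..1} (\<lambda>x. h x * ee x * ee x ^ n) = H 1" for n
      using pos[of n] by (simp add: H_def ee_power mult.assoc ring_distribs ee_add)
  qed (use bound ee_eq_1_iff in \<open>auto simp: norm_mult mult.assoc norm_power intro!: int continuous_intros elim!: Ints_cases\<close>)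
  moreover have "H 0 = 0"
  proof (rule constant_moments_zero[where h = h and w = "\<lambda>x. ee (-x)" and C = C])
    show "integral {0..1} (\<lambda>x. h x * ee (-x) ^ n) = H 0" for n
      using neg[of n] by (simp add: H_def ee_power)
  next
    show "h integrable_on {0..1}" using inth[of 0] by simp
  qed (use bound ee_eq_1_iff in \<open>auto simp: norm_mult mult.assoc norm_power intro!: int continuous_intros elim!: Ints_cases\<close>)
  ultimately show "D 0 = 0"
    using step[of 0] by simp
qed

section \<open>Poisson summation for Gaussians\<close>

text \<open>The shift is complex although inversion is only stated at real points: the entire
  extension supplies continuity and, through its derivative, the Lipschitz bound.\<close>

definition theta_sum :: "real \<Rightarrow> complex \<Rightarrow> complex" where
  "theta_sum t z = (\<Sum>\<^sub>\<infinity>k::int. exp (- of_real (pi * t) * (of_int k + z)\<^sup>2))"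

text \<open>\<open>R\<^sup>2\<close> pays for the square of \<open>Im z\<close>. With u = |k|,
  \<open>(R + 1)\<^sup>2\<close> pays for the cross term and leaves a linear term, because u^2 - 2uR
  - u + (R+1)^2 = (u - (R+1))^2 + u.\<close>

lemma norm_gaussian_term_le:
  fixes k :: int and z :: complex
  assumes "t > 0" "norm z \<le> R"
  shows "norm (exp (- of_real (pi * t) * (of_int k + z)\<^sup>2))
           \<le> exp (pi * t * (R\<^sup>2 + (R + 1)\<^sup>2)) * exp (- (pi * t) * \<bar>of_int k\<bar>)"
proof -
  have R: "\<bar>Re z\<bar> \<le> R" "\<bar>Im z\<bar> \<le> R"
    using assms(2) abs_Re_le_cmod[of z] abs_Im_le_cmod[of z] by linarith+
  define u where "u = \<bar>of_int k :: real\<bar>"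
  have "(of_int k + Re z)\<^sup>2 - (Im z)\<^sup>2 \<ge> u - (R\<^sup>2 + (R + 1)\<^sup>2)"
  proof -
    have "(Im z)\<^sup>2 \<le> R\<^sup>2"
      using R(2) by (metis abs_ge_zero power2_abs power_mono)
    moreover have "of_int k * Re z \<ge> - (u * R)"
    proof -
      have "\<bar>of_int k * Re z\<bar> \<le> u * R"
        using R by (simp add: abs_mult u_def mult_left_mono)
      thus ?thesis by linarith
    qed
    moreover have "u\<^sup>2 - 2 * (u * R) - u + (R + 1)\<^sup>2 \<ge> 0"
    proof -
      have "u\<^sup>2 - 2 * (u * R) - u + (R + 1)\<^sup>2 = (u - (R + 1))\<^sup>2 + u"
        by (simp add: power2_eq_square algebra_simps)
      moreover have "u \<ge> 0" by (simp add: u_def)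
      ultimately show ?thesis using zero_le_power2[of "u - (R + 1)"] by linarith
    qed
    moreover have "(of_int k :: real)\<^sup>2 = u\<^sup>2" by (simp add: u_def)
    ultimately show ?thesis
      using zero_le_power2[of "Re z"] power2_sum[of "of_int k" "Re z"] by linarith
  qed
  hence "pi * t * ((of_int k + Re z)\<^sup>2 - (Im z)\<^sup>2) \<ge> pi * t * (u - (R\<^sup>2 + (R + 1)\<^sup>2))"
    using assms(1) by (intro mult_left_mono) auto
  moreover have "norm (exp (- of_real (pi * t) * (of_int k + z)\<^sup>2))
      = exp (- (pi * t * ((of_int k + Re z)\<^sup>2 - (Im z)\<^sup>2)))"
    by (simp add: power2_eq_square algebra_simps)
  ultimately show ?thesis
    by (simp add: exp_add [symmetric] u_def algebra_simps)
qed

lemma summable_gaussian_bound: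
  "t > 0 \<Longrightarrow> (\<lambda>k::int. C * exp (- (pi * t) * \<bar>of_int k\<bar>)) summable_on UNIV"
  by (intro summable_on_cmult_right summable_on_exp_abs_int) simp

lemma theta_sum_holomorphic:
  assumes "t > 0"
  shows "theta_sum t holomorphic_on UNIV"
  unfolding theta_sum_def
proof (rule holomorphic_on_infsum)
  fix K :: "complex set" assume "compact K"
  then obtain R where R: "\<And>z. z \<in> K \<Longrightarrow> norm z \<le> R"
    by (meson bounded_iff compact_imp_bounded)
  show "\<exists>M. M summable_on UNIV \<and> (\<forall>k::int. \<forall>z\<in>K. norm (exp (- of_real (pi * t) * (of_int k + z)\<^sup>2)) \<le> M k)"
    using summable_gaussian_bound[OF assms, of "exp (pi * t * (R\<^sup>2 + (R + 1)\<^sup>2))"]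
      norm_gaussian_term_le[OF assms] R by blast
qed (auto intro!: holomorphic_intros)

lemma theta_sum_plus_1: "theta_sum t (z + 1) = theta_sum t z"
proof -
  have "theta_sum t z = (\<Sum>\<^sub>\<infinity>k::int. exp (- of_real (pi * t) * (of_int (k + 1) + z)\<^sup>2))"
    unfolding theta_sum_def
    by (rule infsum_reindex_bij_witness[of _ "\<lambda>k. k + 1" "\<lambda>k. k - 1"]) auto
  thus ?thesis by (simp add: theta_sum_def add_ac)
qed

text \<open>The Fourier transform of a Gaussian is the characteristic function of the standard
  normal distribution after the substitution \<open>x = s * y\<close> with
  \<open>s = sqrt (2 * pi * t)\<close>, which turns x^2 / 2 into pi t y^2.\<close>

lemma integrable_gaussian_ee:
  assumes "t > 0"
  shows "integrable lborel (\<lambda>y. of_real (exp (- (pi * t) * y\<^sup>2)) * ee (u * y))"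
    and "integral\<^sup>L lborel (\<lambda>y. of_real (exp (- (pi * t) * y\<^sup>2)) * ee (u * y))
           = of_real (exp (- pi * u\<^sup>2 / t) / sqrt t)"
proof -
  define s where "s = sqrt (2 * pi * t)"
  have s: "s > 0" "s\<^sup>2 = 2 * pi * t"
    using assms by (auto simp: s_def)
  define g where "g = (\<lambda>x. std_normal_density x *\<^sub>R iexp (2 * pi * u / s * x))"
  have gs: "g (0 + s * y) = of_real (1 / sqrt (2 * pi)) * (of_real (exp (- (pi * t) * y\<^sup>2)) * ee (u * y))" for y
    using s by (simp add: g_def std_normal_density_def ee_conv_exp power_mult_distrib scaleR_conv_of_real mult_ac)
  have gi: "integrable lborel g"
  proof -
    have "integrable lborel std_normal_density" by simp
    hence "integrable lborel (\<lambda>x. of_real (std_normal_density x) :: complex)" by simp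
    thus ?thesis
      by (rule Bochner_Integration.integrable_bound) (auto simp: g_def norm_mult)
  qed
  have "integral\<^sup>L lborel g = integral\<^sup>L std_normal_distribution (\<lambda>x. iexp (2 * pi * u / s * x))"
    unfolding g_def by (subst integral_density) auto
  also have "\<dots> = char std_normal_distribution (2 * pi * u / s)"
    by (simp add: char_def)
  also have "\<dots> = of_real (exp (- pi * u\<^sup>2 / t))"
    unfolding char_std_normal_distribution using assms
    by (simp add: power_divide s power_mult_distrib) (simp add: field_simps power2_eq_square)
  finally have gv: "integral\<^sup>L lborel g = of_real (exp (- pi * u\<^sup>2 / t))" .
  have "integrable lborel (\<lambda>y. g (0 + s * y))"
    by (rule lborel_integrable_real_affine[OF gi]) (use s in auto)
  hence i1: "integrable lborel (\<lambda>y. of_real (1 / sqrt (2 * pi)) * (of_real (exp (- (pi * t) * y\<^sup>2)) * ee (u * y)))"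
    unfolding gs .
  have "(\<lambda>y. of_real (exp (- (pi * t) * y\<^sup>2)) * ee (u * y)) = (\<lambda>y. of_real (sqrt (2 * pi)) *
      (of_real (1 / sqrt (2 * pi)) * (of_real (exp (- (pi * t) * y\<^sup>2)) * ee (u * y))))"
    by (simp add: fun_eq_iff)
  with integrable_mult_right[OF i1, of "of_real (sqrt (2 * pi))"]
  show "integrable lborel (\<lambda>y. of_real (exp (- (pi * t) * y\<^sup>2)) * ee (u * y))"
    by metis
  have "integral\<^sup>L lborel g = \<bar>s\<bar> *\<^sub>R integral\<^sup>L lborel (\<lambda>y. g (0 + s * y))"
    by (rule lborel_integral_real_affine) (use s in auto)
  also have "\<dots> = of_real (s / sqrt (2 * pi)) *
      integral\<^sup>L lborel (\<lambda>y. of_real (exp (- (pi * t) * y\<^sup>2)) * ee (u * y))"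
    unfolding gs using s by (simp add: scaleR_conv_of_real)
  also have "s / sqrt (2 * pi) = sqrt t"
    by (simp add: s_def real_sqrt_mult)
  finally show "integral\<^sup>L lborel (\<lambda>y. of_real (exp (- (pi * t) * y\<^sup>2)) * ee (u * y))
           = of_real (exp (- pi * u\<^sup>2 / t) / sqrt t)"
    using gv assms by (simp add: field_simps)
qed

text \<open>The windows are half-open because the unit intervals that start at their points tile
  exactly \<open>[-n, n]\<close>.\<close>

lemma filterlim_symmetric_int_intervals:
  "filterlim (\<lambda>n. {- int n..<int n}) (finite_subsets_at_top UNIV) sequentially"
  unfolding filterlim_finite_subsets_at_top
proof (intro allI impI)
  fix X :: "int set" assume X: "finite X \<and> X \<subseteq> UNIV"
  have "finite ((\<lambda>x. nat \<bar>x\<bar>) ` X)" using X by simp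
  then obtain N where N: "\<And>x. x \<in> X \<Longrightarrow> nat \<bar>x\<bar> < N"
    by (metis finite_nat_set_iff_bounded image_eqI)
  have "X \<subseteq> {- int n..<int n}" if "n \<ge> N" for n
    using N that by fastforce
  thus "eventually (\<lambda>n. finite {- int n..<int n} \<and> X \<subseteq> {- int n..<int n} \<and> {- int n..<int n} \<subseteq> UNIV) sequentially"
    by (auto simp: eventually_sequentially)
qed

lemma sum_integral_unit_intervals:
  fixes g :: "real \<Rightarrow> complex"
  assumes "continuous_on UNIV g"
  shows "(\<Sum>k\<in>{- int n..<int n}. integral {0..1} (\<lambda>x. g (x + of_int k))) = integral {- real n..real n} g"
proof -
  have int: "g integrable_on {a..b}" for a b :: real
    by (intro integrable_continuous_interval continuous_on_subset[OF assms]) auto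
  have shift: "integral {0..1} (\<lambda>x. g (x + of_int k)) = integral {of_int k..of_int k + 1} g" for k :: int
    using integral_shift_Icc_real[of 0 1 g "of_int k"] by (simp add: o_def add.commute)
  show ?thesis
  proof (induction n)
    case (Suc n)
    have "{- int (Suc n)..<int (Suc n)} = insert (- int (Suc n)) (insert (int n) {- int n..<int n})"
      by auto
    hence "(\<Sum>k\<in>{- int (Suc n)..<int (Suc n)}. integral {0..1} (\<lambda>x. g (x + of_int k)))
        = integral {- real (Suc n)..- real n} g + integral {- real n..real n} g + integral {real n..real (Suc n)} g"
      using Suc.IH by (simp add: shift add_ac)
    also have "\<dots> = integral {- real (Suc n)..real (Suc n)} g"
      by (simp add: Henstock_Kurzweil_Integration.integral_combine int)
    finally show ?case .
  qed simp
qed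

lemma integral_symmetric_intervals_tendsto:
  fixes g :: "real \<Rightarrow> complex"
  assumes g: "integrable lborel g" and cont: "continuous_on UNIV g"
  shows "(\<lambda>n. integral {- real n..real n} g) \<longlonglongrightarrow> integral\<^sup>L lborel g"
proof -
  have "(\<lambda>n. integral\<^sup>L lborel (\<lambda>x. indicator {- real n..real n} x *\<^sub>R g x)) \<longlonglongrightarrow> integral\<^sup>L lborel g"
  proof (rule integral_dominated_convergence[where w = "\<lambda>x. norm (g x)"])
    show "AE x in lborel. (\<lambda>n. indicator {- real n..real n} x *\<^sub>R g x) \<longlonglongrightarrow> g x"
    proof (rule AE_I2, rule tendsto_eventually)
      fix x :: real
      obtain N where "\<bar>x\<bar> \<le> real N" using real_arch_simple by blast
      thus "eventually (\<lambda>n. indicator {- real n..real n} x *\<^sub>R g x = g x) sequentially"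
        by (intro eventually_sequentiallyI[of N]) (auto simp: indicator_def)
    qed
  qed (use g in \<open>auto simp: indicator_def\<close>)
  moreover have "integral\<^sup>L lborel (\<lambda>x. indicator {- real n..real n} x *\<^sub>R g x) = integral {- real n..real n} g" for n
    using set_borel_integral_eq_integral(2)[of "{- real n..real n}" g]
      integrable_mult_indicator[OF _ g, of "{- real n..real n}"]
    by (simp add: set_lebesgue_integral_def set_integrable_def)
  ultimately show ?thesis by simp
qed

text \<open>Unfolding: \<open>ee (of_int m * x)\<close> has period 1, so integrating the sum of
  translates over one period equals integrating a single Gaussian over the real line.\<close>

lemma theta_sum_fourier_coeff:
  fixes m :: int
  assumes t: "t > 0"
  shows "integral {0..1} (\<lambda>x. theta_sum t (of_real (x0 + x)) * ee (of_int m * x))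
           = ee (- of_int m * x0) * of_real (exp (- pi * (of_int m)\<^sup>2 / t) / sqrt t)"
proof -
  define g where "g = (\<lambda>y. of_real (exp (- (pi * t) * (x0 + y)\<^sup>2)) * ee (of_int m * y))"
  have contg: "continuous_on UNIV g"
    unfolding g_def by (intro continuous_intros)
  define f where "f = (\<lambda>(k::int) x. exp (- of_real (pi * t) * (of_int k + of_real (x0 + x))\<^sup>2) * ee (of_int m * x))"
  have fg: "f k x = g (x + of_int k)" for k x
  proof -
    have "exp (- of_real (pi * t) * (of_int k + of_real (x0 + x))\<^sup>2)
        = complex_of_real (exp (- (pi * t) * (x0 + (x + of_int k))\<^sup>2))"
      by (simp add: exp_of_real [symmetric] add_ac)
    moreover have "ee (of_int m * (x + of_int k)) = ee (of_int m * x) * ee (of_int (m * k))"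
      unfolding ee_add [symmetric] by (simp add: algebra_simps)
    ultimately show ?thesis using ee_of_int[of "m * k"] by (simp add: f_def g_def)
  qed
  have "((\<lambda>k. integral {0..1} (f k)) has_sum integral {0..1} (\<lambda>x. \<Sum>\<^sub>\<infinity>k. f k x)) UNIV"
  proof (rule integral_infsum[OF _ summable_gaussian_bound[OF t]])
    fix k and x :: real assume "x \<in> {0..1}"
    hence "norm (complex_of_real (x0 + x)) \<le> \<bar>x0\<bar> + 1"
      unfolding norm_of_real by (auto simp: abs_if)
    from norm_gaussian_term_le[OF t this, of k]
    show "norm (f k x) \<le> exp (pi * t * ((\<bar>x0\<bar> + 1)\<^sup>2 + (\<bar>x0\<bar> + 1 + 1)\<^sup>2)) * exp (- (pi * t) * \<bar>of_int k\<bar>)"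
      by (simp add: f_def norm_mult)
  next
    fix k show "continuous_on {0..1} (f k)" unfolding f_def by (intro continuous_intros)
  qed
  also have "(\<lambda>x. \<Sum>\<^sub>\<infinity>k. f k x) = (\<lambda>x. theta_sum t (of_real (x0 + x)) * ee (of_int m * x))"
    unfolding f_def theta_sum_def by (simp add: infsum_cmult_left')
  finally have "((\<lambda>k. integral {0..1} (f k)) has_sum
      integral {0..1} (\<lambda>x. theta_sum t (of_real (x0 + x)) * ee (of_int m * x))) UNIV" .
  hence lim: "(\<lambda>n. \<Sum>k\<in>{- int n..<int n}. integral {0..1} (f k)) \<longlonglongrightarrow>
      integral {0..1} (\<lambda>x. theta_sum t (of_real (x0 + x)) * ee (of_int m * x))"
    unfolding has_sum_def by (rule filterlim_compose[OF _ filterlim_symmetric_int_intervals])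
  have eq: "(\<Sum>k\<in>{- int n..<int n}. integral {0..1} (f k)) = integral {- real n..real n} g" for n
    using sum_integral_unit_intervals[OF contg, of n] by (simp add: fg [abs_def])
  have shift: "g (- x0 + 1 * y) = ee (- of_int m * x0) * (of_real (exp (- (pi * t) * y\<^sup>2)) * ee (of_int m * y))" for y
    by (simp add: g_def ee_add [symmetric] algebra_simps)
  have "integrable lborel (\<lambda>y. g (- x0 + 1 * y))"
    unfolding shift by (intro integrable_mult_right integrable_gaussian_ee t)
  hence intg: "integrable lborel g"
    using lborel_integrable_real_affine_iff[of 1 g "- x0"] by simp
  have "integral\<^sup>L lborel g = integral\<^sup>L lborel (\<lambda>y. g (- x0 + 1 * y))"
    by (subst lborel_integral_real_affine[of 1 g "- x0"]) auto
  also have "\<dots> = ee (- of_int m * x0) * of_real (exp (- pi * (of_int m)\<^sup>2 / t) / sqrt t)"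
    unfolding shift using integrable_gaussian_ee(2)[OF t, of "of_int m"] by simp
  finally have "(\<lambda>n. integral {- real n..real n} g) \<longlonglongrightarrow> ee (- of_int m * x0) * of_real (exp (- pi * (of_int m)\<^sup>2 / t) / sqrt t)"
    using integral_symmetric_intervals_tendsto[OF intg contg] by simp
  with lim show ?thesis
    unfolding eq by (rule LIMSEQ_unique)
qed

definition dual_theta_sum :: "real \<Rightarrow> complex \<Rightarrow> complex" where
  "dual_theta_sum t z = (\<Sum>\<^sub>\<infinity>l::int. of_real (exp (- pi * (of_int l)\<^sup>2 / t)) * exp (2 * of_real pi * \<i> * of_int l * z))"

text \<open>Completing the square in the exponent. The dual series thereby inherits holomorphy from
  \<open>theta_sum\<close>, without a new estimate.\<close>

lemma dual_theta_sum_eq: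
  assumes "t > 0"
  shows "dual_theta_sum t z = exp (- of_real (pi * t) * z\<^sup>2) * theta_sum (1 / t) (- \<i> * of_real t * z)"
  unfolding dual_theta_sum_def theta_sum_def infsum_cmult_right' [symmetric]
proof (rule infsum_cong)
  fix l :: int
  have "- complex_of_real (pi * (1 / t)) * (of_int l + - \<i> * of_real t * z)\<^sup>2
     = - of_real (pi * (of_int l)\<^sup>2 / t) + 2 * of_real pi * \<i> * of_int l * z + of_real (pi * t) * z\<^sup>2"
    using assms by (simp add: power2_eq_square field_simps)
  thus "of_real (exp (- pi * (of_int l)\<^sup>2 / t)) * exp (2 * of_real pi * \<i> * of_int l * z)
    = exp (- of_real (pi * t) * z\<^sup>2) * exp (- of_real (pi * (1 / t)) * (of_int l + - \<i> * of_real t * z)\<^sup>2)"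
    by (simp add: exp_of_real [symmetric] exp_add [symmetric])
qed

text \<open>Termwise integration leaves only the index \<open>l = - m\<close>; its sign is visible
  in the phase but not in the squared exponent.\<close>

lemma dual_theta_sum_fourier_coeff:
  fixes m :: int
  assumes t: "t > 0"
  shows "integral {0..1} (\<lambda>x. dual_theta_sum t (of_real (x0 + x)) * ee (of_int m * x))
           = ee (- of_int m * x0) * of_real (exp (- pi * (of_int m)\<^sup>2 / t))"
proof -
  define c where "c = (\<lambda>l::int. complex_of_real (exp (- pi * (of_int l)\<^sup>2 / t)) * ee (of_int l * x0))"
  define f where "f = (\<lambda>l x. c l * ee (of_int (l + m) * x))"
  have "((\<lambda>l. integral {0..1} (f l)) has_sum integral {0..1} (\<lambda>x. \<Sum>\<^sub>\<infinity>l. f l x)) UNIV"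
  proof (rule integral_infsum)
    show "(\<lambda>l::int. exp (- (pi / t) * \<bar>of_int l\<bar>)) summable_on UNIV"
      using t by (intro summable_on_exp_abs_int) simp
  next
    fix l :: int and x :: real
    have "\<bar>of_int l\<bar> \<le> (of_int l :: real)\<^sup>2" by (rule abs_of_int_le_square)
    hence "(pi / t) * \<bar>of_int l\<bar> \<le> (pi / t) * (of_int l)\<^sup>2"
      using t by (intro mult_left_mono) auto
    thus "norm (f l x) \<le> exp (- (pi / t) * \<bar>of_int l\<bar>)"
      by (simp add: f_def c_def norm_mult)
  next
    fix l show "continuous_on {0..1} (f l)" unfolding f_def by (intro continuous_intros)
  qed
  also have "(\<lambda>x. \<Sum>\<^sub>\<infinity>l. f l x) = (\<lambda>x. dual_theta_sum t (of_real (x0 + x)) * ee (of_int m * x))"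
    unfolding dual_theta_sum_def infsum_cmult_left' [symmetric] f_def c_def
    by (intro ext infsum_cong) (simp add: ee_conv_exp exp_add [symmetric] algebra_simps)
  also have "(\<lambda>l. integral {0..1} (f l)) = (\<lambda>l. if l = - m then c l else 0)"
    using integral_ee by (auto simp: f_def fun_eq_iff add_eq_0_iff simp del: of_int_add)
  finally have "((\<lambda>l. if l = - m then c l else 0) has_sum
      integral {0..1} (\<lambda>x. dual_theta_sum t (of_real (x0 + x)) * ee (of_int m * x))) UNIV" .
  moreover have "((\<lambda>l. if l = - m then c l else 0) has_sum c (-m)) UNIV"
    by (rule has_sum_finite_neutralI[of "{-m}"]) auto
  ultimately show ?thesis
    using has_sum_unique by (fastforce simp: c_def)
qed

text \<open>Both sides are 1-periodic with equal Fourier coefficients. The uniqueness lemma speaks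
  about the point 0 only, so the difference is recentred at \<open>x0\<close>.\<close>

theorem theta_sum_inversion:
  assumes t: "t > 0"
  shows "theta_sum t (of_real x0) = dual_theta_sum t (of_real x0) / of_real (sqrt t)"
proof -
  define E where "E = (\<lambda>z. theta_sum t (of_real x0 + z) - dual_theta_sum t (of_real x0 + z) / of_real (sqrt t))"
  define D where "D = (\<lambda>x::real. E (of_real x))"
  have holA: "(\<lambda>z. theta_sum t (of_real x0 + z)) holomorphic_on UNIV"
    by (rule holomorphic_on_compose[OF _ holomorphic_on_subset[OF theta_sum_holomorphic[OF t]], unfolded o_def])
       (auto intro!: holomorphic_intros)
  have holB: "(\<lambda>z. dual_theta_sum t (of_real x0 + z)) holomorphic_on UNIV"
    unfolding dual_theta_sum_eq[OF t]
    by (intro holomorphic_intros holomorphic_on_compose[OF _ holomorphic_on_subset[OF theta_sum_holomorphic], unfolded o_def])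
       (use t in auto)
  have holE: "E holomorphic_on UNIV"
    unfolding E_def using t by (intro holomorphic_intros holA holB) auto
  have contE': "continuous_on (closed_segment 0 1) (deriv E)"
    using holomorphic_deriv[OF holE] by (auto intro: holomorphic_on_imp_continuous_on continuous_on_subset)
  \<comment> \<open>A bound for the complex derivative on the unit segment serves as Lipschitz
    constant.\<close>
  obtain C where C: "\<And>z. z \<in> closed_segment 0 1 \<Longrightarrow> norm (deriv E z) \<le> C"
    using compact_imp_bounded[OF compact_continuous_image[OF contE' compact_segment]]
    unfolding bounded_iff by blast
  have "D 0 = 0"
  proof (rule fourier_coeffs_zero_imp_zero)
    show contD: "continuous_on UNIV D"
      unfolding D_def
      by (rule continuous_on_compose2[OF holomorphic_on_imp_continuous_on[OF holE]]) (auto intro!: continuous_intros)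
    have "dual_theta_sum t (z + 1) = dual_theta_sum t z" for z
      unfolding dual_theta_sum_def
    proof (intro infsum_cong)
      fix l :: int
      have "exp (2 * of_real pi * \<i> * of_int l) = 1"
        using ee_of_int[of l] by (simp add: ee_conv_exp)
      thus "of_real (exp (- pi * (of_int l)\<^sup>2 / t)) * exp (2 * of_real pi * \<i> * of_int l * (z + 1))
          = of_real (exp (- pi * (of_int l)\<^sup>2 / t)) * exp (2 * of_real pi * \<i> * of_int l * z)"
        by (simp add: ring_distribs exp_add)
    qed
    thus "D 1 = D 0"
      using theta_sum_plus_1[of t "of_real x0"] by (simp add: D_def E_def)
    show "(max C 0)-lipschitz_on {0..1} D"
    proof (rule lipschitz_onI)
      fix x y :: real assume xy: "x \<in> {0..1}" "y \<in> {0..1}"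
      have "norm (E (of_real x) - E (of_real y)) \<le> max C 0 * norm (complex_of_real x - complex_of_real y)"
      proof (rule field_differentiable_bound[where S = "closed_segment 0 1"])
        show "(E has_field_derivative deriv E z) (at z within closed_segment 0 1)" for z
          using holE by (meson UNIV_I has_field_derivative_at_within holomorphic_derivI open_UNIV)
        show "complex_of_real x \<in> closed_segment 0 1" "complex_of_real y \<in> closed_segment 0 1"
          using xy by (auto simp: closed_segment_def scaleR_conv_of_real)
      qed (use C in \<open>auto simp: le_max_iff_disj\<close>)
      thus "dist (D x) (D y) \<le> max C 0 * dist x y"
        by (simp add: D_def dist_norm norm_of_real flip: of_real_diff)
    qed auto
    fix m :: int
    have c1: "continuous_on {0..1} (\<lambda>x. theta_sum t (of_real (x0 + x)))"
      using continuous_on_compose2[OF holomorphic_on_imp_continuous_on[OF holA], of "{0..1::real}" of_real]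
      by (auto intro!: continuous_intros)
    have c2: "continuous_on {0..1} (\<lambda>x. dual_theta_sum t (of_real (x0 + x)))"
      using continuous_on_compose2[OF holomorphic_on_imp_continuous_on[OF holB], of "{0..1::real}" of_real]
      by (auto intro!: continuous_intros)
    have "integral {0..1} (\<lambda>x. D x * ee (of_int m * x)) =
        integral {0..1} (\<lambda>x. theta_sum t (of_real (x0 + x)) * ee (of_int m * x)
          - dual_theta_sum t (of_real (x0 + x)) * ee (of_int m * x) / of_real (sqrt t))"
      by (simp add: D_def E_def algebra_simps diff_divide_distrib)
    also have "\<dots> = integral {0..1} (\<lambda>x. theta_sum t (of_real (x0 + x)) * ee (of_int m * x))
          - integral {0..1} (\<lambda>x. dual_theta_sum t (of_real (x0 + x)) * ee (of_int m * x) / of_real (sqrt t))"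
      by (intro Henstock_Kurzweil_Integration.integral_diff integrable_continuous_interval continuous_intros c1 c2)
         (use t in auto)
    also have "\<dots> = 0"
      unfolding theta_sum_fourier_coeff[OF t] integral_divide dual_theta_sum_fourier_coeff[OF t] by simp
    finally show "integral {0..1} (\<lambda>x. D x * ee (of_int m * x)) = 0" .
  qed
  thus ?thesis by (simp add: D_def E_def)
qed

section \<open>Theta series with periodic coefficients\<close>

text \<open>Common form of all factors: constant coefficients with \<open>s = b\<close> for
  \<open>theta\<close>, the indicator of the odd integers with \<open>s = c / 8\<close> for
  \<open>Psi\<close>.\<close>

definition qseries :: "(int \<Rightarrow> complex) \<Rightarrow> real \<Rightarrow> complex \<Rightarrow> complex" where
  "qseries a s \<tau> = (\<Sum>\<^sub>\<infinity>n. a n * q_pow \<tau> (s * (of_int n)\<^sup>2))"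

lemma norm_q_pow: "norm (q_pow \<tau> r) = exp (- 2 * pi * r * Im \<tau>)"
  by (simp add: q_pow_def)

lemma q_pow_add: "q_pow \<tau> (r + s) = q_pow \<tau> r * q_pow \<tau> s"
  by (simp add: q_pow_def exp_add [symmetric] algebra_simps)

lemma q_pow_power: "q_pow \<tau> r ^ n = q_pow \<tau> (of_nat n * r)"
  by (simp add: q_pow_def exp_of_nat_mult [symmetric] mult_ac)

lemma q_pow_add_real: "q_pow (\<tau> + of_real x) r = ee (r * x) * q_pow \<tau> r"
  by (simp add: q_pow_def ee_conv_exp exp_add [symmetric] algebra_simps)

lemma norm_qseries_term_le:
  fixes n :: int
  assumes "s > 0" "Im \<tau> \<ge> y" "y > 0" "norm (a n) \<le> C"
  shows "norm (a n * q_pow \<tau> (s * (of_int n)\<^sup>2)) \<le> C * exp (- (2 * pi * s * y) * \<bar>of_int n\<bar>)"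
proof -
  have "(2 * pi * s) * y * \<bar>of_int n\<bar> \<le> (2 * pi * s) * Im \<tau> * (of_int n)\<^sup>2"
    using assms by (intro mult_mono abs_of_int_le_square) auto
  hence "norm (q_pow \<tau> (s * (of_int n)\<^sup>2)) \<le> exp (- (2 * pi * s * y) * \<bar>of_int n\<bar>)"
    by (simp add: norm_q_pow mult_ac)
  thus ?thesis
    unfolding norm_mult
    by (intro mult_mono assms(4) norm_ge_zero order_trans[OF norm_ge_zero assms(4)]) auto
qed

lemma qseries_summable:
  assumes "s > 0" "Im \<tau> > 0" "\<And>n. norm (a n) \<le> C"
  shows "(\<lambda>n. a n * q_pow \<tau> (s * (of_int n)\<^sup>2)) summable_on A"
proof -
  have "(\<lambda>n. C * exp (- (2 * pi * s * Im \<tau>) * \<bar>real_of_int n\<bar>)) summable_on A"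
    by (intro summable_on_cmult_right summable_on_subset_banach[OF summable_on_exp_abs_int]) (use assms in auto)
  hence "(\<lambda>n. norm (a n * q_pow \<tau> (s * (of_int n)\<^sup>2))) summable_on A"
    by (rule summable_on_comparison_test) (use assms norm_qseries_term_le in auto)
  thus ?thesis by (rule abs_summable_summable)
qed

lemma open_upper_half_plane: "open upper_half_plane"
  using open_halfspace_Im_gt[of 0] by (simp add: upper_half_plane_def)

lemma connected_upper_half_plane: "connected upper_half_plane"
  using convex_halfspace_Im_gt[of 0] by (simp add: upper_half_plane_def convex_connected)

lemma uhp_minus_inverse: "\<tau> \<in> upper_half_plane \<longleftrightarrow> - 1 / \<tau> \<in> upper_half_plane"
proof (cases "\<tau> = 0")
  case False
  hence "(Re \<tau>)\<^sup>2 + (Im \<tau>)\<^sup>2 > 0"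
    by (auto simp: complex_eq_iff sum_power2_gt_zero_iff)
  thus ?thesis by (simp add: upper_half_plane_def Im_divide zero_less_divide_iff)
qed (simp add: upper_half_plane_def)

lemma qseries_holomorphic:
  assumes "s > 0" "\<And>n. norm (a n) \<le> C"
  shows "qseries a s holomorphic_on upper_half_plane"
  unfolding qseries_def
proof (rule holomorphic_on_infsum[OF open_upper_half_plane])
  fix K assume K: "compact K" "K \<subseteq> upper_half_plane"
  obtain y where y: "y > 0" "\<And>\<tau>. \<tau> \<in> K \<Longrightarrow> Im \<tau> \<ge> y"
  proof (cases "K = {}")
    case False
    from continuous_attains_inf[OF K(1) this, of Im]
    obtain z where "z \<in> K" "\<And>w. w \<in> K \<Longrightarrow> Im z \<le> Im w"
      using linear_continuous_on[OF bounded_linear_Im] by blast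
    with K that[of "Im z"] show ?thesis by (auto simp: upper_half_plane_def)
  qed (use that[of 1] in auto)
  have "(\<lambda>n::int. C * exp (- (2 * pi * s * y) * \<bar>real_of_int n\<bar>)) summable_on UNIV"
    by (intro summable_on_cmult_right summable_on_exp_abs_int) (use assms y in auto)
  moreover have "norm (a n * q_pow \<tau> (s * (of_int n)\<^sup>2)) \<le> C * exp (- (2 * pi * s * y) * \<bar>of_int n\<bar>)"
    if "\<tau> \<in> K" for n \<tau>
    by (rule norm_qseries_term_le) (use assms y that in auto)
  ultimately show "\<exists>M. M summable_on UNIV \<and> (\<forall>n. \<forall>\<tau>\<in>K. norm (a n * q_pow \<tau> (s * (of_int n)\<^sup>2)) \<le> M n)"
    by (intro exI conjI allI ballI)
qed (unfold q_pow_def, intro holomorphic_intros)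

text \<open>For rational \<open>s = p / N\<close> all exponents are nonnegative multiples of
  \<open>1 / N\<close>, so the series is a power series in \<open>q_pow \<tau> (1 / N)\<close>;
  boundedness of the coefficients gives convergence in the whole unit disc.\<close>

lemma qseries_holomorphic_at_ii_inf:
  fixes p N :: nat
  assumes "p > 0" "N > 0" "\<And>n. norm (a n) \<le> C"
  shows "holomorphic_at_ii_inf (qseries a (real p / real N))"
  unfolding holomorphic_at_ii_inf_def
proof (intro exI[of _ N] conjI assms(2))
  define g where "g = (\<lambda>w. \<Sum>\<^sub>\<infinity>n. a n * w ^ (p * nat (n\<^sup>2)))"
  have "g holomorphic_on ball 0 1"
    unfolding g_def
  proof (rule holomorphic_on_infsum[OF open_ball])
    fix K assume K: "compact K" "K \<subseteq> ball (0::complex) 1"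
    obtain r where r: "0 \<le> r" "r < 1" "\<And>w. w \<in> K \<Longrightarrow> norm w \<le> r"
    proof (cases "K = {}")
      case False
      from continuous_attains_sup[OF K(1) this, of norm]
      obtain z where "z \<in> K" "\<And>w. w \<in> K \<Longrightarrow> norm w \<le> norm z"
        by (auto intro: continuous_intros)
      with K that[of "norm z"] show ?thesis by auto
    qed (use that[of 0] in auto)
    have "norm (a n * w ^ (p * nat (n\<^sup>2))) \<le> C * r ^ nat \<bar>n\<bar>" if "w \<in> K" for n w
    proof -
      have "\<bar>n\<bar> \<le> n\<^sup>2"
        using abs_of_int_le_square[of n] by (metis of_int_abs of_int_le_iff of_int_power)
      hence "nat \<bar>n\<bar> \<le> p * nat (n\<^sup>2)"
        using assms(1) by (metis Suc_leI dual_order.trans mult_le_mono1 nat_mono nat_mult_1 One_nat_def)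
      hence "norm w ^ (p * nat (n\<^sup>2)) \<le> r ^ nat \<bar>n\<bar>"
        using r(3)[OF that] r by (meson norm_ge_zero order_less_imp_le order_trans power_decreasing power_mono)
      thus ?thesis
        unfolding norm_mult norm_power
        by (intro mult_mono assms(3) zero_le_power norm_ge_zero order_trans[OF norm_ge_zero assms(3)]) auto
    qed
    thus "\<exists>M. M summable_on UNIV \<and> (\<forall>n. \<forall>w\<in>K. norm (a n * w ^ (p * nat (n\<^sup>2))) \<le> M n)"
      using summable_on_cmult_right[OF summable_on_geometric_int[OF r(1,2)], of C] by blast
  qed (auto intro!: holomorphic_intros)
  moreover have "qseries a (real p / real N) \<tau> = g (q_pow \<tau> (1 / real N))" for \<tau>
    unfolding qseries_def g_def q_pow_power by (intro infsum_cong) simp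
  ultimately show "\<exists>g. g holomorphic_on ball 0 1 \<and>
      (\<forall>\<tau>\<in>upper_half_plane. qseries a (real p / real N) \<tau> = g (q_pow \<tau> (1 / real N)))"
    by blast
qed

lemma qseries_add_real:
  "qseries a s (\<tau> + of_real x) = qseries (\<lambda>n. ee (s * (of_int n)\<^sup>2 * x) * a n) s \<tau>"
  unfolding qseries_def by (simp add: q_pow_add_real mult_ac)

lemma qseries_cmult: "qseries (\<lambda>n. c * a n) s \<tau> = c * qseries a s \<tau>"
  unfolding qseries_def by (simp add: infsum_cmult_right' mult.assoc)

lemma qseries_of_real_mult: "qseries a s (of_real x * \<tau>) = qseries a (s * x) \<tau>"
  unfolding qseries_def q_pow_def by (simp add: mult_ac)

definition finite_fourier :: "int \<Rightarrow> (int \<Rightarrow> complex) \<Rightarrow> int \<Rightarrow> complex" where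
  "finite_fourier m \<phi> l = (\<Sum>r\<in>{0..<m}. \<phi> r * ee (of_int (l * r) / of_int m))"

lemma periodic_bounded:
  fixes \<phi> :: "int \<Rightarrow> complex"
  assumes "m > 0" "\<And>n. \<phi> (n mod m) = \<phi> n"
  obtains C where "\<And>n. norm (\<phi> n) \<le> C"
proof -
  have "norm (\<phi> n) \<le> (\<Sum>r\<in>{0..<m}. norm (\<phi> r))" for n
    using assms by (subst assms(2) [symmetric], intro member_le_sum) auto
  thus ?thesis using that by blast
qed

lemma norm_finite_fourier_le: "norm (finite_fourier m \<phi> l) \<le> (\<Sum>r\<in>{0..<m}. norm (\<phi> r))"
  unfolding finite_fourier_def by (rule order_trans[OF norm_sum]) (simp add: norm_mult)

lemma infsum_finite_sum:
  fixes f :: "'a \<Rightarrow> 'b \<Rightarrow> complex"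
  assumes "finite A" "\<And>r. r \<in> A \<Longrightarrow> f r summable_on X"
  shows "(\<lambda>l. \<Sum>r\<in>A. f r l) summable_on X"
    and "(\<Sum>\<^sub>\<infinity>l\<in>X. \<Sum>r\<in>A. f r l) = (\<Sum>r\<in>A. \<Sum>\<^sub>\<infinity>l\<in>X. f r l)"
proof -
  have "((\<lambda>l. \<Sum>r\<in>A. f r l) has_sum (\<Sum>r\<in>A. \<Sum>\<^sub>\<infinity>l\<in>X. f r l)) X"
    using assms by (induction rule: finite_induct) (auto intro!: has_sum_add)
  thus "(\<lambda>l. \<Sum>r\<in>A. f r l) summable_on X"
    and "(\<Sum>\<^sub>\<infinity>l\<in>X. \<Sum>r\<in>A. f r l) = (\<Sum>r\<in>A. \<Sum>\<^sub>\<infinity>l\<in>X. f r l)"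
    by (auto simp: has_sum_iff)
qed

lemma infsum_residue_classes:
  fixes f :: "int \<Rightarrow> complex"
  assumes "m > 0" "\<And>A. f summable_on A"
  shows "infsum f UNIV = (\<Sum>r\<in>{0..<m}. \<Sum>\<^sub>\<infinity>k. f (r + m * k))"
proof -
  have "(\<Sum>r\<in>{0..<m}. infsum f {n. n mod m = r}) = infsum f (\<Union>r\<in>{0..<m}. {n. n mod m = r})"
    by (rule sum_infsum) (use assms in auto)
  also have "(\<Union>r\<in>{0..<m}. {n. n mod m = r}) = UNIV"
    using assms(1) by auto
  also have "infsum f {n. n mod m = r} = (\<Sum>\<^sub>\<infinity>k. f (r + m * k))" if "r \<in> {0..<m}" for r
    by (rule infsum_reindex_bij_witness[of _ "\<lambda>k. r + m * k" "\<lambda>n. n div m"]) (use that in auto)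
  ultimately show ?thesis by simp
qed

text \<open>Each residue class modulo \<open>m\<close> is a Gaussian sum shifted by
  \<open>r / m\<close>. Inversion turns the shift into the phase \<open>ee (l * r / m)\<close>, and
  summing the phases over \<open>r\<close> builds the finite Fourier transform.\<close>

lemma qseries_inversion_imaginary:
  fixes m :: int and s t :: real
  assumes m: "m > 0" and per: "\<And>n. \<phi> (n mod m) = \<phi> n" and s: "s > 0" and t: "t > 0"
  shows "qseries \<phi> s (\<i> * of_real t) * of_real (of_int m * sqrt (2 * s)) * of_real (sqrt t)
           = qseries (finite_fourier m \<phi>) (1 / (4 * s * (of_int m)\<^sup>2)) (\<i> / of_real t)"
proof -
  \<comment> \<open>At \<open>\<i> * t\<close> the term of \<open>n = r + m * k\<close> is exp(-2 pi
    s t n^2), and n^2 = m^2 (k + r/m)^2.\<close>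
  define T where "T = 2 * s * t * (of_int m)\<^sup>2"
  have T: "T > 0" using assms by (simp add: T_def)
  have sqrtT: "sqrt T = of_int m * sqrt (2 * s) * sqrt t"
    using m by (simp add: T_def real_sqrt_mult)
  obtain C where C: "\<And>n. norm (\<phi> n) \<le> C"
    using periodic_bounded[of m \<phi>, OF m per] by blast
  have "qseries \<phi> s (\<i> * of_real t) =
      (\<Sum>r\<in>{0..<m}. \<Sum>\<^sub>\<infinity>k. \<phi> (r + m * k) * q_pow (\<i> * of_real t) (s * (of_int (r + m * k))\<^sup>2))"
    unfolding qseries_def
    by (rule infsum_residue_classes[OF m]) (use t s C in \<open>auto intro!: qseries_summable\<close>)
  also have "\<dots> = (\<Sum>r\<in>{0..<m}. \<phi> r * theta_sum T (of_real (of_int r / of_int m)))"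
  proof (rule sum.cong[OF refl])
    fix r assume "r \<in> {0..<m}"
    have "\<phi> (r + m * k) = \<phi> r" for k
      using per[of "r + m * k"] per[of r] by simp
    moreover have "q_pow (\<i> * of_real t) (s * (of_int (r + m * k))\<^sup>2)
        = exp (- of_real (pi * T) * (of_int k + of_real (of_int r / of_int m))\<^sup>2)" for k
    proof -
      have "of_int (r + m * k) = complex_of_int m * (of_int k + of_real (of_int r / of_int m))"
        using m by (simp add: field_simps)
      hence "(complex_of_int (r + m * k))\<^sup>2 = (of_int m)\<^sup>2 * (of_int k + of_real (of_int r / of_int m))\<^sup>2"
        by (simp only: power_mult_distrib)
      moreover have "q_pow (\<i> * of_real t) (s * (of_int (r + m * k))\<^sup>2)
          = exp (- of_real (2 * pi * s * t) * (of_int (r + m * k))\<^sup>2)"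
        by (simp add: q_pow_def mult_ac del: of_int_add)
      ultimately show ?thesis
        by (simp add: T_def mult_ac)
    qed
    ultimately show "(\<Sum>\<^sub>\<infinity>k. \<phi> (r + m * k) * q_pow (\<i> * of_real t) (s * (of_int (r + m * k))\<^sup>2))
        = \<phi> r * theta_sum T (of_real (of_int r / of_int m))"
      by (simp add: theta_sum_def infsum_cmult_right')
  qed
  also have "\<dots> = (\<Sum>r\<in>{0..<m}. \<phi> r * dual_theta_sum T (of_real (of_int r / of_int m))) / of_real (sqrt T)"
    unfolding theta_sum_inversion[OF T] sum_divide_distrib by simp
  finally have "qseries \<phi> s (\<i> * of_real t) * of_real (sqrt T)
      = (\<Sum>r\<in>{0..<m}. \<phi> r * dual_theta_sum T (of_real (of_int r / of_int m)))"
    using T by simp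
  also have "\<dots> = (\<Sum>r\<in>{0..<m}. \<Sum>\<^sub>\<infinity>l. (\<phi> r * ee (of_int (l * r) / of_int m))
      * q_pow (\<i> / of_real t) (1 / (4 * s * (of_int m)\<^sup>2) * (of_int l)\<^sup>2))"
  proof (intro sum.cong refl)
    fix r
    have "of_real (exp (- pi * (of_int l)\<^sup>2 / T)) = q_pow (\<i> / of_real t) (1 / (4 * s * (of_int m)\<^sup>2) * (of_int l)\<^sup>2)" for l
      using s t m by (simp add: q_pow_def T_def exp_of_real [symmetric] field_simps)
    moreover have "exp (2 * of_real pi * \<i> * of_int l * of_real (of_int r / of_int m)) = ee (of_int (l * r) / of_int m)" for l
      by (simp add: ee_conv_exp mult_ac)
    ultimately show "\<phi> r * dual_theta_sum T (of_real (of_int r / of_int m)) =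
      (\<Sum>\<^sub>\<infinity>l. (\<phi> r * ee (of_int (l * r) / of_int m))
      * q_pow (\<i> / of_real t) (1 / (4 * s * (of_int m)\<^sup>2) * (of_int l)\<^sup>2))"
      unfolding dual_theta_sum_def infsum_cmult_right' [symmetric] by (intro infsum_cong) (simp add: mult_ac)
  qed
  also have "\<dots> = (\<Sum>\<^sub>\<infinity>l. \<Sum>r\<in>{0..<m}. (\<phi> r * ee (of_int (l * r) / of_int m))
      * q_pow (\<i> / of_real t) (1 / (4 * s * (of_int m)\<^sup>2) * (of_int l)\<^sup>2))"
    by (rule infsum_finite_sum(2) [symmetric])
       (auto intro!: qseries_summable[where C = C] simp: norm_mult s t m C simp del: times_divide_eq_left)
  also have "\<dots> = qseries (finite_fourier m \<phi>) (1 / (4 * s * (of_int m)\<^sup>2)) (\<i> / of_real t)"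
    unfolding qseries_def finite_fourier_def sum_distrib_right ..
  finally show ?thesis
    by (simp add: sqrtT mult_ac)
qed

text \<open>Both sides are holomorphic on the connected upper half-plane and agree on the imaginary
  axis, so the identity theorem applies.\<close>

theorem qseries_inversion:
  fixes m :: int and s :: real
  assumes m: "m > 0" and per: "\<And>n. \<phi> (n mod m) = \<phi> n" and s: "s > 0" and \<tau>: "\<tau> \<in> upper_half_plane"
  shows "qseries \<phi> s \<tau> * of_real (of_int m * sqrt (2 * s)) * csqrt (- \<i> * \<tau>)
           = qseries (finite_fourier m \<phi>) (1 / (4 * s * (of_int m)\<^sup>2)) (- 1 / \<tau>)"
proof -
  obtain C where C: "\<And>n. norm (\<phi> n) \<le> C"
    using periodic_bounded[of m \<phi>, OF m per] by blast
  define f where "f = (\<lambda>\<tau>. qseries \<phi> s \<tau> * of_real (of_int m * sqrt (2 * s)) * csqrt (- \<i> * \<tau>)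
           - qseries (finite_fourier m \<phi>) (1 / (4 * s * (of_int m)\<^sup>2)) (- 1 / \<tau>))"
  have inv: "- 1 / z \<in> upper_half_plane" if "z \<in> upper_half_plane" for z :: complex
    using that uhp_minus_inverse by blast
  have "qseries (finite_fourier m \<phi>) (1 / (4 * s * (of_int m)\<^sup>2)) holomorphic_on upper_half_plane"
    by (rule qseries_holomorphic[OF _ norm_finite_fourier_le]) (use s m in auto)
  hence "qseries (finite_fourier m \<phi>) (1 / (4 * s * (of_int m)\<^sup>2)) \<circ> (\<lambda>z. - 1 / z) holomorphic_on upper_half_plane"
    by (rule holomorphic_on_compose_gen[rotated])
       (use inv in \<open>auto simp: upper_half_plane_def intro!: holomorphic_intros\<close>)
  hence h1: "(\<lambda>z. qseries (finite_fourier m \<phi>) (1 / (4 * s * (of_int m)\<^sup>2)) (- 1 / z)) holomorphic_on upper_half_plane"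
    by (simp only: o_def)
  \<comment> \<open>The real part of \<open>- \<i> * z\<close> is \<open>Im z > 0\<close>, which
    avoids the branch cut.\<close>
  have h2: "(\<lambda>z. csqrt (- \<i> * z)) holomorphic_on upper_half_plane"
    by (intro holomorphic_intros) (auto simp: upper_half_plane_def complex_nonpos_Reals_iff)
  have hol: "f holomorphic_on upper_half_plane"
    unfolding f_def by (intro holomorphic_intros h1 h2 qseries_holomorphic[OF s C])
  define X where "X = (\<lambda>t. \<i> * complex_of_real t) ` {0<..}"
  have islim: "\<i> islimpt X"
    unfolding islimpt_sequential
  proof (intro exI conjI allI)
    fix n show "\<i> * complex_of_real (1 + 1 / real (Suc n)) \<in> X - {\<i>}"
      by (auto simp: X_def complex_eq_iff intro!: imageI add_pos_pos)
    have "(\<lambda>n. \<i> * complex_of_real (1 + 1 / real (Suc n))) \<longlonglongrightarrow> \<i> * complex_of_real (1 + 0)"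
      by (intro tendsto_intros LIMSEQ_inverse_real_of_nat[unfolded inverse_eq_divide])
    thus "(\<lambda>n. \<i> * complex_of_real (1 + 1 / real (Suc n))) \<longlonglongrightarrow> \<i>" by simp
  qed
  have "f \<tau> = 0"
  proof (rule analytic_continuation[OF hol open_upper_half_plane connected_upper_half_plane _ _ islim _ \<tau>])
    fix z assume "z \<in> X"
    then obtain t where t: "t > 0" "z = \<i> * of_real t" by (auto simp: X_def)
    have "csqrt (- \<i> * z) = of_real (sqrt t)"
      using t by (simp add: mult.assoc [symmetric])
    moreover have "- 1 / z = \<i> / of_real t"
      using t by (simp add: field_simps)
    ultimately show "f z = 0"
      unfolding f_def using qseries_inversion_imaginary[where \<phi> = \<phi>, OF m per s t(1)] t(2) by simp
  qed (auto simp: X_def upper_half_plane_def)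
  thus ?thesis by (simp add: f_def)
qed

section \<open>Quadratic Gauss sums\<close>

lemma ee_divide_cong:
  assumes "d \<noteq> 0" "[x = y] (mod d)"
  shows "ee (of_int x / of_int d) = ee (of_int y / of_int d)"
proof -
  from assms(2) obtain k where "x = y + d * k"
    by (metis cong_iff_lin mult.commute cong_sym)
  hence "of_int x / of_int d = of_int y / of_int d + (of_int k :: real)"
    using assms(1) by (simp add: field_simps)
  thus ?thesis by (simp add: ee_add)
qed

text \<open>A map that is injective modulo \<open>m\<close> permutes the finite set of
  residues.\<close>

lemma sum_residues_reindex:
  fixes f :: "int \<Rightarrow> complex"
  assumes "m > 0" "\<And>x. f (x mod m) = f x"
    and inj: "\<And>x y. x \<in> {0..<m} \<Longrightarrow> y \<in> {0..<m} \<Longrightarrow> [g x = g y] (mod m) \<Longrightarrow> x = y"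
  shows "(\<Sum>x\<in>{0..<m}. f (g x)) = (\<Sum>x\<in>{0..<m}. f x)"
proof -
  have inj': "inj_on (\<lambda>x. g x mod m) {0..<m}"
    by (rule inj_onI, rule inj) (auto simp: cong_def)
  moreover have sub: "(\<lambda>x. g x mod m) ` {0..<m} \<subseteq> {0..<m}"
    using assms(1) by auto
  ultimately have "(\<lambda>x. g x mod m) ` {0..<m} = {0..<m}"
    by (intro endo_inj_surj) auto
  hence "(\<Sum>x\<in>{0..<m}. f x) = (\<Sum>x\<in>{0..<m}. f (g x mod m))"
    using sum.reindex[OF inj', of f] by simp
  thus ?thesis by (simp add: assms(2))
qed

lemma int_div_less:
  fixes x a b :: int
  assumes "a > 0" "x < a * b"
  shows "x div a < b"
proof -
  have "a * (x div a) \<le> x"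
    using assms(1) by (simp add: minus_mod_eq_mult_div [symmetric])
  with assms have "a * (x div a) < a * b" by linarith
  thus ?thesis using assms(1) by simp
qed

lemma sum_split_residues:
  fixes f :: "int \<Rightarrow> complex"
  assumes "a > 0" "b > 0"
  shows "(\<Sum>x\<in>{0..<a * b}. f x) = (\<Sum>y\<in>{0..<a}. \<Sum>z\<in>{0..<b}. f (y + a * z))"
proof -
  have "(\<Sum>y\<in>{0..<a}. \<Sum>z\<in>{0..<b}. f (y + a * z)) = (\<Sum>(y, z)\<in>{0..<a} \<times> {0..<b}. f (y + a * z))"
    by (simp add: sum.cartesian_product)
  also have "\<dots> = (\<Sum>x\<in>{0..<a * b}. f x)"
  proof (rule sum.reindex_bij_witness[of _ "\<lambda>x. (x mod a, x div a)" "\<lambda>(y, z). y + a * z"])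
    fix yz assume "yz \<in> {0..<a} \<times> {0..<b}"
    then obtain y z where yz: "yz = (y, z)" "0 \<le> y" "y < a" "0 \<le> z" "z < b" by auto
    have "a * z \<le> a * (b - 1)" using yz assms by (intro mult_left_mono) auto
    hence "y + a * z < a * b" using yz by (simp add: algebra_simps)
    thus "(case yz of (y, z) \<Rightarrow> y + a * z) \<in> {0..<a * b}" using yz assms by auto
    show "((case yz of (y, z) \<Rightarrow> y + a * z) mod a, (case yz of (y, z) \<Rightarrow> y + a * z) div a) = yz"
      using yz by simp
  next
    fix x assume x: "x \<in> {0..<a * b}"
    have "x div a < b"
      using x assms by (intro int_div_less) auto
    thus "(x mod a, x div a) \<in> {0..<a} \<times> {0..<b}"
      using x assms by (auto simp: pos_imp_zdiv_nonneg_iff)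
  qed (auto split: prod.splits)
  finally show ?thesis ..
qed

text \<open>Orthogonality of additive characters: for a nontrivial root of unity \<open>w\<close>
  the geometric sum has numerator \<open>w ^ d - 1 = 0\<close>.\<close>

lemma sum_ee:
  assumes "d > 0"
  shows "(\<Sum>r\<in>{0..<d}. ee (of_int (k * r) / of_int d)) = (if d dvd k then of_int d else 0)"
proof (cases "d dvd k")
  case True
  then obtain j where "k = d * j" by auto
  hence "of_int (k * r) / of_int d = real_of_int (j * r)" for r
    using assms by simp
  hence "ee (of_int (k * r) / of_int d) = 1" for r
    by (simp only: ee_of_int)
  thus ?thesis using True assms by simp
next
  case False
  define w where "w = ee (of_int k / of_int d)"
  have "w \<noteq> 1"
  proof
    assume "w = 1"
    then obtain j where "of_int k / of_int d = real_of_int j"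
      by (auto simp: w_def ee_eq_1_iff elim!: Ints_cases)
    hence "real_of_int k = of_int (j * d)" using assms by (simp add: field_simps)
    hence "k = j * d" by linarith
    with False show False by simp
  qed
  have "(\<Sum>r\<in>{0..<d}. ee (of_int (k * r) / of_int d)) = (\<Sum>n<nat d. w ^ n)"
    by (rule sum.reindex_bij_witness[of _ int nat]) (auto simp: w_def ee_power mult_ac)
  also have "\<dots> = (w ^ nat d - 1) / (w - 1)"
    by (rule geometric_sum) fact
  also have "w ^ nat d = 1"
    using assms by (simp add: w_def ee_power)
  finally show ?thesis using False by simp
qed

definition gauss_sum :: "int \<Rightarrow> int \<Rightarrow> complex" where
  "gauss_sum B d = (\<Sum>r\<in>{0..<d}. ee (of_int (B * r\<^sup>2) / of_int d))"

lemma gauss_sum_reindex: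
  assumes "d > 0" "\<And>x y. x \<in> {0..<d} \<Longrightarrow> y \<in> {0..<d} \<Longrightarrow> [g x = g y] (mod d) \<Longrightarrow> x = y"
  shows "(\<Sum>r\<in>{0..<d}. ee (of_int (B * (g r)\<^sup>2) / of_int d)) = gauss_sum B d"
  unfolding gauss_sum_def
proof (rule sum_residues_reindex[where f = "\<lambda>r. ee (of_int (B * r\<^sup>2) / of_int d)", OF assms(1) _ assms(2)])
  show "ee (of_int (B * (x mod d)\<^sup>2) / of_int d) = ee (of_int (B * x\<^sup>2) / of_int d)" for x
    using assms(1) by (intro ee_divide_cong cong_mult cong_pow cong_refl) (auto simp: cong_def)
qed

lemma gauss_sum_cong:
  assumes "d > 0" "[A = B] (mod d)"
  shows "gauss_sum A d = gauss_sum B d"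
  unfolding gauss_sum_def
  by (intro sum.cong refl ee_divide_cong cong_mult cong_refl) (use assms in auto)

lemma residue_eqI:
  fixes x y :: int
  assumes "x \<in> {0..<m}" "y \<in> {0..<m}" "[x = y] (mod m)"
  shows "x = y"
  using assms by (auto simp: cong_def)

lemma gauss_sum_square_mult:
  assumes "d > 0" "coprime w d"
  shows "gauss_sum (w\<^sup>2 * B) d = gauss_sum B d"
proof -
  have "(\<Sum>r\<in>{0..<d}. ee (of_int (B * (w * r)\<^sup>2) / of_int d)) = gauss_sum B d"
    by (rule gauss_sum_reindex[OF assms(1)]) (use assms(2) in \<open>auto simp: cong_mult_lcancel intro: residue_eqI\<close>)
  thus ?thesis by (simp add: gauss_sum_def power_mult_distrib mult_ac)
qed

text \<open>This is |G|^2 = d, the second factor being the complex conjugate. Substituting x = z + y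
  makes x^2 - y^2 linear in \<open>y\<close>; the sum over \<open>y\<close> then kills all
  \<open>z\<close> except 0, as \<open>2 * B\<close> is invertible modulo \<open>d\<close>.\<close>

lemma gauss_sum_conj_product:
  assumes d: "d > 0" "odd d" and B: "coprime B d"
  shows "gauss_sum B d * gauss_sum (-B) d = of_int d"
proof -
  have "gauss_sum B d * gauss_sum (-B) d =
      (\<Sum>y\<in>{0..<d}. gauss_sum B d * ee (of_int (- B * y\<^sup>2) / of_int d))"
    by (simp add: gauss_sum_def[of "-B"] sum_distrib_left)
  also have "\<dots> = (\<Sum>y\<in>{0..<d}. \<Sum>z\<in>{0..<d}. ee (of_int (B * z\<^sup>2) / of_int d) * ee (of_int ((2 * B * z) * y) / of_int d))"
  proof (rule sum.cong[OF refl])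
    fix y
    have "gauss_sum B d = (\<Sum>z\<in>{0..<d}. ee (of_int (B * (z + y)\<^sup>2) / of_int d))"
      by (rule gauss_sum_reindex [symmetric]) (use d in \<open>auto simp: cong_add_rcancel intro: residue_eqI\<close>)
    moreover have "of_int (B * (z + y)\<^sup>2) / of_int d + of_int (- B * y\<^sup>2) / of_int d
        = of_int (B * z\<^sup>2) / of_int d + (of_int ((2 * B * z) * y) / of_int d :: real)" for z
      by (simp add: power2_eq_square algebra_simps add_divide_distrib)
    ultimately show "gauss_sum B d * ee (of_int (- B * y\<^sup>2) / of_int d) =
      (\<Sum>z\<in>{0..<d}. ee (of_int (B * z\<^sup>2) / of_int d) * ee (of_int ((2 * B * z) * y) / of_int d))"
      by (simp only: sum_distrib_right ee_add [symmetric])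
  qed
  also have "\<dots> = (\<Sum>z\<in>{0..<d}. \<Sum>y\<in>{0..<d}. ee (of_int (B * z\<^sup>2) / of_int d) * ee (of_int ((2 * B * z) * y) / of_int d))"
    by (rule sum.swap)
  also have "\<dots> = (\<Sum>z\<in>{0..<d}. ee (of_int (B * z\<^sup>2) / of_int d) * (if d dvd 2 * B * z then of_int d else 0))"
    unfolding sum_distrib_left [symmetric] sum_ee[OF d(1)] ..
  also have "\<dots> = (\<Sum>z\<in>{0..<d}. if z = 0 then of_int d else 0)"
  proof (rule sum.cong[OF refl])
    fix z assume z: "z \<in> {0..<d}"
    have "coprime d (2 * B)" using d B by (simp add: coprime_commute)
    hence "d dvd 2 * B * z \<longleftrightarrow> d dvd z" by (rule coprime_dvd_mult_right_iff)
    also have "\<dots> \<longleftrightarrow> z = 0" using z zdvd_not_zless[of z d] by (cases "z = 0") auto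
    finally show "ee (of_int (B * z\<^sup>2) / of_int d) * (if d dvd 2 * B * z then of_int d else 0)
        = (if z = 0 then of_int d else 0)" by simp
  qed
  also have "\<dots> = of_int d" using d by simp
  finally show ?thesis .
qed

text \<open>With r = y + p m z the square is linear in \<open>z\<close> modulo p^2 m, so the sum
  over \<open>z\<close> forces \<open>p dvd y\<close>; writing y = p j cancels p^2 and leaves the
  sum modulo \<open>m\<close>. Here \<open>p\<close> may still divide \<open>m\<close>.\<close>

lemma gauss_sum_prime_square:
  assumes p: "prime p" "odd p" "\<not> p dvd B" and m: "m > 0"
  shows "gauss_sum B (p * p * m) = of_int p * gauss_sum B m"
proof -
  have p0: "p > 0" using p(1) by (simp add: prime_gt_0_int)
  have "gauss_sum B (p * p * m) = (\<Sum>y\<in>{0..<p * m}. \<Sum>z\<in>{0..<p}. ee (of_int (B * (y + (p * m) * z)\<^sup>2) / of_int (p * p * m)))"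
    using sum_split_residues[of "p * m" p "\<lambda>r. ee (of_int (B * r\<^sup>2) / of_int (p * p * m))"] p0 m
    by (simp add: gauss_sum_def mult_ac)
  also have "\<dots> = (\<Sum>y\<in>{0..<p * m}. ee (of_int (B * y\<^sup>2) / of_int (p * p * m)) * (if p dvd y then of_int p else 0))"
  proof (rule sum.cong[OF refl])
    fix y
    have "ee (of_int (B * (y + (p * m) * z)\<^sup>2) / of_int (p * p * m)) =
        ee (of_int (B * y\<^sup>2) / of_int (p * p * m)) * ee (of_int ((2 * B * y) * z) / of_int p)" for z
    proof -
      have "of_int (B * (y + (p * m) * z)\<^sup>2) / of_int (p * p * m) =
          of_int (B * y\<^sup>2) / of_int (p * p * m) + of_int ((2 * B * y) * z) / of_int p + real_of_int (B * m * z\<^sup>2)"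
        using p0 m by (simp add: field_simps power2_eq_square)
      thus ?thesis by (simp only: ee_add ee_of_int mult_1_right)
    qed
    moreover have "p dvd 2 * B * y \<longleftrightarrow> p dvd y"
    proof -
      have "\<not> p dvd 2"
        using p primes_dvd_imp_eq[of p 2] by auto
      thus ?thesis using p by (simp add: prime_dvd_mult_iff)
    qed
    ultimately show "(\<Sum>z\<in>{0..<p}. ee (of_int (B * (y + (p * m) * z)\<^sup>2) / of_int (p * p * m))) =
        ee (of_int (B * y\<^sup>2) / of_int (p * p * m)) * (if p dvd y then of_int p else 0)"
      using sum_ee[OF p0, of "2 * B * y"] by (simp only: sum_distrib_left [symmetric])
  qed
  also have "\<dots> = (\<Sum>i\<in>{0..<p}. \<Sum>j\<in>{0..<m}. ee (of_int (B * (i + p * j)\<^sup>2) / of_int (p * p * m)) * (if i = 0 then of_int p else 0))"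
  proof (subst sum_split_residues[OF p0 m], intro sum.cong refl)
    fix i j assume i: "i \<in> {0..<p}"
    have "p dvd i + p * j \<longleftrightarrow> p dvd i" by (simp add: dvd_add_left_iff)
    also have "\<dots> \<longleftrightarrow> i = 0" using i zdvd_not_zless[of i p] by (cases "i = 0") auto
    finally show "ee (of_int (B * (i + p * j)\<^sup>2) / of_int (p * p * m)) * (if p dvd i + p * j then of_int p else 0)
      = ee (of_int (B * (i + p * j)\<^sup>2) / of_int (p * p * m)) * (if i = 0 then of_int p else 0)" by simp
  qed
  also have "\<dots> = (\<Sum>i\<in>{0..<p}. if i = 0 then of_int p * gauss_sum B m else 0)"
  proof (intro sum.cong refl)
    fix i
    have "of_int (B * (0 + p * j)\<^sup>2) / of_int (p * p * m) = (of_int (B * j\<^sup>2) / of_int m :: real)" for j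
      using p0 m by (simp add: power2_eq_square field_simps)
    thus "(\<Sum>j\<in>{0..<m}. ee (of_int (B * (i + p * j)\<^sup>2) / of_int (p * p * m)) * (if i = 0 then of_int p else 0))
        = (if i = 0 then of_int p * gauss_sum B m else 0)"
      by (cases "i = 0") (simp_all only: gauss_sum_def sum_distrib_left mult.commute[of "of_int p"] if_True if_False mult_zero_right sum.neutral_const simp_thms)
  qed
  also have "\<dots> = of_int p * gauss_sum B m" using p0 by simp
  finally show ?thesis .
qed

text \<open>Chinese remaindering with r = p y + m z: the cross term 2 B y z is an integer after
  division by p m. The price is the twist of \<open>B\<close> by the complementary modulus.\<close>

lemma gauss_sum_coprime_mult:
  assumes p: "p > 0" and m: "m > 0" and cop: "coprime p m"
  shows "gauss_sum B (p * m) = gauss_sum (B * p) m * gauss_sum (B * m) p"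
proof -
  have "gauss_sum (B * p) m * gauss_sum (B * m) p =
      (\<Sum>y\<in>{0..<m}. \<Sum>z\<in>{0..<p}. ee (of_int (B * (p * y + m * z)\<^sup>2) / of_int (p * m)))"
    unfolding gauss_sum_def sum_product
  proof (intro sum.cong refl)
    fix y z
    have "of_int (B * (p * y + m * z)\<^sup>2) / of_int (p * m) =
        of_int (B * p * y\<^sup>2) / of_int m + of_int (B * m * z\<^sup>2) / of_int p + real_of_int (2 * B * y * z)"
      using p m by (simp add: field_simps power2_eq_square)
    thus "ee (of_int (B * p * y\<^sup>2) / of_int m) * ee (of_int (B * m * z\<^sup>2) / of_int p)
        = ee (of_int (B * (p * y + m * z)\<^sup>2) / of_int (p * m))"
      by (simp only: ee_add ee_of_int mult_1_right)
  qed
  also have "\<dots> = (\<Sum>x\<in>{0..<m * p}. ee (of_int (B * (p * (x mod m) + m * (x div m))\<^sup>2) / of_int (p * m)))"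
    by (subst sum_split_residues[OF m p]) (intro sum.cong refl, simp)
  also have "\<dots> = gauss_sum B (p * m)"
    unfolding mult.commute[of m p]
  proof (rule gauss_sum_reindex)
    fix x x' assume x: "x \<in> {0..<p * m}" "x' \<in> {0..<p * m}"
      and cong: "[p * (x mod m) + m * (x div m) = p * (x' mod m) + m * (x' div m)] (mod p * m)"
    have "[p * (x mod m) = p * (x' mod m)] (mod m)"
      using cong_dvd_modulus[OF cong, of m] by (simp add: cong_def mod_simps)
    hence "[x mod m = x' mod m] (mod m)"
      using cop by (simp add: cong_mult_lcancel coprime_commute)
    hence 1: "x mod m = x' mod m" by (simp add: cong_def)
    have "[m * (x div m) = m * (x' div m)] (mod p)"
      using cong_dvd_modulus[OF cong, of p] by (simp add: cong_def mod_simps)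
    hence "[x div m = x' div m] (mod p)"
      using cop by (simp add: cong_mult_lcancel coprime_commute)
    moreover have "x div m \<in> {0..<p}" "x' div m \<in> {0..<p}"
      using x p m by (auto simp: pos_imp_zdiv_nonneg_iff mult.commute intro!: int_div_less)
    ultimately have 2: "x div m = x' div m" by (intro residue_eqI)
    from 1 2 show "x = x'" by (metis div_mult_mod_eq)
  qed (use p m in auto)
  finally show ?thesis ..
qed

section \<open>Legendre symbols and Gauss sums to prime moduli\<close>

lemma Legendre_values: "Legendre a p \<in> {-1, 0, 1}"
  by (simp add: Legendre_def)

lemma Legendre_eq_0_iff: "Legendre a p = 0 \<longleftrightarrow> p dvd a"
  by (simp add: Legendre_def cong_0_iff)

text \<open>Euler's criterion gives the identity modulo \<open>p\<close>; both sides lie in {-1, 0,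
  1} and so differ by at most 2, which is less than \<open>p\<close>.\<close>

lemma Legendre_mult:
  assumes "prime p" "odd p"
  shows "Legendre (a * b) p = Legendre a p * Legendre b p"
proof -
  obtain q where q: "p = int q"
    using assms(1) by (metis prime_ge_0_int zero_le_imp_eq_int)
  have p2: "p > 2"
    using assms prime_ge_2_int[of p] by (cases "p = 2") auto
  hence p0: "p > 0" by simp
  have euler: "[Legendre x p = x ^ ((q - 1) div 2)] (mod p)" for x
    unfolding q by (rule euler_criterion) (use assms(1) p2 q in auto)
  have "[Legendre a p * Legendre b p = a ^ ((q - 1) div 2) * b ^ ((q - 1) div 2)] (mod p)"
    by (intro cong_mult euler)
  hence "[Legendre (a * b) p = Legendre a p * Legendre b p] (mod p)"
    using euler[of "a * b"] by (simp add: power_mult_distrib) (metis cong_sym cong_trans)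
  hence dvd: "p dvd Legendre (a * b) p - Legendre a p * Legendre b p"
    by (simp add: cong_iff_dvd_diff)
  have "\<bar>Legendre (a * b) p - Legendre a p * Legendre b p\<bar> \<le> 2"
    using Legendre_values[of "a * b" p] Legendre_values[of a p] Legendre_values[of b p] by auto
  with dvd p2 show ?thesis
    by (metis dvd_imp_le_int dual_order.strict_trans2 eq_iff_diff_eq_0 abs_of_pos p0 not_le)
qed

lemma Legendre_eq_1_imp_square:
  assumes "Legendre u p = 1"
  obtains w where "[w\<^sup>2 = u] (mod p)"
  using assms by (auto simp: Legendre_def QuadRes_def split: if_splits)

lemma gauss_sum_mult_residue:
  assumes p: "prime p" and u: "Legendre u p = 1"
  shows "gauss_sum (u * B) p = gauss_sum B p"
proof -
  have p0: "p > 0" using p by (simp add: prime_gt_0_int)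
  from u obtain w where w: "[w\<^sup>2 = u] (mod p)"
    by (rule Legendre_eq_1_imp_square)
  have "\<not> p dvd u" using u Legendre_eq_0_iff[of u p] by auto
  hence "\<not> p dvd w"
    using w by (metis cong_dvd_iff dvd_mult power2_eq_square)
  hence cop: "coprime w p"
    using p by (simp add: coprime_commute prime_imp_coprime)
  have "gauss_sum (u * B) p = gauss_sum (w\<^sup>2 * B) p"
    by (intro gauss_sum_cong p0 cong_mult cong_refl) (rule cong_sym[OF w])
  also have "\<dots> = gauss_sum B p"
    by (rule gauss_sum_square_mult[OF p0 cop])
  finally show ?thesis .
qed

text \<open>Both \<open>\<Sum>t. gauss_sum (t * B) p\<close> and \<open>gauss_sum 0 p\<close> equal \<open>p\<close>, so the values of the Gauss sum
  on residues and non-residues cancel.\<close>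

lemma gauss_sum_mult_prime:
  assumes p: "prime p" "odd p" and u: "\<not> p dvd u" and B: "\<not> p dvd B"
  shows "gauss_sum (u * B) p = of_int (Legendre u p) * gauss_sum B p"
proof (cases "Legendre u p = 1")
  case True
  thus ?thesis using gauss_sum_mult_residue[OF p(1) True] by simp
next
  case False
  hence u': "Legendre u p = -1"
    using Legendre_values[of u p] u Legendre_eq_0_iff[of u p] by auto
  have p0: "p > 0" using p by (simp add: prime_gt_0_int)
  have pdvd: "p dvd t \<longleftrightarrow> t = 0" if "t \<in> {0..<p}" for t
    using that zdvd_not_zless[of t p] by (cases "t = 0") auto
  define g1 g2 where "g1 = gauss_sum B p" and "g2 = gauss_sum (u * B) p"
  \<comment> \<open>\<open>gauss_sum (t * B) p\<close> takes only two values, selected by the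
    Legendre symbol of \<open>t\<close>; this interpolates between them.\<close>
  have val: "2 * gauss_sum (t * B) p = (g1 + g2) + of_int (Legendre t p) * (g1 - g2)" if "\<not> p dvd t" for t
  proof (cases "Legendre t p = 1")
    case True
    thus ?thesis using gauss_sum_mult_residue[OF p(1) True, of B] by (simp add: g1_def)
  next
    case False
    hence t': "Legendre t p = -1"
      using Legendre_values[of t p] that Legendre_eq_0_iff[of t p] by auto
    \<comment> \<open>Both \<open>t\<close> and \<open>u\<close> are non-residues, so
      \<open>t * u\<close> and \<open>u * u\<close> are residues; multiplying \<open>u * B\<close>
      by the first gives the same as multiplying \<open>t * B\<close> by the second.\<close>
    hence "Legendre (t * u) p = 1" using u' p by (simp add: Legendre_mult)
    hence "gauss_sum (t * u * (u * B)) p = gauss_sum (u * B) p"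
      by (rule gauss_sum_mult_residue[OF p(1)])
    moreover have "Legendre (u * u) p = 1" using u' p by (simp add: Legendre_mult)
    hence "gauss_sum (u * u * (t * B)) p = gauss_sum (t * B) p"
      by (rule gauss_sum_mult_residue[OF p(1)])
    ultimately show ?thesis by (simp add: g2_def t' mult_ac)
  qed
  have "(\<Sum>t\<in>{0..<p}. gauss_sum (t * B) p) = (\<Sum>x\<in>{0..<p}. \<Sum>t\<in>{0..<p}. ee (of_int ((B * x\<^sup>2) * t) / of_int p))"
    unfolding gauss_sum_def by (subst sum.swap) (simp add: mult_ac)
  also have "\<dots> = (\<Sum>x\<in>{0..<p}. if x = 0 then of_int p else 0)"
    unfolding sum_ee[OF p0]
    by (intro sum.cong refl) (use p B pdvd in \<open>auto simp: prime_dvd_mult_iff prime_dvd_power_iff\<close>)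
  also have "\<dots> = of_int p" using p0 by simp
  finally have "(\<Sum>t\<in>{0..<p}. gauss_sum (t * B) p) = of_int p" .
  moreover have split0: "{0..<p} = insert 0 {1..<p}" using p0 by auto
  moreover have "gauss_sum (0 * B) p = of_int p" using p0 by (simp add: gauss_sum_def)
  ultimately have "(\<Sum>t\<in>{1..<p}. gauss_sum (t * B) p) = 0" by simp
  hence "0 = (\<Sum>t\<in>{1..<p}. 2 * gauss_sum (t * B) p)" by (simp flip: sum_distrib_left)
  also have "\<dots> = (\<Sum>t\<in>{1..<p}. (g1 + g2) + of_int (Legendre t p) * (g1 - g2))"
    by (intro sum.cong refl val) (use pdvd in auto)
  also have "\<dots> = of_nat (card {1..<p}) * (g1 + g2) + (\<Sum>t\<in>{1..<p}. of_int (Legendre t p)) * (g1 - g2)"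
    by (simp add: sum.distrib sum_distrib_right)
  also have "(\<Sum>t\<in>{1..<p}. of_int (Legendre t p)) = (0::complex)"
  proof -
    have L0: "Legendre 0 p = 0" by (simp add: Legendre_eq_0_iff)
    \<comment> \<open>Multiplication by the non-residue \<open>u\<close> permutes the residues but
      flips every symbol, so the sum equals its own negative.\<close>
    have "(\<Sum>t\<in>{0..<p}. complex_of_int (Legendre (u * t) p)) = (\<Sum>t\<in>{0..<p}. of_int (Legendre t p))"
    proof (rule sum_residues_reindex[where f = "\<lambda>t. complex_of_int (Legendre t p)", OF p0])
      show "complex_of_int (Legendre (x mod p) p) = of_int (Legendre x p)" for x
        by (simp add: Legendre_def QuadRes_def cong_def)
    next
      fix x y assume "x \<in> {0..<p}" "y \<in> {0..<p}" "[u * x = u * y] (mod p)"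
      thus "x = y"
        using u p by (intro residue_eqI[of x p y]) (auto simp: cong_mult_lcancel coprime_commute prime_imp_coprime)
    qed
    hence "- (\<Sum>t\<in>{0..<p}. complex_of_int (Legendre t p)) = (\<Sum>t\<in>{0..<p}. of_int (Legendre t p))"
      using p u' by (simp add: Legendre_mult sum_negf)
    hence "(\<Sum>t\<in>{0..<p}. complex_of_int (Legendre t p)) = 0" by simp
    thus ?thesis unfolding split0 by (simp add: L0)
  qed
  finally have "of_nat (card {1..<p}) * (g1 + g2) = 0" by simp
  moreover have "card {1..<p} \<noteq> 0" using p(1) prime_gt_1_int[of p] by simp
  ultimately have "g1 + g2 = 0" by simp
  thus ?thesis by (simp add: g1_def g2_def u' add_eq_0_iff)
qed

section \<open>Kronecker symbols and Gauss sums to odd moduli\<close>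

lemma kronecker_odd:
  assumes "odd d" "d > 0"
  shows "kronecker a d = (\<Prod>p\<in>#prime_factorization d. Legendre a p)"
proof -
  have "p \<noteq> 2" if "p \<in># prime_factorization d" for p
    using that assms by (auto dest: in_prime_factors_imp_dvd)
  thus ?thesis
    using assms by (auto simp: kronecker_def kronecker_prime_def intro!: arg_cong[of _ _ prod_mset] image_mset_cong)
qed

lemma odd_prime_factor:
  assumes "odd d" "p \<in># prime_factorization d"
  shows "prime p" "odd p"
  using assms in_prime_factors_imp_dvd in_prime_factors_imp_prime dvd_trans by blast+

lemma kronecker_mult_left:
  assumes "odd d" "d > 0"
  shows "kronecker (a * b) d = kronecker a d * kronecker b d"
  unfolding kronecker_odd[OF assms] prod_mset.distrib [symmetric]
  by (intro arg_cong[of _ _ prod_mset] image_mset_cong Legendre_mult odd_prime_factor[OF assms(1)])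

lemma kronecker_mult_right:
  assumes "odd d" "d > 0" "odd e" "e > 0"
  shows "kronecker a (d * e) = kronecker a d * kronecker a e"
  using assms by (simp add: kronecker_odd prime_factorization_mult)

lemma kronecker_one_left:
  assumes "odd d" "d > 0"
  shows "kronecker 1 d = 1"
proof -
  have "Legendre 1 p = 1" if "p \<in># prime_factorization d" for p
  proof -
    have "\<not> p dvd 1" using in_prime_factors_imp_prime[OF that] by (metis not_prime_unit)
    moreover have "QuadRes p 1" unfolding QuadRes_def by (rule exI[of _ 1]) simp
    ultimately show ?thesis by (simp add: Legendre_def cong_0_iff)
  qed
  thus ?thesis unfolding kronecker_odd[OF assms]
    by (simp cong: image_mset_cong)
qed

lemma kronecker_power_left:
  assumes "odd d" "d > 0"
  shows "kronecker (a ^ n) d = kronecker a d ^ n"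
  by (induction n) (simp_all add: assms kronecker_one_left kronecker_mult_left)

lemma kronecker_prod_left:
  assumes "odd d" "d > 0" "finite A"
  shows "kronecker (\<Prod>i\<in>A. f i) d = (\<Prod>i\<in>A. kronecker (f i) d)"
  using assms(3) by (induction rule: finite_induct) (simp_all add: assms(1,2) kronecker_one_left kronecker_mult_left)

lemma kronecker_square:
  assumes "odd d" "d > 0" "coprime a d"
  shows "kronecker a d * kronecker a d = 1"
proof -
  have "Legendre a p * Legendre a p = 1" if "p \<in># prime_factorization d" for p
  proof -
    have "\<not> p dvd a" using that assms(3)
      by (metis coprime_common_divisor in_prime_factors_imp_dvd in_prime_factors_imp_prime not_prime_unit)
    thus ?thesis using Legendre_values[of a p] Legendre_eq_0_iff[of a p] by auto
  qed
  thus ?thesis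
    unfolding kronecker_odd[OF assms(1,2)] prod_mset.distrib [symmetric]
    by (simp cong: image_mset_cong)
qed

text \<open>Strong induction on \<open>d\<close>, splitting off one prime: either a square
  \<open>p * p\<close> is removed, or \<open>p\<close> is coprime to the cofactor and the sum
  factors. \<open>B\<close> must vary in the induction because the factorisation twists it by
  \<open>p\<close>.\<close>

theorem gauss_sum_mult:
  assumes "odd d" "d > 0" "coprime u d" "coprime B d"
  shows "gauss_sum (u * B) d = of_int (kronecker u d) * gauss_sum B d"
  using assms
proof (induction "nat d" arbitrary: d B rule: less_induct)
  case less
  show ?case
  proof (cases "d = 1")
    case True
    moreover have "{0..<1::int} = {0}" by auto
    ultimately show ?thesis by (simp add: gauss_sum_def kronecker_def)
  next
    case False
    then obtain p where p: "prime p" "p dvd d"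
      using prime_factor_int[of d] less.prems by auto
    then obtain m where m: "d = p * m" by auto
    have p0: "p > 1" using p by (simp add: prime_gt_1_int)
    have m0: "m > 0" using less.prems(2) p0 m by (simp add: zero_less_mult_iff)
    have podd: "odd p" and modd: "odd m" using less.prems(1) m by auto
    have pu: "\<not> p dvd u" and pB: "\<not> p dvd B"
      using less.prems p by (metis coprime_common_divisor not_prime_unit)+
    have kp: "kronecker u p = Legendre u p"
      using p podd p0 by (simp add: kronecker_odd prime_factorization_prime)
    show ?thesis
    proof (cases "p dvd m")
      case True
      then obtain n where n: "m = p * n" by auto
      have n0: "n > 0" using m0 n p0 by (simp add: zero_less_mult_iff)
      have d: "d = p * p * n" using m n by simp
      have "n < d"
      proof -
        have "1 * n < (p * p) * n" using n0 p0 by (intro mult_strict_right_mono) (auto simp: less_1_mult)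
        thus ?thesis using d by simp
      qed
      hence IH: "gauss_sum (u * B) n = of_int (kronecker u n) * gauss_sum B n"
        using less.prems d n0 by (intro less.hyps) auto
      have "kronecker u d = kronecker u p * kronecker u p * kronecker u n"
        using d podd n0 p0 less.prems(1) by (simp add: kronecker_mult_right)
      \<comment> \<open>Two copies of \<open>p\<close> do not change the symbol, just as removing
        \<open>p * p\<close> multiplies both Gauss sums by the same \<open>p\<close>.\<close>
      also have "kronecker u p * kronecker u p = 1"
        using podd p0 p pu by (intro kronecker_square) (auto simp: coprime_commute prime_imp_coprime)
      finally have kd: "kronecker u d = kronecker u n" by simp
      have "\<not> p dvd u * B" using pu pB p by (simp add: prime_dvd_mult_iff)
      thus ?thesis
        using gauss_sum_prime_square[OF p(1) podd pB n0] gauss_sum_prime_square[OF p(1) podd _ n0, of "u * B"] IH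
        by (simp add: kd d [symmetric])
    next
      case False
      have cop: "coprime p m" using p False by (simp add: prime_imp_coprime)
      have "m < d" using m m0 p0 by simp
      hence IH: "gauss_sum (u * (B * p)) m = of_int (kronecker u m) * gauss_sum (B * p) m"
        using less.prems m m0 modd cop by (intro less.hyps) auto
      have "gauss_sum (u * B) d = gauss_sum (u * (B * p)) m * gauss_sum (u * (B * m)) p"
        using gauss_sum_coprime_mult[OF _ m0 cop, of "u * B"] p0 m by (simp add: mult.assoc)
      also have "gauss_sum (u * (B * m)) p = of_int (Legendre u p) * gauss_sum (B * m) p"
        using False pB pu p podd by (intro gauss_sum_mult_prime) (auto simp: prime_dvd_mult_iff)
      also have "gauss_sum (u * (B * p)) m * (of_int (Legendre u p) * gauss_sum (B * m) p)
          = of_int (Legendre u p * kronecker u m) * (gauss_sum (B * p) m * gauss_sum (B * m) p)"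
        unfolding IH by simp
      also have "gauss_sum (B * p) m * gauss_sum (B * m) p = gauss_sum B d"
        using gauss_sum_coprime_mult[OF _ m0 cop, of B] p0 m by simp
      also have "Legendre u p * kronecker u m = kronecker u d"
        using m podd p0 modd m0 by (simp add: kronecker_mult_right kp)
      finally show ?thesis .
    qed
  qed
qed

text \<open>The case \<open>u = -1\<close> of \<open>gauss_sum_mult\<close> relates the conjugate
  sum to the sum itself and so converts its absolute square into its square.\<close>

lemma gauss_sum_square:
  assumes "odd d" "d > 0" "coprime B d"
  shows "(gauss_sum B d)\<^sup>2 = of_int (kronecker (-1) d) * of_int d"
proof -
  have "gauss_sum (- B) d = of_int (kronecker (-1) d) * gauss_sum B d"
    using gauss_sum_mult[OF assms(1,2) _ assms(3), of "-1"] by simp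
  with gauss_sum_conj_product[OF assms(2,1,3)]
  have "of_int (kronecker (-1) d) * (gauss_sum B d)\<^sup>2 = of_int d"
    by (simp add: power2_eq_square mult_ac)
  moreover have "complex_of_int (kronecker (-1) d) * of_int (kronecker (-1) d) = 1"
    using kronecker_square[OF assms(1,2), of "-1"] by (simp flip: of_int_mult)
  ultimately show ?thesis
    by (metis mult.assoc mult_1)
qed

section \<open>Transformation laws\<close>

lemma uhp_nonzero: "\<tau> \<in> upper_half_plane \<Longrightarrow> \<tau> \<noteq> 0"
  by (auto simp: upper_half_plane_def)

lemma automorphy_nonzero:
  fixes c d :: int
  assumes "\<tau> \<in> upper_half_plane" "d \<noteq> 0 \<or> c \<noteq> 0"
  shows "of_int c * \<tau> + of_int d \<noteq> 0"
proof
  assume *: "of_int c * \<tau> + of_int d = 0"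
  from arg_cong[OF this, of Im] assms(1) have "c = 0"
    by (auto simp: upper_half_plane_def)
  with * assms(2) show False by auto
qed

lemma moebius_shift_denominator:
  fixes a \<beta> c d :: int
  assumes det: "a * d - \<beta> * c = 1" and d: "d > 0" and \<tau>: "\<tau> \<in> upper_half_plane"
  defines "\<sigma> \<equiv> \<tau> / (of_int d * (of_int c * \<tau> + of_int d))"
  shows "(of_int a * \<tau> + of_int \<beta>) / (of_int c * \<tau> + of_int d) = \<sigma> + of_real (of_int \<beta> / of_int d)"
    and "- 1 / \<sigma> = of_real ((of_int d)\<^sup>2) * (- 1 / \<tau>) + of_real (- of_int (c * d))"
    and "\<sigma> \<in> upper_half_plane"
proof -
  have nz: "of_int c * \<tau> + of_int d \<noteq> 0" "\<tau> \<noteq> 0" "complex_of_int d \<noteq> 0"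
    using automorphy_nonzero[OF \<tau>, of d c] uhp_nonzero[OF \<tau>] d by auto
  have ad: "complex_of_int a * of_int d = of_int \<beta> * of_int c + 1"
    using det by (metis diff_eq_eq add.commute of_int_1 of_int_add of_int_mult)
  have "(of_int a * \<tau> + of_int \<beta>) * of_int d = (of_int a * of_int d) * \<tau> + of_int \<beta> * of_int d"
    by (simp add: algebra_simps)
  also have "\<dots> = \<tau> + of_int \<beta> * (of_int c * \<tau> + of_int d)"
    unfolding ad by (simp add: algebra_simps)
  finally have "(of_int a * \<tau> + of_int \<beta>) * of_int d = \<tau> + of_int \<beta> * (of_int c * \<tau> + of_int d)" .
  thus "(of_int a * \<tau> + of_int \<beta>) / (of_int c * \<tau> + of_int d) = \<sigma> + of_real (of_int \<beta> / of_int d)"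
    unfolding \<sigma>_def using nz by (simp add: divide_simps mult_ac)
  show inv: "- 1 / \<sigma> = of_real ((of_int d)\<^sup>2) * (- 1 / \<tau>) + of_real (- of_int (c * d))"
    unfolding \<sigma>_def using nz by (simp add: field_simps power2_eq_square)
  have "- 1 / \<tau> \<in> upper_half_plane" using \<tau> uhp_minus_inverse by blast
  moreover have "Im (of_real x * w + of_real y) = x * Im w" for x y w
    by simp
  ultimately have "Im (- 1 / \<sigma>) > 0"
    unfolding inv using d by (simp only: upper_half_plane_def mem_Collect_eq) (simp add: mult_pos_neg)
  thus "\<sigma> \<in> upper_half_plane"
    using uhp_minus_inverse[of \<sigma>] by (simp add: upper_half_plane_def)
qed

text \<open>The analysis shared by both kinds of factor; assumption \<open>K\<close> isolates the
  finite identity that the two Gauss sum computations supply. The roots stay on separate sides, so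
  no branches need comparing.\<close>

lemma qseries_transformation:
  fixes a \<beta> c d m :: int and s :: real
  assumes det: "a * d - \<beta> * c = 1" and d: "d > 0" and \<tau>: "\<tau> \<in> upper_half_plane"
    and m: "m > 0" and s: "s > 0" and per: "\<And>n. \<phi> (n mod m) = \<phi> n"
  defines "\<sigma> \<equiv> \<tau> / (of_int d * (of_int c * \<tau> + of_int d))"
  defines "\<phi>' \<equiv> (\<lambda>n. ee (s * (of_int n)\<^sup>2 * (of_int \<beta> / of_int d)) * \<phi> n)"
  assumes per': "\<And>n. \<phi>' (n mod (m * d)) = \<phi>' n"
    and K: "\<And>l. ee (1 / (4 * s * (of_int (m * d))\<^sup>2) * (of_int l)\<^sup>2 * (- of_int (c * d))) * finite_fourier (m * d) \<phi>' l
              = K * finite_fourier m \<phi> l"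
  shows "qseries \<phi> s ((of_int a * \<tau> + of_int \<beta>) / (of_int c * \<tau> + of_int d)) * (of_int d * csqrt (- \<i> * \<sigma>))
           = K * csqrt (- \<i> * \<tau>) * qseries \<phi> s \<tau>"
proof -
  note mo = moebius_shift_denominator[OF det d \<tau>, folded \<sigma>_def]
  \<comment> \<open>The factor d^2 in \<open>- 1 / \<sigma>\<close> compensates the modulus growing
    from \<open>m\<close> to \<open>m * d\<close>, so the two dual series have equal
    exponents.\<close>
  have s': "1 / (4 * s * (of_int (m * d))\<^sup>2) * (of_int d)\<^sup>2 = 1 / (4 * s * (of_int m)\<^sup>2)"
    using d by (simp add: power_mult_distrib)
  have md: "m * d > 0" using m d by simp
  have "qseries \<phi> s ((of_int a * \<tau> + of_int \<beta>) / (of_int c * \<tau> + of_int d)) = qseries \<phi>' s \<sigma>"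
    unfolding mo(1) qseries_add_real \<phi>'_def ..
  moreover have "qseries \<phi>' s \<sigma> * of_real (of_int (m * d) * sqrt (2 * s)) * csqrt (- \<i> * \<sigma>)
      = qseries (finite_fourier (m * d) \<phi>') (1 / (4 * s * (of_int (m * d))\<^sup>2)) (- 1 / \<sigma>)"
    by (rule qseries_inversion[where \<phi> = \<phi>', OF md per' s mo(3)])
  moreover have "\<dots> = K * qseries (finite_fourier m \<phi>) (1 / (4 * s * (of_int m)\<^sup>2)) (- 1 / \<tau>)"
    unfolding mo(2) qseries_add_real qseries_of_real_mult s' K qseries_cmult ..
  moreover have "qseries (finite_fourier m \<phi>) (1 / (4 * s * (of_int m)\<^sup>2)) (- 1 / \<tau>)
      = qseries \<phi> s \<tau> * of_real (of_int m * sqrt (2 * s)) * csqrt (- \<i> * \<tau>)"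
    by (rule qseries_inversion[where \<phi> = \<phi>, OF m per s \<tau>, symmetric])
  ultimately have "of_real (of_int m * sqrt (2 * s)) *
        (qseries \<phi> s ((of_int a * \<tau> + of_int \<beta>) / (of_int c * \<tau> + of_int d)) * (of_int d * csqrt (- \<i> * \<sigma>)))
      = of_real (of_int m * sqrt (2 * s)) * (K * csqrt (- \<i> * \<tau>) * qseries \<phi> s \<tau>)"
    by (simp add: mult_ac)
  moreover have "complex_of_real (of_int m * sqrt (2 * s)) \<noteq> 0"
    using m s by simp
  ultimately show ?thesis by (metis mult_left_cancel)
qed

text \<open>Put c = 4 b c' and B = b \<beta>. Then 4 B c' = a d - 1 is -1 modulo \<open>d\<close>,
  so B r^2 + l r is congruent to B (r - 2 c' l)^2 + c' l^2. The last summand is cancelled by the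
  phase of the translation by \<open>- c * d\<close>, and a Gauss sum independent of
  \<open>l\<close> remains.\<close>

lemma theta_transformation:
  fixes a \<beta> c d :: int and b :: nat
  assumes det: "a * d - \<beta> * c = 1" and d: "d > 0" and \<tau>: "\<tau> \<in> upper_half_plane"
    and b: "b > 0" "4 * int b dvd c"
  shows "qseries (\<lambda>_. 1) (real b) ((of_int a * \<tau> + of_int \<beta>) / (of_int c * \<tau> + of_int d)) *
           (of_int d * csqrt (- \<i> * (\<tau> / (of_int d * (of_int c * \<tau> + of_int d)))))
         = gauss_sum (int b * \<beta>) d * csqrt (- \<i> * \<tau>) * qseries (\<lambda>_. 1) (real b) \<tau>"
proof (rule qseries_transformation[OF det d \<tau>, where m = 1])
  from b(2) obtain c' where c': "c = 4 * int b * c'" by auto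
  define B where "B = int b * \<beta>"
  have det': "4 * B * c' = a * d - 1" using det by (simp add: B_def c' algebra_simps)
  have eq: "real b * (of_int n)\<^sup>2 * (of_int \<beta> / of_int d) = of_int (B * n\<^sup>2) / (of_int d :: real)" for n
    by (simp add: B_def)
  show "ee (real b * (of_int (n mod (1 * d)))\<^sup>2 * (of_int \<beta> / of_int d)) * 1
      = ee (real b * (of_int n)\<^sup>2 * (of_int \<beta> / of_int d)) * 1" for n
    unfolding eq mult_1 using d
    by (intro arg_cong2[of _ _ _ _ "(*)"] refl ee_divide_cong cong_mult cong_pow cong_refl) (auto simp: cong_def)
  fix l
  have eq2: "1 / (4 * real b * (of_int (1 * d))\<^sup>2) * (of_int l)\<^sup>2 * (- of_int (c * d)) = of_int (- c' * l\<^sup>2) / (of_int d :: real)"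
    using b d by (simp add: c' field_simps power2_eq_square)
  have "ee (of_int (- c' * l\<^sup>2) / of_int d) * finite_fourier (1 * d) (\<lambda>n. ee (of_int (B * n\<^sup>2) / of_int d) * 1) l
      = (\<Sum>r\<in>{0..<d}. ee (of_int (B * (r - 2 * c' * l)\<^sup>2) / of_int d))"
    unfolding finite_fourier_def sum_distrib_left mult_1 mult_1_right ee_add [symmetric] add_divide_distrib [symmetric] of_int_add [symmetric]
  proof (intro sum.cong refl ee_divide_cong)
    fix r
    have "B * (r - 2 * c' * l)\<^sup>2 = B * r\<^sup>2 - (4 * B * c') * (r * l) + (4 * B * c') * c' * l\<^sup>2"
      by (simp add: power2_eq_square algebra_simps)
    also have "\<dots> = - c' * l\<^sup>2 + (B * r\<^sup>2 + l * r) + d * (a * (c' * l\<^sup>2 - r * l))"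
      unfolding det' by (simp add: algebra_simps)
    finally show "[- c' * l\<^sup>2 + (B * r\<^sup>2 + l * r) = B * (r - 2 * c' * l)\<^sup>2] (mod d)"
      by (simp add: cong_def)
  qed (use d in auto)
  also have "\<dots> = gauss_sum B d"
    by (rule gauss_sum_reindex[OF d]) (auto simp: cong_iff_dvd_diff intro: residue_eqI)
  moreover have "{0..<1::int} = {0}" by auto
  ultimately show "ee (1 / (4 * real b * (of_int (1 * d))\<^sup>2) * (of_int l)\<^sup>2 * (- of_int (c * d))) *
      finite_fourier (1 * d) (\<lambda>n. ee (real b * (of_int n)\<^sup>2 * (of_int \<beta> / of_int d)) * 1) l
      = gauss_sum (int b * \<beta>) d * finite_fourier 1 (\<lambda>_. 1) l"
    unfolding eq eq2 by (simp add: B_def finite_fourier_def[of 1])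
qed (use b in auto)

definition odd_char :: "int \<Rightarrow> complex" where
  "odd_char n = of_bool (odd n)"

text \<open>The obvious period is \<open>8 * d\<close>, but odd \<open>n\<close> need only
  \<open>2 * d\<close>: adding 2 d k to an odd r changes r^2 by 4 d k (r + d k), and k (r + d k) is
  even because \<open>r\<close> and \<open>d\<close> are odd.\<close>

lemma odd_gauss_periodic:
  assumes "odd d" "d > 0"
  shows "ee (of_int (B * (n mod (2 * d))\<^sup>2) / of_int (8 * d)) * odd_char (n mod (2 * d))
       = ee (of_int (B * n\<^sup>2) / of_int (8 * d)) * odd_char n"
proof (cases "odd n")
  case True
  define k where "k = n div (2 * d)"
  have n: "n = n mod (2 * d) + 2 * d * k"
    by (simp add: k_def)
  define r where "r = n mod (2 * d)"
  have r: "odd r" using True n by (metis r_def dvd_add_right_iff dvd_mult2 dvd_triv_left add.commute)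
  have "even (k * (r + d * k))" using r assms(1) by auto
  then obtain j where j: "k * (r + d * k) = 2 * j" by (elim evenE)
  have "B * n\<^sup>2 = B * r\<^sup>2 + 4 * d * B * (k * (r + d * k))"
    unfolding n[folded r_def] by (simp add: power2_eq_square algebra_simps)
  also have "\<dots> = B * r\<^sup>2 + (8 * d) * (B * j)" unfolding j by simp
  finally have "[B * r\<^sup>2 = B * n\<^sup>2] (mod (8 * d))" by (simp add: cong_def)
  thus ?thesis using True r assms unfolding odd_char_def r_def
    by (intro arg_cong2[of _ _ _ _ "(*)"] ee_divide_cong) auto
next
  case False
  hence "even (n mod (2 * d))" by (metis dvd_mod dvd_triv_left)
  thus ?thesis using False by (simp add: odd_char_def)
qed

text \<open>The odd residues modulo \<open>2 * d\<close> are represented by 4 u + d with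
  \<open>u\<close> modulo \<open>d\<close>, and (4u + d)^2 / (8d) = d/8 + 2 u^2 / d + u. This splits
  off the eighth root of unity.\<close>

lemma odd_gauss_sum:
  assumes "odd d" "d > 0"
  shows "(\<Sum>r\<in>{0..<2 * d}. ee (of_int (B * r\<^sup>2) / of_int (8 * d)) * odd_char r)
         = ee (of_int (B * d) / 8) * gauss_sum (2 * B) d"
proof -
  define f where "f = (\<lambda>r. ee (of_int (B * r\<^sup>2) / of_int (8 * d)) * odd_char r)"
  \<comment> \<open>Here \<open>x mod d\<close> is \<open>u\<close>, while \<open>x div d\<close> is
    0 or 1 and decides the parity; the value 1 yields even residues, whose terms vanish.\<close>
  define g where "g = (\<lambda>x. 4 * (x mod d) + d * (1 + x div d))"
  have "(\<Sum>r\<in>{0..<2 * d}. f r) = (\<Sum>x\<in>{0..<2 * d}. f (g x))"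
  proof (rule sum_residues_reindex [symmetric])
    show "f (x mod (2 * d)) = f x" for x
      unfolding f_def by (rule odd_gauss_periodic[OF assms])
  next
    fix x y assume xy: "x \<in> {0..<2 * d}" "y \<in> {0..<2 * d}" and cong: "[g x = g y] (mod (2 * d))"
    have div: "x div d \<in> {0..<2}" "y div d \<in> {0..<2}"
      using xy assms by (auto simp: pos_imp_zdiv_nonneg_iff mult.commute intro!: int_div_less)
    have "[g x = g y] (mod 2)"
      using cong by (rule cong_dvd_modulus) simp
    hence "even (g x) \<longleftrightarrow> even (g y)" by (simp add: cong_def even_iff_mod_2_eq_zero)
    hence "even (x div d) \<longleftrightarrow> even (y div d)" using assms by (simp add: g_def)
    moreover have "z = 0 \<or> z = 1" if "z \<in> {0..<2}" for z :: int
      using that unfolding atLeastLessThan_iff by linarith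
    ultimately have 1: "x div d = y div d" using div by (metis odd_one even_zero)
    have "[g x = g y] (mod d)"
      using cong by (rule cong_dvd_modulus) simp
    hence "[4 * (x mod d) = 4 * (y mod d)] (mod d)"
      by (simp add: g_def cong_def mod_simps)
    moreover have "coprime (4::int) d"
      using assms(1) coprime_mult_left_iff[of 2 2 d] by simp
    ultimately have "[x mod d = y mod d] (mod d)"
      by (simp add: cong_mult_lcancel)
    hence 2: "x mod d = y mod d" by (simp add: cong_def)
    from 1 2 show "x = y" by (metis div_mult_mod_eq)
  qed (use assms in auto)
  also have "\<dots> = (\<Sum>u\<in>{0..<d}. \<Sum>z\<in>{0..<2}. f (4 * u + d * (1 + z)))"
    unfolding mult.commute[of 2 d]
    by (subst sum_split_residues) (use assms in \<open>auto simp: g_def intro!: sum.cong\<close>)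
  also have "\<dots> = (\<Sum>u\<in>{0..<d}. f (4 * u + d))"
  proof (intro sum.cong refl)
    fix u
    have "{0..<2::int} = {0, 1}" by auto
    moreover have "f (4 * u + d * (1 + 1)) = 0" by (simp add: f_def odd_char_def)
    ultimately show "(\<Sum>z\<in>{0..<2}. f (4 * u + d * (1 + z))) = f (4 * u + d)" by simp
  qed
  also have "\<dots> = (\<Sum>u\<in>{0..<d}. ee (of_int (B * d) / 8) * ee (of_int (2 * B * u\<^sup>2) / of_int d))"
  proof (intro sum.cong refl)
    fix u
    have "of_int (B * (4 * u + d)\<^sup>2) / of_int (8 * d) = of_int (B * d) / 8 + of_int (2 * B * u\<^sup>2) / of_int d + real_of_int (B * u)"
      using assms(2) by (simp add: field_simps power2_eq_square)
    thus "f (4 * u + d) = ee (of_int (B * d) / 8) * ee (of_int (2 * B * u\<^sup>2) / of_int d)"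
      unfolding f_def using assms(1) by (simp add: odd_char_def ee_add del: of_int_mult of_int_power of_int_add)
  qed
  finally show ?thesis
    by (simp only: f_def gauss_sum_def sum_distrib_left)
qed

text \<open>With c = 2 e c' the inverse of -2B is c', and the square is completed by the shift 4 c'
  l, which preserves parity. A sign \<open>ee (l / 2)\<close> is left over; it is the finite Fourier
  transform of \<open>odd_char\<close> modulo 2.\<close>

lemma Psi_transformation:
  fixes a \<beta> c d :: int and e :: nat
  assumes det: "a * d - \<beta> * c = 1" and d: "d > 0" "odd d" and \<tau>: "\<tau> \<in> upper_half_plane"
    and e: "e > 0" "2 * int e dvd c"
  shows "qseries odd_char (real e / 8) ((of_int a * \<tau> + of_int \<beta>) / (of_int c * \<tau> + of_int d)) *
           (of_int d * csqrt (- \<i> * (\<tau> / (of_int d * (of_int c * \<tau> + of_int d)))))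
         = (ee (of_int (int e * \<beta> * d) / 8) * gauss_sum (2 * (int e * \<beta>)) d) * csqrt (- \<i> * \<tau>) * qseries odd_char (real e / 8) \<tau>"
proof (rule qseries_transformation[OF det d(1) \<tau>, where m = 2])
  from e(2) obtain c' where c': "c = 2 * int e * c'" by auto
  define B where "B = int e * \<beta>"
  have det': "2 * B * c' = a * d - 1" using det by (simp add: B_def c' algebra_simps)
  have odd_a: "odd a" using det' by (metis diff_add_cancel dvd_triv_left even_mult_iff even_plus_one_iff mult.assoc)
  have eq: "real e / 8 * (of_int n)\<^sup>2 * (of_int \<beta> / of_int d) = of_int (B * n\<^sup>2) / (of_int (8 * d) :: real)" for n
    by (simp add: B_def)
  show "ee (real e / 8 * (of_int (n mod (2 * d)))\<^sup>2 * (of_int \<beta> / of_int d)) * odd_char (n mod (2 * d))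
      = ee (real e / 8 * (of_int n)\<^sup>2 * (of_int \<beta> / of_int d)) * odd_char n" for n
    unfolding eq by (rule odd_gauss_periodic[OF d(2,1)])
  show "odd_char (n mod 2) = odd_char n" for n
    by (simp add: odd_char_def)
  fix l
  have eq2: "1 / (4 * (real e / 8) * (of_int (2 * d))\<^sup>2) * (of_int l)\<^sup>2 * (- of_int (c * d)) = of_int (- c' * l\<^sup>2) / (of_int d :: real)"
    using e d by (simp add: c' field_simps power2_eq_square)
  define f where "f = (\<lambda>r. ee (of_int (B * r\<^sup>2) / of_int (8 * d)) * odd_char r)"
  have "ee (of_int (- c' * l\<^sup>2) / of_int d) * finite_fourier (2 * d) f l = (\<Sum>r\<in>{0..<2 * d}. ee (of_int l / 2) * f (r - 4 * c' * l))"
    unfolding finite_fourier_def sum_distrib_left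
  proof (intro sum.cong refl)
    fix r
    show "ee (of_int (- c' * l\<^sup>2) / of_int d) * (f r * ee (of_int (l * r) / of_int (2 * d))) = ee (of_int l / 2) * f (r - 4 * c' * l)"
    proof (cases "odd r")
      case True
      \<comment> \<open>An odd \<open>a * r\<close> turns the term -4 d (a r) l, divided by 8 d,
        into l/2 modulo 1: this is the source of the sign.\<close>
      with odd_a have "odd (a * r)" by simp
      then obtain j where j: "a * r = 2 * j + 1" by (elim oddE)
      have "B * (r - 4 * c' * l)\<^sup>2 = B * r\<^sup>2 - 4 * (2 * B * c') * (r * l) + 8 * (2 * B * c') * (c' * l\<^sup>2)"
        by (simp add: power2_eq_square algebra_simps)
      also have "\<dots> = B * r\<^sup>2 + 4 * (r * l) - 8 * (c' * l\<^sup>2) - 4 * d * ((a * r) * l) + 8 * d * (a * c' * l\<^sup>2)"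
        unfolding det' by (simp add: algebra_simps)
      also have "\<dots> = B * r\<^sup>2 + 4 * (r * l) - 8 * (c' * l\<^sup>2) - 4 * d * l + 8 * d * (a * c' * l\<^sup>2 - j * l)"
        unfolding j by (simp add: algebra_simps)
      finally have *: "B * (r - 4 * c' * l)\<^sup>2 = \<dots>" .
      have "of_int (- c' * l\<^sup>2) / of_int d + (of_int (B * r\<^sup>2) / of_int (8 * d) + of_int (l * r) / of_int (2 * d))
        = of_int l / 2 + of_int (B * (r - 4 * c' * l)\<^sup>2) / of_int (8 * d) + real_of_int (- (a * c' * l\<^sup>2 - j * l))"
        unfolding * using d(1) by (simp add: field_simps)
      thus ?thesis using True
        by (simp add: f_def odd_char_def ee_add [symmetric] del: of_int_mult of_int_power of_int_add of_int_diff of_int_minus)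
           (simp only: ee_add ee_of_int mult_1_right)
    qed (simp add: f_def odd_char_def)
  qed
  also have "\<dots> = ee (of_int l / 2) * (\<Sum>r\<in>{0..<2 * d}. f r)"
    unfolding sum_distrib_left [symmetric]
  proof (intro arg_cong2[of _ _ _ _ "(*)"] refl sum_residues_reindex)
    show "f (x mod (2 * d)) = f x" for x
      unfolding f_def by (rule odd_gauss_periodic[OF d(2,1)])
  next
    fix x y assume "x \<in> {0..<2 * d}" "y \<in> {0..<2 * d}" "[x - 4 * c' * l = y - 4 * c' * l] (mod (2 * d))"
    thus "x = y" by (intro residue_eqI[of x "2 * d" y]) (auto simp: cong_iff_dvd_diff)
  qed (use d in auto)
  also have "(\<Sum>r\<in>{0..<2 * d}. f r) = ee (of_int (B * d) / 8) * gauss_sum (2 * B) d"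
    unfolding f_def by (rule odd_gauss_sum[OF d(2,1)])
  \<comment> \<open>Only the residue 1 contributes to \<open>finite_fourier 2 odd_char l\<close>,
    which is therefore \<open>ee (l / 2)\<close>.\<close>
  moreover have "{0..<2::int} = {0, 1}" by auto
  ultimately show "ee (1 / (4 * (real e / 8) * (of_int (2 * d))\<^sup>2) * (of_int l)\<^sup>2 * (- of_int (c * d))) *
      finite_fourier (2 * d) (\<lambda>n. ee (real e / 8 * (of_int n)\<^sup>2 * (of_int \<beta> / of_int d)) * odd_char n) l
      = ee (of_int (int e * \<beta> * d) / 8) * gauss_sum (2 * (int e * \<beta>)) d * finite_fourier 2 odd_char l"
    unfolding eq eq2 by (simp add: B_def f_def finite_fourier_def[of 2] odd_char_def mult_ac)
qed (use e in auto)

text \<open>One inversion in \<sigma> suffices, as \<open>- 1 / \<sigma>\<close> is an affine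
  function of \<tau>. The root stays on the left and is disposed of in the product. Constant
  coefficients are covered by taking \<open>e = 8 * b\<close>.\<close>

lemma qseries_at_cusp:
  fixes a \<beta> c d :: int and e :: nat
  assumes det: "a * d - \<beta> * c = 1" and c: "c > 0" and e: "e > 0"
    and per: "\<And>n. \<phi> (n mod 2) = \<phi> n"
  shows "\<exists>Q. holomorphic_at_ii_inf Q \<and> (\<forall>\<tau>\<in>upper_half_plane.
       qseries \<phi> (real e / 8) ((of_int a * \<tau> + of_int \<beta>) / (of_int c * \<tau> + of_int d)) *
         csqrt (- \<i> * (- 1 / (of_int c * (of_int c * \<tau> + of_int d)))) = Q \<tau>)"
proof -
  define s where "s = real e / 8"
  \<comment> \<open>This modulus clears the denominator of the phase and is even, so both the phase
    and \<phi> are periodic modulo \<open>m\<close>.\<close>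
  define m where "m = 8 * c"
  define \<phi>' where "\<phi>' = (\<lambda>n. ee (s * (of_int n)\<^sup>2 * (of_int a / of_int c)) * \<phi> n)"
  have s: "s > 0" and m: "m > 0" using e c by (auto simp: s_def m_def)
  have eq: "s * (of_int n)\<^sup>2 * (of_int a / of_int c) = of_int (int e * a * n\<^sup>2) / (of_int m :: real)" for n
    by (simp add: s_def m_def)
  have per': "\<phi>' (n mod m) = \<phi>' n" for n
  proof -
    have "\<phi> (n mod m) = \<phi> n"
      using per[of "n mod m"] per[of n] by (simp add: m_def mod_mod_cancel)
    moreover have "ee (of_int (int e * a * (n mod m)\<^sup>2) / of_int m) = ee (of_int (int e * a * n\<^sup>2) / of_int m)"
      using m by (intro ee_divide_cong cong_mult cong_pow cong_refl) (auto simp: cong_def)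
    ultimately show ?thesis by (simp only: \<phi>'_def eq)
  qed
  define k where "k = complex_of_real (of_int m * sqrt (2 * s))"
  have k: "k \<noteq> 0" using m s by (simp add: k_def)
  define \<psi> where "\<psi> = (\<lambda>l. ee (1 / (4 * s * (of_int m)\<^sup>2) * (of_int l)\<^sup>2 * of_int (c * d)) * finite_fourier m \<phi>' l)"
  define Q where "Q = (\<lambda>\<tau>. qseries (\<lambda>l. inverse k * \<psi> l) (real 1 / real (32 * e)) \<tau>)"
  have "holomorphic_at_ii_inf Q"
    unfolding Q_def
  proof (rule qseries_holomorphic_at_ii_inf)
    fix l
    show "norm (inverse k * \<psi> l) \<le> norm (inverse k) * (\<Sum>r\<in>{0..<m}. norm (\<phi>' r))"
      unfolding norm_mult \<psi>_def by (intro mult_left_mono) (simp_all add: norm_finite_fourier_le)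
  qed (use e in auto)
  moreover have "qseries \<phi> (real e / 8) ((of_int a * \<tau> + of_int \<beta>) / (of_int c * \<tau> + of_int d)) *
         csqrt (- \<i> * (- 1 / (of_int c * (of_int c * \<tau> + of_int d)))) = Q \<tau>"
    if \<tau>: "\<tau> \<in> upper_half_plane" for \<tau>
  proof -
    define \<sigma> where "\<sigma> = - 1 / (of_int c * (of_int c * \<tau> + of_int d))"
    have nz: "of_int c * \<tau> + of_int d \<noteq> 0" "complex_of_int c \<noteq> 0"
      using automorphy_nonzero[OF \<tau>, of d c] c by auto
    have ad: "complex_of_int a * of_int d = of_int \<beta> * of_int c + 1"
      using det by (metis diff_eq_eq add.commute of_int_1 of_int_add of_int_mult)
    have "(of_int a * \<tau> + of_int \<beta>) * of_int c = of_int a * (of_int c * \<tau> + of_int d) - 1"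
      using ad by (simp add: algebra_simps)
    hence mo: "(of_int a * \<tau> + of_int \<beta>) / (of_int c * \<tau> + of_int d) = \<sigma> + of_real (of_int a / of_int c)"
      unfolding \<sigma>_def using nz by (simp add: divide_simps mult_ac)
    have inv: "- 1 / \<sigma> = of_real ((of_int c)\<^sup>2) * \<tau> + of_real (of_int (c * d))"
      unfolding \<sigma>_def using nz by (simp add: field_simps power2_eq_square)
    have "Im (of_real x * w + of_real y) = x * Im w" for x y w
      by simp
    hence "Im (- 1 / \<sigma>) > 0"
      unfolding inv using c \<tau> by (simp only: upper_half_plane_def mem_Collect_eq) (simp add: zero_less_mult_iff)
    hence \<sigma>: "\<sigma> \<in> upper_half_plane"
      using uhp_minus_inverse[of \<sigma>] by (simp add: upper_half_plane_def)
    have s': "1 / (4 * s * (of_int m)\<^sup>2) * (of_int c)\<^sup>2 = real 1 / real (32 * e)"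
      using c e by (simp add: s_def m_def field_simps)
    have "qseries \<phi> s ((of_int a * \<tau> + of_int \<beta>) / (of_int c * \<tau> + of_int d)) = qseries \<phi>' s \<sigma>"
      unfolding mo qseries_add_real \<phi>'_def ..
    moreover have "qseries \<phi>' s \<sigma> * k * csqrt (- \<i> * \<sigma>)
        = qseries (finite_fourier m \<phi>') (1 / (4 * s * (of_int m)\<^sup>2)) (- 1 / \<sigma>)"
      unfolding k_def by (rule qseries_inversion[where \<phi> = \<phi>', OF m per' s \<sigma>])
    moreover have "\<dots> = qseries \<psi> (real 1 / real (32 * e)) \<tau>"
      unfolding inv qseries_add_real qseries_of_real_mult s' \<psi>_def ..
    ultimately have "qseries \<phi> s ((of_int a * \<tau> + of_int \<beta>) / (of_int c * \<tau> + of_int d)) * csqrt (- \<i> * \<sigma>)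
        = inverse k * qseries \<psi> (real 1 / real (32 * e)) \<tau>"
      using k by (simp add: field_simps)
    thus ?thesis by (simp only: Q_def qseries_cmult s_def \<sigma>_def)
  qed
  ultimately show ?thesis by blast
qed

lemma holomorphic_at_ii_inf_cong:
  "(\<And>\<tau>. \<tau> \<in> upper_half_plane \<Longrightarrow> f \<tau> = g \<tau>) \<Longrightarrow> holomorphic_at_ii_inf f \<longleftrightarrow> holomorphic_at_ii_inf g"
  by (simp add: holomorphic_at_ii_inf_def)

lemma holomorphic_at_ii_inf_const: "holomorphic_at_ii_inf (\<lambda>_. k)"
  unfolding holomorphic_at_ii_inf_def by (intro exI[of _ 1] conjI exI[of _ "\<lambda>_. k"]) auto

text \<open>The two periods may differ; over the common period \<open>N1 * N2\<close> each local
  parameter is a power of the new one.\<close>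

lemma holomorphic_at_ii_inf_mult:
  assumes "holomorphic_at_ii_inf f1" "holomorphic_at_ii_inf f2"
  shows "holomorphic_at_ii_inf (\<lambda>\<tau>. f1 \<tau> * f2 \<tau>)"
proof -
  obtain N1 g1 where 1: "N1 > 0" "g1 holomorphic_on ball 0 1"
    "\<And>\<tau>. \<tau> \<in> upper_half_plane \<Longrightarrow> f1 \<tau> = g1 (q_pow \<tau> (1 / real N1))"
    using assms(1) unfolding holomorphic_at_ii_inf_def by blast
  obtain N2 g2 where 2: "N2 > 0" "g2 holomorphic_on ball 0 1"
    "\<And>\<tau>. \<tau> \<in> upper_half_plane \<Longrightarrow> f2 \<tau> = g2 (q_pow \<tau> (1 / real N2))"
    using assms(2) unfolding holomorphic_at_ii_inf_def by blast
  have pow: "(\<lambda>w. g (w ^ n)) holomorphic_on ball 0 1" if "g holomorphic_on ball 0 1" "n > 0" for g :: "complex \<Rightarrow> complex" and n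
  proof -
    have "(g \<circ> (\<lambda>w. w ^ n)) holomorphic_on ball 0 1"
      by (rule holomorphic_on_compose_gen[OF _ that(1)])
         (use that(2) in \<open>auto intro!: holomorphic_intros simp: norm_power power_less_one_iff\<close>)
    thus ?thesis by (simp add: o_def)
  qed
  show ?thesis
    unfolding holomorphic_at_ii_inf_def
  proof (intro exI[of _ "N1 * N2"] conjI exI[of _ "\<lambda>w. g1 (w ^ N2) * g2 (w ^ N1)"] ballI)
    show "(\<lambda>w. g1 (w ^ N2) * g2 (w ^ N1)) holomorphic_on ball 0 1"
      by (intro holomorphic_on_mult pow 1 2)
    fix \<tau> assume "\<tau> \<in> upper_half_plane"
    thus "f1 \<tau> * f2 \<tau> = g1 (q_pow \<tau> (1 / real (N1 * N2)) ^ N2) * g2 (q_pow \<tau> (1 / real (N1 * N2)) ^ N1)"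
      using 1 2 by (simp add: q_pow_power)
  qed (use 1 2 in auto)
qed

lemma holomorphic_at_ii_inf_prod:
  "finite A \<Longrightarrow> (\<And>i. i \<in> A \<Longrightarrow> holomorphic_at_ii_inf (f i)) \<Longrightarrow> holomorphic_at_ii_inf (\<lambda>\<tau>. \<Prod>i\<in>A. f i \<tau>)"
  by (induction rule: finite_induct) (simp_all add: holomorphic_at_ii_inf_const holomorphic_at_ii_inf_mult)

section \<open>The given series as sums over squares; values at the imaginary unit and under
  translation\<close>

lemma theta_eq_qseries: "theta (of_nat b * \<tau>) = qseries (\<lambda>_. 1) (real b) \<tau>"
  unfolding theta_def qseries_def q_pow_def by (intro infsum_cong) (simp add: mult_ac)

text \<open>Positive odd n = 2m + 1 give n^2 / 8 = 1/8 + m(m+1)/2, and the symmetry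
  \<open>n \<mapsto> - n\<close> explains the factor 1/2.\<close>

lemma Psi_eq_qseries:
  assumes "e > 0" "\<tau> \<in> upper_half_plane"
  shows "q_pow \<tau> (real e / 8) * Psi (of_nat e * \<tau>) = qseries odd_char (real e / 8) \<tau> / 2"
proof -
  define t where "t = (\<lambda>n::int. q_pow \<tau> (real e / 8 * (of_int n)\<^sup>2))"
  have summ: "t summable_on A" for A
    using qseries_summable[of "real e / 8" \<tau> "\<lambda>_. 1" 1 A] assms by (simp add: t_def upper_half_plane_def)
  have t_uminus: "t (- n) = t n" for n by (simp add: t_def)
  have "qseries odd_char (real e / 8) \<tau> = infsum t {n. odd n}"
    unfolding qseries_def t_def odd_char_def by (rule infsum_cong_neutral) auto
  also have "{n::int. odd n} = {n. odd n \<and> n > 0} \<union> {n. odd n \<and> n < 0}"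
    by (auto simp: not_less order_le_less)
  also have "infsum t \<dots> = infsum t {n. odd n \<and> n > 0} + infsum t {n. odd n \<and> n < 0}"
    by (rule infsum_Un_disjoint[OF summ summ]) auto
  also have "infsum t {n. odd n \<and> n < 0} = infsum t {n. odd n \<and> n > 0}"
    by (rule infsum_reindex_bij_witness[of _ uminus uminus]) (auto simp: t_uminus)
  also have "infsum t {n. odd n \<and> n > 0} = (\<Sum>\<^sub>\<infinity>m::nat. t (2 * int m + 1))"
    by (rule infsum_reindex_bij_witness[of _ "\<lambda>m. 2 * int m + 1" "\<lambda>n. nat (n div 2)"]) (auto elim!: oddE)
  finally have half: "qseries odd_char (real e / 8) \<tau> / 2 = (\<Sum>\<^sub>\<infinity>m::nat. t (2 * int m + 1))"
    by simp
  have "t summable_on range (\<lambda>m. 2 * int m + 1)" by (rule summ)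
  hence "(\<lambda>m. t (2 * int m + 1)) summable_on UNIV"
    by (subst (asm) summable_on_reindex) (auto simp: o_def inj_on_def)
  hence "(\<lambda>m. t (2 * int m + 1)) sums (qseries odd_char (real e / 8) \<tau> / 2)"
    unfolding half by (intro has_sum_imp_sums has_sum_infsum)
  hence "(\<lambda>m. inverse (q_pow \<tau> (real e / 8)) * t (2 * int m + 1)) sums
      (inverse (q_pow \<tau> (real e / 8)) * (qseries odd_char (real e / 8) \<tau> / 2))"
    by (rule sums_mult)
  also have "(\<lambda>m. inverse (q_pow \<tau> (real e / 8)) * t (2 * int m + 1)) = (\<lambda>m. q_pow (of_nat e * \<tau>) (real m * (real m + 1) / 2))"
  proof
    fix m
    have "t (2 * int m + 1) = q_pow \<tau> (real e / 8 + real e * (real m * (real m + 1) / 2))"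
      by (simp add: t_def power2_eq_square algebra_simps add_divide_distrib)
    also have "\<dots> = q_pow \<tau> (real e / 8) * q_pow \<tau> (real e * (real m * (real m + 1) / 2))"
      by (rule q_pow_add)
    also have "q_pow \<tau> (real e * (real m * (real m + 1) / 2)) = q_pow (of_nat e * \<tau>) (real m * (real m + 1) / 2)"
      by (simp add: q_pow_def mult_ac)
    finally show "inverse (q_pow \<tau> (real e / 8)) * t (2 * int m + 1) = q_pow (of_nat e * \<tau>) (real m * (real m + 1) / 2)"
      by (simp add: q_pow_def)
  qed
  finally have "Psi (of_nat e * \<tau>) = inverse (q_pow \<tau> (real e / 8)) * (qseries odd_char (real e / 8) \<tau> / 2)"
    unfolding Psi_def by (rule sums_unique [symmetric])
  moreover have "q_pow \<tau> (real e / 8) \<noteq> 0" by (simp add: q_pow_def)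
  ultimately show ?thesis by (simp add: field_simps)
qed

text \<open>At \<open>\<i>\<close> every power of q is a positive real, so the term at
  \<open>n = 1\<close> is a positive lower bound. The index 1 is present in both kinds of
  series.\<close>

lemma qseries_imaginary_unit_nonzero:
  assumes s: "s > 0" and a: "\<And>n. a n = 0 \<or> a n = 1" "a 1 = 1"
  shows "qseries a s \<i> \<noteq> 0"
proof -
  have bd: "norm (a n) \<le> 1" for n
    using a(1)[of n] by auto
  have summ: "(\<lambda>n. a n * q_pow \<i> (s * (of_int n)\<^sup>2)) summable_on UNIV"
    by (rule qseries_summable[OF s _ bd]) simp
  have q: "q_pow \<i> r = of_real (exp (- 2 * pi * r))" for r
    by (simp add: q_pow_def exp_of_real [symmetric] mult_ac)
  have nonneg: "Re (a n * q_pow \<i> (s * (of_int n)\<^sup>2)) \<ge> 0" for n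
    using a(1)[of n] by (auto simp: q)
  have "0 < (\<Sum>n\<in>{1}. Re (a n * q_pow \<i> (s * (of_int n)\<^sup>2)))"
    using a(2) by (simp add: q)
  also have "\<dots> \<le> (\<Sum>\<^sub>\<infinity>n. Re (a n * q_pow \<i> (s * (of_int n)\<^sup>2)))"
    by (rule finite_sum_le_infsum[OF summable_on_Re[OF summ]]) (use nonneg in auto)
  also have "\<dots> = Re (qseries a s \<i>)"
    unfolding qseries_def by (rule infsum_Re[OF summ])
  finally show ?thesis by auto
qed

lemma qseries_one_plus_1: "qseries (\<lambda>_. 1) (real b) (\<tau> + 1) = qseries (\<lambda>_. 1) (real b) \<tau>"
proof -
  have "ee (real b * (of_int n)\<^sup>2 * 1) * 1 = 1" for n
    using ee_of_int[of "int b * n\<^sup>2"] by simp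
  thus ?thesis using qseries_add_real[of "\<lambda>_. 1" "real b" \<tau> 1] by simp
qed

text \<open>Odd squares are 1 modulo 8, so all terms acquire the same phase.\<close>

lemma qseries_odd_char_plus_1:
  "qseries odd_char (real e / 8) (\<tau> + 1) = ee (real e / 8) * qseries odd_char (real e / 8) \<tau>"
proof -
  have eq: "ee (real e / 8 * (of_int n)\<^sup>2 * 1) * odd_char n = ee (real e / 8) * odd_char n" for n
  proof (cases "odd n")
    case True
    then obtain j where j: "n = 2 * j + 1" by (elim oddE)
    have "even (j * (j + 1))" by simp
    then obtain i where "j * (j + 1) = 2 * i" by (elim evenE)
    hence "n\<^sup>2 = 1 + 8 * i" by (simp add: j power2_eq_square algebra_simps)
    hence "[int e * n\<^sup>2 = int e * 1] (mod 8)"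
      by (intro cong_mult cong_refl) (simp add: cong_def)
    from ee_divide_cong[OF _ this] show ?thesis by simp
  qed (simp add: odd_char_def)
  show ?thesis
    using qseries_add_real[of odd_char "real e / 8" \<tau> 1] by (simp only: eq of_real_1 qseries_cmult)
qed

section \<open>Products of theta series\<close>

definition theta_product :: "nat \<Rightarrow> (nat \<Rightarrow> nat) \<Rightarrow> nat \<Rightarrow> (nat \<Rightarrow> nat) \<Rightarrow> complex \<Rightarrow> complex" where
  "theta_product v b k c \<tau> =
     (\<Prod>i=1..v. qseries (\<lambda>_. 1) (real (b i)) \<tau>) * (\<Prod>j=1..k. qseries odd_char (real (c j) / 8) \<tau>)"

lemma q_pow_psi_prod_eq:
  assumes "\<tau> \<in> upper_half_plane" "\<forall>j\<in>{1..k}. c j > 0" "h = (\<Sum>j=1..k. c j)"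
  shows "q_pow \<tau> (real h / 8) * psi_prod v b k c \<tau> = theta_product v b k c \<tau> / 2 ^ k"
proof -
  have "q_pow \<tau> (\<Sum>j\<in>A. x j) = (\<Prod>j\<in>A. q_pow \<tau> (x j))" if "finite A" for A :: "nat set" and x
    using that by (induction rule: finite_induct) (simp_all add: q_pow_add, simp add: q_pow_def)
  hence "q_pow \<tau> (real h / 8) = (\<Prod>j=1..k. q_pow \<tau> (real (c j) / 8))"
    by (simp add: assms(3) sum_divide_distrib)
  hence "q_pow \<tau> (real h / 8) * psi_prod v b k c \<tau>
      = (\<Prod>i=1..v. theta (of_nat (b i) * \<tau>)) * (\<Prod>j=1..k. q_pow \<tau> (real (c j) / 8) * Psi (of_nat (c j) * \<tau>))"
    by (simp add: psi_prod_def prod.distrib mult_ac)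
  also have "(\<Prod>j=1..k. q_pow \<tau> (real (c j) / 8) * Psi (of_nat (c j) * \<tau>))
      = (\<Prod>j=1..k. qseries odd_char (real (c j) / 8) \<tau> / 2)"
    using assms by (intro prod.cong refl Psi_eq_qseries) auto
  finally show ?thesis
    by (simp add: theta_product_def theta_eq_qseries prod_dividef)
qed

text \<open>Multiplying the \<open>v + k = 2 * w\<close> laws leaves \<open>w\<close>-th powers of
  the squares of \<open>x\<close>, \<open>y\<close> and \<open>g\<close>; these squares are free of
  roots, and that of \<open>g\<close> contributes the symbol of -1.\<close>

lemma theta_product_transformation:
  fixes a \<beta> C d :: int and b c :: "nat \<Rightarrow> nat"
  assumes det: "a * d - \<beta> * C = 1" and d: "d > 0" "odd d" and \<tau>: "\<tau> \<in> upper_half_plane"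
    and b: "\<forall>i\<in>{1..v}. b i > 0 \<and> 4 * int (b i) dvd C"
    and c: "\<forall>j\<in>{1..k}. c j > 0 \<and> 2 * int (c j) dvd C"
    and w: "v + k = 2 * w" and h: "8 dvd (\<Sum>j=1..k. c j)"
  shows "theta_product v b k c ((of_int a * \<tau> + of_int \<beta>) / (of_int C * \<tau> + of_int d)) =
     of_int (kronecker ((-1) ^ w * (if even v \<and> even k then 4 else 8) *
             (\<Prod>i=1..v. int (b i)) * (\<Prod>j=1..k. int (c j))) d) *
     (of_int C * \<tau> + of_int d) ^ w * theta_product v b k c \<tau>"
    (is "?P' = of_int (kronecker ?D d) * _ * ?P")
proof -
  let ?X = "\<lambda>n. complex_of_int (kronecker n d)"
  define \<sigma> where "\<sigma> = \<tau> / (of_int d * (of_int C * \<tau> + of_int d))"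
  define x y g where "x = of_int d * csqrt (- \<i> * \<sigma>)" and "y = csqrt (- \<i> * \<tau>)" and "g = gauss_sum \<beta> d"
  define \<tau>' where "\<tau>' = (of_int a * \<tau> + of_int \<beta>) / (of_int C * \<tau> + of_int d)"
  have nz: "of_int C * \<tau> + of_int d \<noteq> 0" "\<tau> \<noteq> 0"
    using automorphy_nonzero[OF \<tau>, of d C] uhp_nonzero[OF \<tau>] d by auto
  have copC: "coprime C d"
  proof (rule coprimeI)
    fix n assume "n dvd C" "n dvd d"
    hence "n dvd a * d - \<beta> * C" by simp
    thus "is_unit n" by (simp add: det)
  qed
  have cop\<beta>: "coprime \<beta> d"
  proof (rule coprimeI)
    fix n assume "n dvd \<beta>" "n dvd d"
    hence "n dvd a * d - \<beta> * C" by simp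
    thus "is_unit n" by (simp add: det)
  qed
  have cop: "coprime n d" if "n dvd C" for n
    using coprime_divisors[OF that dvd_refl copC] .
  have theta: "qseries (\<lambda>_. 1) (real (b i)) \<tau>' * x = (?X (int (b i)) * g) * y * qseries (\<lambda>_. 1) (real (b i)) \<tau>"
    if "i \<in> {1..v}" for i
  proof -
    have bi: "b i > 0" "4 * int (b i) dvd C" using b that by auto
    have "gauss_sum (int (b i) * \<beta>) d = ?X (int (b i)) * g"
      unfolding g_def using bi by (intro gauss_sum_mult d cop\<beta> cop) (metis dvd_mult_right)
    thus ?thesis
      using theta_transformation[OF det d(1) \<tau> bi] by (simp add: x_def y_def \<sigma>_def \<tau>'_def)
  qed
  have Psi: "qseries odd_char (real (c j) / 8) \<tau>' * x
      = (ee (of_int (int (c j) * \<beta> * d) / 8) * (?X (2 * int (c j)) * g)) * y * qseries odd_char (real (c j) / 8) \<tau>"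
    if "j \<in> {1..k}" for j
  proof -
    have cj: "c j > 0" "2 * int (c j) dvd C" using c that by auto
    have "gauss_sum (2 * (int (c j) * \<beta>)) d = ?X (2 * int (c j)) * g"
      unfolding g_def mult.assoc [symmetric] using cj by (intro gauss_sum_mult d cop\<beta> cop)
    thus ?thesis
      using Psi_transformation[OF det d \<tau> cj] by (simp add: x_def y_def \<sigma>_def \<tau>'_def)
  qed
  have "theta_product v b k c \<tau>' * x ^ (v + k)
      = (\<Prod>i=1..v. qseries (\<lambda>_. 1) (real (b i)) \<tau>' * x) * (\<Prod>j=1..k. qseries odd_char (real (c j) / 8) \<tau>' * x)"
    by (simp add: theta_product_def prod.distrib power_add mult_ac)
  also have "\<dots> = (\<Prod>i=1..v. (?X (int (b i)) * g) * y * qseries (\<lambda>_. 1) (real (b i)) \<tau>) *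
      (\<Prod>j=1..k. (ee (of_int (int (c j) * \<beta> * d) / 8) * (?X (2 * int (c j)) * g)) * y * qseries odd_char (real (c j) / 8) \<tau>)"
    by (intro arg_cong2[of _ _ _ _ "(*)"] prod.cong refl theta Psi) auto
  also have "\<dots> = (\<Prod>j=1..k. ee (of_int (int (c j) * \<beta> * d) / 8)) *
      ((\<Prod>i=1..v. ?X (int (b i))) * (\<Prod>j=1..k. ?X (2 * int (c j)))) * g ^ (v + k) * y ^ (v + k) * theta_product v b k c \<tau>"
    by (simp add: theta_product_def prod.distrib power_add mult_ac)
  \<comment> \<open>The only place where divisibility of the weight sum by 8 enters the law.\<close>
  also have "(\<Prod>j=1..k. ee (of_int (int (c j) * \<beta> * d) / 8)) = 1"
  proof -
    obtain r where r: "(\<Sum>j=1..k. c j) = 8 * r" using h by auto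
    have "(\<Sum>j=1..k. of_int (int (c j) * \<beta> * d) / 8) = real (\<Sum>j=1..k. c j) * of_int (\<beta> * d) / 8"
      by (simp add: sum_divide_distrib sum_distrib_right mult.assoc)
    also have "\<dots> = real_of_int (int r * (\<beta> * d))"
      unfolding r by simp
    finally have "(\<Sum>j=1..k. of_int (int (c j) * \<beta> * d) / 8) = real_of_int (int r * (\<beta> * d))" .
    thus ?thesis by (simp only: ee_sum [symmetric] finite_atLeastAtMost ee_of_int)
  qed
  also have "g ^ (v + k) = (?X (-1) * of_int d) ^ w"
    unfolding w power_mult g_def using gauss_sum_square[OF d(2,1) cop\<beta>] by simp
  also have "y ^ (v + k) = (- \<i> * \<tau>) ^ w"
    unfolding w power_mult y_def by simp
  also have "x ^ (v + k) = ((of_int d)\<^sup>2 * (- \<i> * \<sigma>)) ^ w"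
    unfolding w power_mult x_def by (simp add: power_mult_distrib)
  finally have main: "theta_product v b k c \<tau>' * ((of_int d)\<^sup>2 * (- \<i> * \<sigma>)) ^ w
      = ((\<Prod>i=1..v. ?X (int (b i))) * (\<Prod>j=1..k. ?X (2 * int (c j))) * ?X (-1) ^ w)
         * (of_int d * (- \<i> * \<tau>)) ^ w * theta_product v b k c \<tau>"
    by (simp only: power_mult_distrib mult_ac mult_1_left)
  have X2: "kronecker 2 d * kronecker 2 d = 1"
    using d by (intro kronecker_square) auto
  have "kronecker ?D d = kronecker (-1) d ^ w * kronecker (if even v \<and> even k then 4 else 8) d *
      (\<Prod>i=1..v. kronecker (int (b i)) d) * (\<Prod>j=1..k. kronecker (int (c j)) d)"
    by (simp only: kronecker_mult_left[OF d(2,1)] kronecker_power_left[OF d(2,1)]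
          kronecker_prod_left[OF d(2,1)] finite_atLeastAtMost)
  \<comment> \<open>Each odd series contributes one symbol of 2. Since \<open>v\<close> and
    \<open>k\<close> have equal parity, the constants 4 and 8 record exactly the parity of
    \<open>k\<close>.\<close>
  also have "kronecker (if even v \<and> even k then 4 else 8) d = kronecker 2 d ^ k"
  proof (cases "even k")
    case True
    then obtain n where n: "k = 2 * n" by (elim evenE)
    have "even v" using w True by presburger
    moreover have "kronecker 4 d = 1" using kronecker_mult_left[OF d(2,1), of 2 2] X2 by simp
    ultimately show ?thesis using True X2 by (simp add: n power_mult power2_eq_square)
  next
    case False
    then obtain n where n: "k = 2 * n + 1" by (elim oddE)
    have "kronecker 8 d = kronecker 2 d"
      using kronecker_mult_left[OF d(2,1), of 2 4] kronecker_mult_left[OF d(2,1), of 2 2] X2 by simp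
    thus ?thesis using False X2 by (simp add: n power_add power_mult power2_eq_square)
  qed
  also have "kronecker (-1) d ^ w * kronecker 2 d ^ k * (\<Prod>i=1..v. kronecker (int (b i)) d) * (\<Prod>j=1..k. kronecker (int (c j)) d)
     = (\<Prod>i=1..v. kronecker (int (b i)) d) * (\<Prod>j=1..k. kronecker (2 * int (c j)) d) * kronecker (-1) d ^ w"
    using d by (simp add: kronecker_mult_left prod.distrib mult_ac)
  finally have kron: "?X ?D = (\<Prod>i=1..v. ?X (int (b i))) * (\<Prod>j=1..k. ?X (2 * int (c j))) * ?X (-1) ^ w"
    by (simp only: of_int_mult of_int_prod of_int_power)
  \<comment> \<open>The squares of \<open>x\<close> and \<open>y\<close> differ by this relation,
    which is where the automorphy factor appears.\<close>
  have "of_int d * (- \<i> * \<tau>) = (of_int d)\<^sup>2 * (- \<i> * \<sigma>) * (of_int C * \<tau> + of_int d)"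
    unfolding \<sigma>_def using nz d by (simp add: power2_eq_square)
  hence "theta_product v b k c \<tau>' * ((of_int d)\<^sup>2 * (- \<i> * \<sigma>)) ^ w
      = (?X ?D * (of_int C * \<tau> + of_int d) ^ w * theta_product v b k c \<tau>) * ((of_int d)\<^sup>2 * (- \<i> * \<sigma>)) ^ w"
    unfolding main kron [symmetric] by (simp only: power_mult_distrib mult_ac)
  moreover have "((of_int d)\<^sup>2 * (- \<i> * \<sigma>)) ^ w \<noteq> 0"
    unfolding \<sigma>_def using nz d by simp
  ultimately show ?thesis unfolding \<tau>'_def by (rule mult_right_cancel[THEN iffD1, rotated])
qed

text \<open>The square of the root \<open>y\<close> is \<i> / (C (C \<tau> + d)), so the
  \<open>2 * w\<close> roots absorbed by the factors amount to the automorphy factor to the power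
  -w, up to a constant.\<close>

lemma theta_product_at_cusp:
  fixes a \<beta> C d :: int and b c :: "nat \<Rightarrow> nat"
  assumes det: "a * d - \<beta> * C = 1" and C: "C > 0"
    and b: "\<forall>i\<in>{1..v}. b i > 0" and c: "\<forall>j\<in>{1..k}. c j > 0" and w: "v + k = 2 * w"
  shows "holomorphic_at_ii_inf (\<lambda>\<tau>. (of_int C * \<tau> + of_int d) powi (- int w) *
           theta_product v b k c ((of_int a * \<tau> + of_int \<beta>) / (of_int C * \<tau> + of_int d)))"
proof -
  define M where "M = (\<lambda>\<tau>::complex. (of_int a * \<tau> + of_int \<beta>) / (of_int C * \<tau> + of_int d))"
  define y where "y = (\<lambda>\<tau>::complex. csqrt (- \<i> * (- 1 / (of_int C * (of_int C * \<tau> + of_int d)))))"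
  have "\<exists>Q. holomorphic_at_ii_inf Q \<and> (\<forall>\<tau>\<in>upper_half_plane. qseries (\<lambda>_. 1) (real (b i)) (M \<tau>) * y \<tau> = Q \<tau>)"
    if "i \<in> {1..v}" for i
  proof -
    have "8 * b i > 0" using b that by simp
    from qseries_at_cusp[OF det C this, of "\<lambda>_. 1"] show ?thesis by (simp add: M_def y_def)
  qed
  then obtain Q1 where Q1: "\<And>i. i \<in> {1..v} \<Longrightarrow> holomorphic_at_ii_inf (Q1 i)"
    "\<And>i \<tau>. i \<in> {1..v} \<Longrightarrow> \<tau> \<in> upper_half_plane \<Longrightarrow> qseries (\<lambda>_. 1) (real (b i)) (M \<tau>) * y \<tau> = Q1 i \<tau>"
    by metis
  have "\<exists>Q. holomorphic_at_ii_inf Q \<and> (\<forall>\<tau>\<in>upper_half_plane. qseries odd_char (real (c j) / 8) (M \<tau>) * y \<tau> = Q \<tau>)"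
    if "j \<in> {1..k}" for j
  proof -
    have "c j > 0" using c that by simp
    from qseries_at_cusp[OF det C this, of odd_char] show ?thesis by (simp add: M_def y_def odd_char_def)
  qed
  then obtain Q2 where Q2: "\<And>j. j \<in> {1..k} \<Longrightarrow> holomorphic_at_ii_inf (Q2 j)"
    "\<And>j \<tau>. j \<in> {1..k} \<Longrightarrow> \<tau> \<in> upper_half_plane \<Longrightarrow> qseries odd_char (real (c j) / 8) (M \<tau>) * y \<tau> = Q2 j \<tau>"
    by metis
  have "(of_int C * \<tau> + of_int d) powi (- int w) * theta_product v b k c (M \<tau>)
      = (of_int C / \<i>) ^ w * ((\<Prod>i=1..v. Q1 i \<tau>) * (\<Prod>j=1..k. Q2 j \<tau>))" if \<tau>: "\<tau> \<in> upper_half_plane" for \<tau>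
  proof -
    have nz: "of_int C * \<tau> + of_int d \<noteq> 0" "complex_of_int C \<noteq> 0"
      using automorphy_nonzero[OF \<tau>, of d C] C by auto
    have "(\<Prod>i=1..v. Q1 i \<tau>) * (\<Prod>j=1..k. Q2 j \<tau>) =
        (\<Prod>i=1..v. qseries (\<lambda>_. 1) (real (b i)) (M \<tau>) * y \<tau>) * (\<Prod>j=1..k. qseries odd_char (real (c j) / 8) (M \<tau>) * y \<tau>)"
      by (intro arg_cong2[of _ _ _ _ "(*)"] prod.cong refl) (use \<tau> Q1(2) Q2(2) in auto)
    also have "\<dots> = y \<tau> ^ (v + k) * theta_product v b k c (M \<tau>)"
      by (simp add: theta_product_def prod.distrib power_add mult_ac)
    also have "y \<tau> ^ (v + k) = (\<i> / (of_int C * (of_int C * \<tau> + of_int d))) ^ w"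
      unfolding w power_mult y_def by simp
    finally have "(of_int C / \<i>) ^ w * ((\<Prod>i=1..v. Q1 i \<tau>) * (\<Prod>j=1..k. Q2 j \<tau>))
        = ((of_int C / \<i>) * (\<i> / (of_int C * (of_int C * \<tau> + of_int d)))) ^ w * theta_product v b k c (M \<tau>)"
      by (simp only: power_mult_distrib mult.assoc)
    also have "p / \<i> * (\<i> / (p * z)) = inverse z" if "p \<noteq> 0" "z \<noteq> 0" for p z
      using that by (simp add: field_simps)
    note this[OF nz(2,1)]
    finally show ?thesis by (simp add: power_int_minus power_inverse)
  qed
  moreover have "holomorphic_at_ii_inf (\<lambda>\<tau>. (of_int C / \<i>) ^ w * ((\<Prod>i=1..v. Q1 i \<tau>) * (\<Prod>j=1..k. Q2 j \<tau>)))"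
    by (intro holomorphic_at_ii_inf_mult holomorphic_at_ii_inf_const holomorphic_at_ii_inf_prod finite_atLeastAtMost Q1(1) Q2(1))
  ultimately show ?thesis
    unfolding M_def by (subst holomorphic_at_ii_inf_cong)
qed

lemma kronecker_uminus_right:
  assumes "d < 0"
  shows "kronecker n d = (if n < 0 then -1 else 1) * kronecker n (- d)"
proof -
  have "prime_factorization (- d) = prime_factorization d"
    using prime_factorization_normalize[of d] prime_factorization_normalize[of "- d"] by simp
  thus ?thesis using assms by (simp add: kronecker_def)
qed

lemma complex_minus_divide_minus: "(- p) / (- q) = p / (q :: complex)"
  by simp

lemma moebius_in_upper_half_plane:
  assumes "A \<in> SL2Z" "\<tau> \<in> upper_half_plane"
  shows "moebius A \<tau> \<in> upper_half_plane"
proof -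
  define a \<beta> C d where "a = A $ 1 $ 1" and "\<beta> = A $ 1 $ 2" and "C = A $ 2 $ 1" and "d = A $ 2 $ 2"
  note defs = a_def \<beta>_def C_def d_def
  have det: "a * d - \<beta> * C = 1"
    using assms(1) by (auto simp: SL2Z_def det_2 defs)
  define z where "z = of_int C * \<tau> + of_int d"
  have "d \<noteq> 0 \<or> C \<noteq> 0" using det by auto
  hence "z \<noteq> 0" unfolding z_def by (rule automorphy_nonzero[OF assms(2)])
  hence pos: "(Re z)\<^sup>2 + (Im z)\<^sup>2 > 0"
    by (auto simp: complex_eq_iff sum_power2_gt_zero_iff)
  have "Im (moebius A \<tau>) = Im ((of_int a * \<tau> + of_int \<beta>) / z)"
    by (simp add: moebius_def automorphy_factor_def defs z_def)
  also have "\<dots> = of_int (a * d - \<beta> * C) * Im \<tau> / ((Re z)\<^sup>2 + (Im z)\<^sup>2)"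
    unfolding Im_divide by (simp add: z_def algebra_simps)
  finally show ?thesis
    using pos assms(2) by (simp add: upper_half_plane_def det)
qed

text \<open>For negative \<open>d\<close> the law is applied to \<open>-A\<close>, which acts
  identically but negates the automorphy factor. The resulting \<open>(-1) ^ w\<close> is the unit
  factor of the Kronecker symbol at \<open>d\<close>.\<close>

lemma theta_product_modular:
  fixes b c :: "nat \<Rightarrow> nat" and A :: "int ^ 2 ^ 2"
  assumes A: "A \<in> Gamma0 M" and \<tau>: "\<tau> \<in> upper_half_plane" and M: "even M"
    and b: "\<forall>i\<in>{1..v}. b i > 0 \<and> 4 * b i dvd M"
    and c: "\<forall>j\<in>{1..k}. c j > 0 \<and> 2 * c j dvd M"
    and w: "v + k = 2 * w" and h: "8 dvd (\<Sum>j=1..k. c j)"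
  shows "theta_product v b k c (moebius A \<tau>) =
     of_int (kronecker ((-1) ^ w * (if even v \<and> even k then 4 else 8) *
             (\<Prod>i=1..v. int (b i)) * (\<Prod>j=1..k. int (c j))) (A $ 2 $ 2)) *
     automorphy_factor A \<tau> powi (int w) * theta_product v b k c \<tau>"
    (is "_ = of_int (kronecker ?D _) * _ * _")
proof -
  define a \<beta> C d where "a = A $ 1 $ 1" and "\<beta> = A $ 1 $ 2" and "C = A $ 2 $ 1" and "d = A $ 2 $ 2"
  note defs = a_def \<beta>_def C_def d_def
  have det: "a * d - \<beta> * C = 1" and MC: "int M dvd C"
    using A by (auto simp: Gamma0_def SL2Z_def det_2 defs)
  have "even C" using MC M by (metis dvd_trans even_of_nat_iff)
  hence d: "odd d" using det by (metis dvd_diff dvd_mult odd_one)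
  have "int (4 * b i) dvd C" if "i \<in> {1..v}" for i
    using b that MC dvd_trans of_nat_dvd_iff by metis
  hence b': "\<forall>i\<in>{1..v}. b i > 0 \<and> 4 * int (b i) dvd C"
    using b by simp
  have "int (2 * c j) dvd C" if "j \<in> {1..k}" for j
    using c that MC dvd_trans of_nat_dvd_iff by metis
  hence c': "\<forall>j\<in>{1..k}. c j > 0 \<and> 2 * int (c j) dvd C"
    using c by simp
  have eq: "moebius A \<tau> = (of_int a * \<tau> + of_int \<beta>) / (of_int C * \<tau> + of_int d)"
    "automorphy_factor A \<tau> = of_int C * \<tau> + of_int d"
    by (simp_all add: moebius_def automorphy_factor_def defs)
  show ?thesis
  proof (cases "d > 0")
    case True
    show ?thesis
      using theta_product_transformation[OF det True d \<tau> b' c' w h] by (simp add: eq flip: d_def)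
  next
    case False
    with d have neg: "d < 0" by (cases "d = 0") auto
    \<comment> \<open>All other factors of the discriminant are positive, so its sign is that of
      \<open>(-1) ^ w\<close>.\<close>
    have D: "?D < 0 \<longleftrightarrow> odd w"
    proof -
      have "(\<Prod>i=1..v. int (b i)) > 0" "(\<Prod>j=1..k. int (c j)) > 0"
        using b c by (auto intro!: prod_pos)
      thus ?thesis by (cases "even w") (auto simp: mult_less_0_iff zero_less_mult_iff)
    qed
    have b'': "\<forall>i\<in>{1..v}. b i > 0 \<and> 4 * int (b i) dvd - C" and c'': "\<forall>j\<in>{1..k}. c j > 0 \<and> 2 * int (c j) dvd - C"
      using b' c' by auto
    have det': "(- a) * (- d) - (- \<beta>) * (- C) = 1" and pos: "- d > 0" and odd': "odd (- d)"
      using det neg d by auto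
    have frac: "(of_int (- a) * \<tau> + of_int (- \<beta>)) / (- automorphy_factor A \<tau>) = moebius A \<tau>"
      using complex_minus_divide_minus[of "of_int a * \<tau> + of_int \<beta>" "of_int C * \<tau> + of_int d"] by (simp add: eq)
    have neg_aut: "of_int (- C) * \<tau> + of_int (- d) = - automorphy_factor A \<tau>"
      by (simp add: eq)
    have "theta_product v b k c (moebius A \<tau>) = of_int (kronecker ?D (- d)) * (- automorphy_factor A \<tau>) ^ w * theta_product v b k c \<tau>"
      using theta_product_transformation[OF det' pos odd' \<tau> b'' c'' w h] by (simp only: frac neg_aut)
    moreover have "kronecker ?D d = (-1) ^ w * kronecker ?D (- d)"
      using kronecker_uminus_right[OF neg, of ?D] D by (cases "even w") auto
    hence "complex_of_int (kronecker ?D d) = (-1) ^ w * of_int (kronecker ?D (- d))"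
      by simp
    ultimately show ?thesis
      by (simp add: power_minus[of "automorphy_factor A \<tau>"] mult_ac flip: d_def)
  qed
qed

text \<open>For a negative lower left entry the expansion of \<open>-A\<close> is used; it differs
  by the constant \<open>(-1) ^ w\<close>.\<close>

lemma theta_product_slash_cusp:
  fixes b c :: "nat \<Rightarrow> nat" and A :: "int ^ 2 ^ 2"
  assumes A: "A \<in> SL2Z" "A $ 2 $ 1 \<noteq> 0"
    and b: "\<forall>i\<in>{1..v}. b i > 0" and c: "\<forall>j\<in>{1..k}. c j > 0" and w: "v + k = 2 * w"
  shows "holomorphic_at_ii_inf (slash (int w) (theta_product v b k c) A)"
proof -
  define a \<beta> C d where "a = A $ 1 $ 1" and "\<beta> = A $ 1 $ 2" and "C = A $ 2 $ 1" and "d = A $ 2 $ 2"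
  note defs = a_def \<beta>_def C_def d_def
  have det: "a * d - \<beta> * C = 1"
    using A by (auto simp: SL2Z_def det_2 defs)
  have slash: "slash (int w) (theta_product v b k c) A \<tau> = (of_int C * \<tau> + of_int d) powi (- int w) *
      theta_product v b k c ((of_int a * \<tau> + of_int \<beta>) / (of_int C * \<tau> + of_int d))" for \<tau>
    by (simp add: slash_def moebius_def automorphy_factor_def defs)
  show ?thesis
  proof (cases "C > 0")
    case True
    show ?thesis
      using theta_product_at_cusp[OF det True b c w] by (simp add: slash [abs_def])
  next
    case False
    hence C: "- C > 0" using A(2) by (simp add: C_def)
    have det': "(- a) * (- d) - (- \<beta>) * (- C) = 1" using det by simp
    have eq: "slash (int w) (theta_product v b k c) A \<tau> = (-1) ^ w * ((of_int (- C) * \<tau> + of_int (- d)) powi (- int w) *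
      theta_product v b k c ((of_int (- a) * \<tau> + of_int (- \<beta>)) / (of_int (- C) * \<tau> + of_int (- d))))" for \<tau>
    proof -
      have 1: "of_int (- C) * \<tau> + of_int (- d) = - (of_int C * \<tau> + of_int d)"
        "of_int (- a) * \<tau> + of_int (- \<beta>) = - (of_int a * \<tau> + of_int \<beta>)"
        by simp_all
      have 2: "(- z) powi (- int w) = (-1) ^ w * z powi (- int w)" for z :: complex
        by (cases "even w") (simp_all add: power_int_minus power_minus[of z])
      show ?thesis unfolding slash 1 2 complex_minus_divide_minus by (simp flip: mult.assoc power_mult_distrib)
    qed
    show ?thesis
      using holomorphic_at_ii_inf_mult[OF holomorphic_at_ii_inf_const theta_product_at_cusp[OF det' C b c w], of "(-1) ^ w"]
      by (subst holomorphic_at_ii_inf_cong[OF eq])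
  qed
qed

lemma holomorphic_at_ii_inf_theta_product:
  assumes "\<forall>i\<in>{1..v}. b i > 0" "\<forall>j\<in>{1..k}. c j > 0"
  shows "holomorphic_at_ii_inf (theta_product v b k c)"
proof -
  have "holomorphic_at_ii_inf (qseries (\<lambda>_. 1) (real (b i)))" if "i \<in> {1..v}" for i
    using qseries_holomorphic_at_ii_inf[of "b i" 1 "\<lambda>_. 1" 1] assms that by simp
  moreover have "holomorphic_at_ii_inf (qseries odd_char (real (c j) / 8))" if "j \<in> {1..k}" for j
    using qseries_holomorphic_at_ii_inf[of "c j" 8 odd_char 1] assms that by (simp add: odd_char_def)
  ultimately show ?thesis
    unfolding theta_product_def [abs_def]
    by (intro holomorphic_at_ii_inf_mult holomorphic_at_ii_inf_prod finite_atLeastAtMost) auto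
qed

lemma holomorphic_on_theta_product:
  assumes "\<forall>i\<in>{1..v}. b i > 0" "\<forall>j\<in>{1..k}. c j > 0"
  shows "theta_product v b k c holomorphic_on upper_half_plane"
  unfolding theta_product_def [abs_def]
  by (intro holomorphic_on_mult holomorphic_on_prod qseries_holomorphic[where C = 1])
     (use assms in \<open>auto simp: odd_char_def\<close>)

lemma theta_product_plus_1:
  "theta_product v b k c (\<tau> + 1) = ee (real (\<Sum>j=1..k. c j) / 8) * theta_product v b k c \<tau>"
proof -
  have "(\<Prod>j=1..k. ee (real (c j) / 8)) = ee (real (\<Sum>j=1..k. c j) / 8)"
    by (simp add: sum_divide_distrib ee_sum)
  thus ?thesis
    by (simp add: theta_product_def qseries_one_plus_1 qseries_odd_char_plus_1 prod.distrib mult_ac)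
qed

lemma theta_product_imaginary_unit_nonzero:
  assumes "\<forall>i\<in>{1..v}. b i > 0" "\<forall>j\<in>{1..k}. c j > 0"
  shows "theta_product v b k c \<i> \<noteq> 0"
proof -
  have "qseries (\<lambda>_. 1) (real (b i)) \<i> \<noteq> 0" if "i \<in> {1..v}" for i
    by (rule qseries_imaginary_unit_nonzero) (use assms that in auto)
  moreover have "qseries odd_char (real (c j) / 8) \<i> \<noteq> 0" if "j \<in> {1..k}" for j
    by (rule qseries_imaginary_unit_nonzero) (use assms that in \<open>auto simp: odd_char_def\<close>)
  ultimately show ?thesis by (auto simp: theta_product_def)
qed

theorem theorem1p3:
  fixes v k h M :: nat and b c :: "nat \<Rightarrow> nat" and \<epsilon> :: "int \<Rightarrow> complex"
  assumes "v > 0" and "k > 0" and "even (v + k)"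
    and "\<forall>i\<in>{1..v}. b i \<in> {1, 2, 3, 6}"
    and "\<forall>j\<in>{1..k}. c j \<in> {1, 2, 3, 4, 6}"
    and "h = (\<Sum>j=1..k. c j)"
    and "M = lcm (4 * Lcm (b ` {1..v})) (2 * Lcm (c ` {1..k}))"
    and "\<epsilon> = (\<lambda>d. of_int (kronecker
            ((-1) ^ ((v + k) div 2) * (if even v \<and> even k then 4 else 8) *
             (\<Prod>i=1..v. int (b i)) * (\<Prod>j=1..k. int (c j))) d))"
  shows "(\<lambda>\<tau>. q_pow \<tau> (real h / 8) * psi_prod v b k c \<tau>)
           \<in> modular_forms (int ((v + k) div 2)) M \<epsilon>
         \<longleftrightarrow> [h = 0] (mod 8)"
proof -
  define w where "w = (v + k) div 2"
  have w: "v + k = 2 * w" using assms(3) by (simp add: w_def)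
  define F where "F = (\<lambda>\<tau>. q_pow \<tau> (real h / 8) * psi_prod v b k c \<tau>)"
  let ?P = "theta_product v b k c"
  have b: "\<forall>i\<in>{1..v}. b i > 0" and c: "\<forall>j\<in>{1..k}. c j > 0"
    using assms(4,5) by auto
  have F: "F \<tau> = ?P \<tau> / 2 ^ k" if "\<tau> \<in> upper_half_plane" for \<tau>
    unfolding F_def by (rule q_pow_psi_prod_eq[OF that c assms(6)])
  show ?thesis
    unfolding F_def [symmetric] w_def [symmetric]
  proof
    assume "F \<in> modular_forms (int w) M \<epsilon>"
    hence law: "F (moebius A \<tau>) = \<epsilon> (A $ 2 $ 2) * automorphy_factor A \<tau> powi (int w) * F \<tau>"
      if "A \<in> Gamma0 M" "\<tau> \<in> upper_half_plane" for A \<tau>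
      using that by (auto simp: modular_forms_def)
    define T :: "int ^ 2 ^ 2" where "T = vector [vector [1, 1], vector [0, 1]]"
    have T: "T $ 1 $ 1 = 1" "T $ 1 $ 2 = 1" "T $ 2 $ 1 = 0" "T $ 2 $ 2 = 1"
      by (simp_all add: T_def)
    have "T \<in> Gamma0 M" by (simp add: Gamma0_def SL2Z_def det_2 T)
    \<comment> \<open>At 1 the symbol is an empty product.\<close>
    moreover have "\<epsilon> 1 = 1" by (simp add: assms(8) kronecker_def)
    moreover have i: "\<i> \<in> upper_half_plane" "\<i> + 1 \<in> upper_half_plane" by (simp_all add: upper_half_plane_def)
    ultimately have "F (\<i> + 1) = F \<i>"
      using law[of T \<i>] by (simp add: moebius_def automorphy_factor_def T)
    hence "?P (\<i> + 1) = ?P \<i>" using F i by simp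
    hence "ee (real h / 8) = 1"
      using theta_product_plus_1[of v b k c \<i>] theta_product_imaginary_unit_nonzero[OF b c] assms(6) by simp
    then obtain n :: int where "real h / 8 = of_int n"
      by (auto simp: ee_eq_1_iff elim!: Ints_cases)
    hence "real_of_int (int h) = of_int (8 * n)" by simp
    hence "int h = 8 * n" by linarith
    hence "int 8 dvd int h" by simp
    hence "8 dvd h" by (simp only: of_nat_dvd_iff)
    thus "[h = 0] (mod 8)" by (simp add: cong_0_iff)
  next
    assume "[h = 0] (mod 8)"
    hence h: "8 dvd (\<Sum>j=1..k. c j)" by (simp add: cong_0_iff assms(6))
    have "4 * b i dvd M" if "i \<in> {1..v}" for i
      unfolding assms(7) using that by (intro dvd_lcmI1 mult_dvd_mono dvd_Lcm) auto
    hence b': "\<forall>i\<in>{1..v}. b i > 0 \<and> 4 * b i dvd M" using b by blast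
    have "2 * c j dvd M" if "j \<in> {1..k}" for j
      unfolding assms(7) using that by (intro dvd_lcmI2 mult_dvd_mono dvd_Lcm) auto
    hence c': "\<forall>j\<in>{1..k}. c j > 0 \<and> 2 * c j dvd M" using c by blast
    have M: "even M" by (simp add: assms(7))
    have law: "F (moebius A \<tau>) = \<epsilon> (A $ 2 $ 2) * automorphy_factor A \<tau> powi (int w) * F \<tau>"
      if A: "A \<in> Gamma0 M" and \<tau>: "\<tau> \<in> upper_half_plane" for A \<tau>
    proof -
      have "A \<in> SL2Z" using A by (simp add: Gamma0_def)
      thus ?thesis
        using theta_product_modular[OF A \<tau> M b' c' w h] F[OF \<tau>] F[OF moebius_in_upper_half_plane[OF _ \<tau>, of A]]
        by (simp add: assms(8) w)
    qed
    have hol: "holomorphic_at_ii_inf F"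
      using holomorphic_at_ii_inf_mult[OF holomorphic_at_ii_inf_const holomorphic_at_ii_inf_theta_product[OF b c], of "1 / 2 ^ k"]
      by (subst holomorphic_at_ii_inf_cong[OF F]) simp_all
    have "holomorphic_at_ii_inf (slash (int w) F A)" if A: "A \<in> SL2Z" for A
    \<comment> \<open>The expansion at a cusp divides by the lower left entry. If that entry is 0,
      the matrix lies in the group of every level, and the transformation law makes the slashed
      function a constant multiple of \<open>F\<close>.\<close>
    proof (cases "A $ 2 $ 1 = 0")
      case True
      have A0: "A \<in> Gamma0 M" using A True by (simp add: Gamma0_def)
      have "A $ 2 $ 2 \<noteq> 0" using A True by (auto simp: SL2Z_def det_2)
      hence "slash (int w) F A \<tau> = \<epsilon> (A $ 2 $ 2) * F \<tau>" if "\<tau> \<in> upper_half_plane" for \<tau>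
        using law[OF A0 that] True by (simp add: slash_def automorphy_factor_def power_int_minus)
      with holomorphic_at_ii_inf_mult[OF holomorphic_at_ii_inf_const hol, of "\<epsilon> (A $ 2 $ 2)"]
      show ?thesis by (subst holomorphic_at_ii_inf_cong)
    next
      case False
      have "slash (int w) F A \<tau> = 1 / 2 ^ k * slash (int w) ?P A \<tau>" if "\<tau> \<in> upper_half_plane" for \<tau>
        using F[OF moebius_in_upper_half_plane[OF A that]] by (simp add: slash_def)
      with holomorphic_at_ii_inf_mult[OF holomorphic_at_ii_inf_const theta_product_slash_cusp[OF A False b c w], of "1 / 2 ^ k"]
      show ?thesis by (subst holomorphic_at_ii_inf_cong)
    qed
    moreover have "F holomorphic_on upper_half_plane"
    proof -
      have "(\<lambda>\<tau>. ?P \<tau> / 2 ^ k) holomorphic_on upper_half_plane"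
        by (intro holomorphic_intros holomorphic_on_theta_product[OF b c]) auto
      thus ?thesis by (subst holomorphic_cong[OF refl F])
    qed
    ultimately show "F \<in> modular_forms (int w) M \<epsilon>"
      using law by (auto simp: modular_forms_def)
  qed
qed

end
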